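(* Let $G$ be a graph. Then $G$ is both a circular-arc graph and a minimal forbidden induced subgraph for the class of Helly circular-arc graphs if and only if $G$ is an essential obstacle.
   Context: All graphs are finite, undirected, without loops or multiple edges. A circular-arc graph is the intersection graph of a finite set of arcs on a circle (such a set is a circular-arc model of the graph). A Helly circular-arc graph is a graph having a circular-arc model with the Helly property (every nonempty subfamily of pairwise intersecting arcs has a common point). A minimal forbidden induced subgraph for a hereditary class is a graph not in the class all of whose proper induced subgraphs are in the class. $\overline N_G(v)$ denotes the set of vertices of $G$ different from $v$ and nonadjacent to $v$. An obstacle enumeration in a graph $G$ is a circular enumeration $\mathcal Q=v_1,\ldots,v_k$ of $k\ge 3$ pairwise different vertices such that $Q=\{v_1,\ldots,v_k\}$ is a clique of $G$, together with, for each $i\in\{1,\ldots,k\}$, a linear enumeration $\mathcal W_i$ (the witness enumeration of $v_iv_{i+1}$) of one or two vertices of $G$ such that (indices modulo $k$) either $(\mathcal O_1)$ $\mathcal W_i=w_i$ where $\overline N_G(w_i)\cap Q=\{v_i,v_{i+1}\}$; or $(\mathcal O_2)$ $\mathcal W_i=u_i,z_i$ where $\overline N_G(u_i)\cap Q=\{v_i\}$, $\overline N_G(z_i)\cap Q=\{v_{i+1}\}$, and $u_iz_i\in E(G)$. Witness enumerations of different edges may share vertices. The vertices occurring in $\mathcal W_1,\ldots,\mathcal W_k$ are the witnesses of $\mathcal Q$. $\mathcal Q$ is an obstacle enumeration of $G$ if every vertex of $G$ belongs to $Q$ or is a witness of $\mathcal Q$. An obstacle is a graph having an obstacle enumeration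 of it. An edge $y_1y_2$ of $G$ joining two witnesses is valid if either one of $\overline N_G(y_1)\cap Q$ and $\overline N_G(y_2)\cap Q$ is a subset of the other, or $y_1$ and $y_2$ occur together in some witness enumeration of $\mathcal Q$. An obstacle enumeration is essential if every edge joining two of its witnesses is valid. An obstacle is essential if there is an essential obstacle enumeration of it. *)

theory Defs
  imports Complex_Main "Graph_Theory.Digraph_Component"
begin

text \<open>
  A finite simple graph is a digraph satisfying the locale predicate \<open>Digraph.graph\<close> (finite,
  symmetric, without loops or parallel arcs); \<open>u \<rightarrow>\<^bsub>G\<^esub> v\<close> is the adjacency relation.
\<close>

text \<open>
  Arcs are closed, have distinct endpoints and are proper subsets of the unit circle.
\<close>

definition circle_arc :: "complex set \<Rightarrow> bool" where
  "circle_arc X \<longleftrightarrow> (\<exists>a b :: real. a < b \<and> b < a + 2 * pi \<and> X = cis ` {a..b})"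

text \<open>
  A model is a set of arcs, the vertices being in bijection with the arcs; hence the injectivity.
\<close>

definition circular_arc_model :: "('a, 'b) pre_digraph \<Rightarrow> ('a \<Rightarrow> complex set) \<Rightarrow> bool" where
  "circular_arc_model G A \<longleftrightarrow>
     inj_on A (verts G) \<and>
     (\<forall>v \<in> verts G. circle_arc (A v)) \<and>
     (\<forall>u \<in> verts G. \<forall>v \<in> verts G. u \<noteq> v \<longrightarrow> (u \<rightarrow>\<^bsub>G\<^esub> v \<longleftrightarrow> A u \<inter> A v \<noteq> {}))"

definition circular_arc_graph :: "('a, 'b) pre_digraph \<Rightarrow> bool" where
  "circular_arc_graph G \<longleftrightarrow> Digraph.graph G \<and> (\<exists>A. circular_arc_model G A)"

definition helly_family :: "'p set set \<Rightarrow> bool" where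
  "helly_family \<F> \<longleftrightarrow>
     (\<forall>\<S> \<subseteq> \<F>. \<S> \<noteq> {} \<longrightarrow> (\<forall>X \<in> \<S>. \<forall>Y \<in> \<S>. X \<inter> Y \<noteq> {}) \<longrightarrow> \<Inter>\<S> \<noteq> {})"

definition helly_circular_arc_graph :: "('a, 'b) pre_digraph \<Rightarrow> bool" where
  "helly_circular_arc_graph G \<longleftrightarrow>
     Digraph.graph G \<and> (\<exists>A. circular_arc_model G A \<and> helly_family (A ` verts G))"

definition minimal_forbidden_induced_subgraph ::
    "(('a, 'b) pre_digraph \<Rightarrow> bool) \<Rightarrow> ('a, 'b) pre_digraph \<Rightarrow> bool" where
  "minimal_forbidden_induced_subgraph C G \<longleftrightarrow>
     \<not> C G \<and> (\<forall>H. induced_subgraph H G \<and> H \<noteq> G \<longrightarrow> C H)"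

definition non_neighbours :: "('a, 'b) pre_digraph \<Rightarrow> 'a \<Rightarrow> 'a set" where
  "non_neighbours G v = {u \<in> verts G. u \<noteq> v \<and> \<not> v \<rightarrow>\<^bsub>G\<^esub> u}"

definition clique :: "('a, 'b) pre_digraph \<Rightarrow> 'a set \<Rightarrow> bool" where
  "clique G Q \<longleftrightarrow> Q \<subseteq> verts G \<and> (\<forall>u \<in> Q. \<forall>v \<in> Q. u \<noteq> v \<longrightarrow> u \<rightarrow>\<^bsub>G\<^esub> v)"

text \<open>
  A vertex \<open>x\<close> and the following vertex \<open>y\<close> of the circular enumeration of the clique \<open>Q\<close>;
  \<open>ws\<close> is the witness enumeration of the edge joining them.
\<close>

definition witness_enumeration ::
    "('a, 'b) pre_digraph \<Rightarrow> 'a set \<Rightarrow> 'a \<Rightarrow> 'a \<Rightarrow> 'a list \<Rightarrow> bool" where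
  "witness_enumeration G Q x y ws \<longleftrightarrow>
     set ws \<subseteq> verts G \<and>
     ((\<exists>w. ws = [w] \<and> non_neighbours G w \<inter> Q = {x, y}) \<or>
      (\<exists>u z. ws = [u, z] \<and> non_neighbours G u \<inter> Q = {x} \<and>
             non_neighbours G z \<inter> Q = {y} \<and> u \<rightarrow>\<^bsub>G\<^esub> z))"

text \<open>
  The circular enumeration is a list \<open>vs\<close> read cyclically, with indices \<open>0, \<dots>, k - 1\<close>;
  \<open>Ws ! i\<close> is the witness enumeration of the edge from \<open>vs ! i\<close> to its cyclic successor.
\<close>

definition obstacle_enumeration_in ::
    "('a, 'b) pre_digraph \<Rightarrow> 'a list \<Rightarrow> 'a list list \<Rightarrow> bool" where
  "obstacle_enumeration_in G vs Ws \<longleftrightarrow>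
     length vs \<ge> 3 \<and> distinct vs \<and> clique G (set vs) \<and> length Ws = length vs \<and>
     (\<forall>i < length vs.
        witness_enumeration G (set vs) (vs ! i) (vs ! ((i + 1) mod length vs)) (Ws ! i))"

definition witnesses :: "'a list list \<Rightarrow> 'a set" where
  "witnesses Ws = (\<Union>ws \<in> set Ws. set ws)"

definition obstacle_enumeration_of ::
    "('a, 'b) pre_digraph \<Rightarrow> 'a list \<Rightarrow> 'a list list \<Rightarrow> bool" where
  "obstacle_enumeration_of G vs Ws \<longleftrightarrow>
     obstacle_enumeration_in G vs Ws \<and> verts G \<subseteq> set vs \<union> witnesses Ws"

definition valid_edge ::
    "('a, 'b) pre_digraph \<Rightarrow> 'a list \<Rightarrow> 'a list list \<Rightarrow> 'a \<Rightarrow> 'a \<Rightarrow> bool" where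
  "valid_edge G vs Ws y1 y2 \<longleftrightarrow>
     non_neighbours G y1 \<inter> set vs \<subseteq> non_neighbours G y2 \<inter> set vs \<or>
     non_neighbours G y2 \<inter> set vs \<subseteq> non_neighbours G y1 \<inter> set vs \<or>
     (\<exists>ws \<in> set Ws. y1 \<in> set ws \<and> y2 \<in> set ws)"

definition essential_obstacle_enumeration_of ::
    "('a, 'b) pre_digraph \<Rightarrow> 'a list \<Rightarrow> 'a list list \<Rightarrow> bool" where
  "essential_obstacle_enumeration_of G vs Ws \<longleftrightarrow>
     obstacle_enumeration_of G vs Ws \<and>
     (\<forall>y1 \<in> witnesses Ws. \<forall>y2 \<in> witnesses Ws. y1 \<rightarrow>\<^bsub>G\<^esub> y2 \<longrightarrow> valid_edge G vs Ws y1 y2)"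

definition essential_obstacle :: "('a, 'b) pre_digraph \<Rightarrow> bool" where
  "essential_obstacle G \<longleftrightarrow>
     Digraph.graph G \<and> (\<exists>vs Ws. essential_obstacle_enumeration_of G vs Ws)"

end

theory Submission
  imports Defs
begin

text \<open>
  Arcs are lifted to periodic subsets of the integers, so that representations become finite objects.
  An obstacle admits no Helly representation: a common point of the clique cuts the circle open, the
  vertices of the clique then become complements of intervals, and the leftmost of the points
  contributed by the witness enumerations contradicts the convexity of one of these intervals.

  Conversely, choose a representation of a circular-arc graph with as many vertex sets having a common
  point as possible and then with maximal arcs. If it is not Helly, a minimal clique without a common
  point, ordered by the points missed by its members, is the clique of an obstacle: maximality of the
  arcs provides a non-neighbour of \<open>v\<close> next to either end of the gap of \<open>v\<close>, and maximality of the
  number of common points makes the gaps of consecutive vertices overlap.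
  In a minimal forbidden graph this obstacle is everything, and exchanging witnesses along an invalid
  edge would give a smaller one.

  In an essential obstacle the edges between witnesses join cyclically consecutive ones only, which
  gives an explicit representation. After removal of a vertex its cliques have common points, unless
  three witnesses form a triangle. Then the graph is the octahedron, in which the roles of the clique
  and of the witnesses can be exchanged.
\<close>

subsection \<open>Cyclically convex sets\<close>

text \<open>Periodic subsets of an ordered ring let one notion serve twice: over the reals for the
  lifted models, where an obstacle is refuted, and over the integers for representations that are
  optimised or built by hand. The circumference has to vary while common points are counted, because
  a new common point is created between two neighbouring integers by doubling the circle. The two
  optimisations do not conflict: enlarging arcs never destroys a common point. Three pairwise
  adjacent witnesses are the exceptional case because in the explicit representation a point belongs
  to at most two witnesses. Deleting a witness does no harm even then, since only three exist; but
  deleting a clique vertex leaves the triangle intact. The locale used there speaks of sequences and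
  adjacency only, so the octahedron satisfies it a second time with clique and witnesses
  interchanged, and the vertex to be deleted becomes a witness.\<close>

text \<open>
  \<open>cyc_convex m A\<close> says that \<open>A\<close> is the preimage of an arc of a circle of circumference \<open>m\<close> (possibly
  empty or the whole circle): no two points of \<open>A\<close> separate two points outside \<open>A\<close>.
\<close>

definition cyc_convex :: "'t::linordered_idom \<Rightarrow> 't set \<Rightarrow> bool" where
  "cyc_convex m A \<longleftrightarrow> (\<forall>x. x + m \<in> A \<longleftrightarrow> x \<in> A) \<and>
     \<not> (\<exists>x p y q. x < p \<and> p < y \<and> y < q \<and> q < x + m \<and> x \<in> A \<and> y \<in> A \<and> p \<notin> A \<and> q \<notin> A)"

lemma cyc_convexD:
  assumes "cyc_convex m A" "x < p" "p < y" "y < q" "q < x + m" "x \<in> A" "y \<in> A" "p \<notin> A"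
  shows "q \<in> A"
  using assms unfolding cyc_convex_def by blast

lemma cyc_convex_shift1: "cyc_convex m A \<Longrightarrow> x + m \<in> A \<longleftrightarrow> x \<in> A"
  unfolding cyc_convex_def by blast

lemma cyc_convex_shift:
  fixes j :: int
  assumes "cyc_convex m A"
  shows "x + of_int j * m \<in> A \<longleftrightarrow> x \<in> A"
proof (induction j arbitrary: x rule: int_induct[where k = 0])
  case base
  show ?case by simp
next
  case (step1 i)
  have "x + of_int (i + 1) * m = x + of_int i * m + m" by (simp add: algebra_simps)
  then show ?case using step1 cyc_convex_shift1[OF assms] by metis
next
  case (step2 i)
  have "x + of_int i * m = x + of_int (i - 1) * m + m" by (simp add: algebra_simps)
  then show ?case using step2 cyc_convex_shift1[OF assms] by metis
qed

text \<open>The alternating pattern of four points is cyclic: read from its second point on and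
  closed with \<open>x + m\<close>, it interchanges the set and its complement.\<close>

lemma cyc_convex_Compl:
  assumes "cyc_convex m A" shows "cyc_convex m (- A)"
proof -
  have False if "x < p" "p < y" "y < q" "q < x + m" "x \<notin> A" "y \<notin> A" "p \<in> A" "q \<in> A" for x p y q
  proof -
    have "x + m < p + m" "x + m \<notin> A" using that cyc_convex_shift1[OF assms] by auto
    then show False using cyc_convexD[OF assms that(2,3,4)] that by blast
  qed
  then show ?thesis using cyc_convex_shift1[OF assms] unfolding cyc_convex_def by fast
qed

text \<open>With \<open>a = b\<close> this is the orbit of one point under translation by
  \<open>m\<close>, the form in which single positions are added to an arc or taken from it.\<close>

definition cyc_interval :: "'t::linordered_idom \<Rightarrow> 't \<Rightarrow> 't \<Rightarrow> 't set" where
  "cyc_interval m a b = {t. \<exists>j::int. a \<le> t + of_int j * m \<and> t + of_int j * m \<le> b}"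

lemma cyc_intervalI: "a \<le> t + of_int j * m \<Longrightarrow> t + of_int j * m \<le> b \<Longrightarrow> t \<in> cyc_interval m a b"
  unfolding cyc_interval_def by blast

lemma cyc_intervalE:
  assumes "t \<in> cyc_interval m a b"
  obtains j :: int where "a \<le> t + of_int j * m" "t + of_int j * m \<le> b"
  using assms unfolding cyc_interval_def by blast

lemma cyc_interval_shift1: "t + m \<in> cyc_interval m a b \<longleftrightarrow> t \<in> cyc_interval m a b"
proof -
  have 1: "t + m + of_int j * m = t + of_int (j + 1) * m" 
          "t + of_int j * m = t + m + of_int (j - 1) * m" for j :: int
    by (simp_all add: algebra_simps)
  show ?thesis unfolding cyc_interval_def mem_Collect_eq using 1 by metis
qed

text \<open>Translate \<open>x\<close> into the interval. As \<open>p\<close> is missing it falls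
  beyond \<open>b\<close>, so \<open>y\<close> reaches the interval only in an earlier period;
  \<open>q\<close>, squeezed between \<open>y\<close> and \<open>x + m\<close>, is then caught one
  period before \<open>x\<close>.\<close>

lemma cyc_convex_cyc_interval:
  fixes m :: "'t::linordered_idom"
  assumes "0 < m" shows "cyc_convex m (cyc_interval m a b)"
proof -
  let ?A = "cyc_interval m a b"
  have False if h: "x < p" "p < y" "y < q" "q < x + m" "x \<in> ?A" "y \<in> ?A" "p \<notin> ?A" "q \<notin> ?A" for x p y q
  proof -
    obtain j where j: "a \<le> x + of_int j * m" "x + of_int j * m \<le> b"
      using h(5) unfolding cyc_interval_def by blast
    obtain i where i: "a \<le> y + of_int i * m" "y + of_int i * m \<le> b"
      using h(6) unfolding cyc_interval_def by blast
    have pb: "b < p + of_int j * m" using h(1,7) j cyc_intervalI[of a p j m b] by force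
    have "i < j"
    proof (rule ccontr)
      assume "\<not> i < j"
      then have "of_int j * m \<le> of_int i * m" using assms by simp
      then show False using pb i h(2) by simp
    qed
    then have "of_int (i + 1) * m \<le> of_int j * m" using assms by (simp del: of_int_add)
    then have "of_int i * m + m \<le> of_int j * m" by (simp add: algebra_simps)
    then have 1: "a \<le> q + of_int (j - 1) * m" using i(1) h(3) by (simp add: algebra_simps)
    have "q + of_int (j - 1) * m \<le> b" using h(4) j(2) by (simp add: algebra_simps)
    then show False using 1 h(8) cyc_intervalI by blast
  qed
  then show ?thesis using cyc_interval_shift1 unfolding cyc_convex_def by blast
qed

text \<open>An inserted point in an alternating pattern can be replaced by its neighbour in
  \<open>A\<close>. The strict order survives the replacement, because \<open>p\<close> and
  \<open>q\<close> lie outside \<open>A\<close> and so differ from the new points.\<close>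

lemma cyc_convex_insert:
  fixes m n d :: int
  assumes A: "cyc_convex m A" and d: "d = 1 \<or> d = - 1" and n: "n + d \<in> A"
  shows "cyc_convex m (A \<union> cyc_interval m n n)"
proof -
  let ?B = "A \<union> cyc_interval m n n"
  have nb: "x + d \<in> A" if x: "x \<in> ?B" "x \<notin> A" for x
  proof -
    obtain j :: int where "x + j * m = n" using x unfolding cyc_interval_def by (auto intro: antisym)
    then have "x + d + j * m = n + d" by simp
    then show ?thesis using n cyc_convex_shift[OF A, of "x + d" j] by (metis of_int_eq_id id_apply)
  qed
  have False if h: "x < p" "p < y" "y < q" "q < x + m" "x \<in> ?B" "y \<in> ?B" "p \<notin> ?B" "q \<notin> ?B" for x p y q
  proof -
    obtain x' where x': "x' \<in> A" "x' = x \<or> x' = x + d" using nb h(5) by auto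
    obtain y' where y': "y' \<in> A" "y' = y \<or> y' = y + d" using nb h(6) by auto
    have ne: "x' \<noteq> p" "p \<noteq> y'" "y' \<noteq> q" "q \<noteq> x' + m"
      using x'(1) y'(1) h(7,8) cyc_convex_shift1[OF A] by auto
    have "x' < p" "p < y'" "y' < q" "q < x' + m" using ne x'(2) y'(2) d h(1-4) by auto
    then show False using cyc_convexD[OF A] x' y' h(7,8) by blast
  qed
  moreover have "x + m \<in> ?B \<longleftrightarrow> x \<in> ?B" for x
    using cyc_convex_shift1[OF A] cyc_interval_shift1 by blast
  ultimately show ?thesis unfolding cyc_convex_def by blast
qed

text \<open>Cutting the circle at some \<open>n\<close> outside \<open>A\<close> leaves a window in
  which \<open>A\<close> has a least and a greatest element. A hole between these, together with
  \<open>n + m\<close>, would form the forbidden pattern.\<close>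

lemma cyc_convex_is_cyc_interval:
  fixes m :: int
  assumes A: "cyc_convex m A" and m: "0 < m" and ne: "A \<noteq> {}"
  obtains s e where "s \<le> e" "e < s + m" "A = cyc_interval m s e"
proof (cases "A = UNIV")
  case True
  have "t \<in> cyc_interval m 0 (m - 1)" for t
    using m by (intro cyc_intervalI[of _ _ "- (t div m)"]) (simp_all add: minus_div_mult_eq_mod)
  then have "A = cyc_interval m 0 (m - 1)" using True by auto
  then show ?thesis using that[of 0 "m - 1"] m by simp
next
  case False
  then obtain n where n: "n \<notin> A" by blast
  obtain a where a: "a \<in> A" using ne by blast
  have window: "\<exists>j. n \<le> t + j * m \<and> t + j * m < n + m" for t
  proof -
    have "t + (- ((t - n) div m)) * m = n + (t - n) mod m" by (simp add: algebra_simps mod_mult_div_eq minus_div_mult_eq_mod[symmetric])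
    then show ?thesis using m pos_mod_bound[OF m, of "t - n"] pos_mod_sign[OF m, of "t - n"] by (metis add_le_cancel_left add.right_neutral add_less_cancel_left)
  qed
  define S where "S = A \<inter> {n..<n + m}"
  have fin: "finite S" unfolding S_def by simp
  have "S \<noteq> {}"
  proof -
    obtain j where "n \<le> a + j * m" "a + j * m < n + m" using window by blast
    moreover have "a + j * m \<in> A" using cyc_convex_shift[OF A, of a j] a by simp
    ultimately show ?thesis unfolding S_def by auto
  qed
  define s where "s = Min S"
  define e where "e = Max S"
  have sS: "s \<in> S" and eS: "e \<in> S" using Min_in Max_in fin \<open>S \<noteq> {}\<close> unfolding s_def e_def by auto
  have se: "s \<le> e" using sS fin unfolding e_def by simp
  have sn: "n < s" using sS n unfolding S_def by (cases "s = n") auto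
  have em: "e < s + m" using eS sn unfolding S_def by auto
  have mid: "t \<in> A" if "s \<le> t" "t \<le> e" for t
  proof (rule ccontr)
    assume t: "t \<notin> A"
    then have "s < t" "t < e" using that sS eS unfolding S_def by (auto simp: le_less)
    moreover have "e < n + m" "n + m < s + m" "n + m \<notin> A" using eS sn n cyc_convex_shift1[OF A] unfolding S_def by auto
    ultimately show False using cyc_convexD[OF A _ _ _ _ _ _ t] sS eS unfolding S_def by blast
  qed
  have "A = cyc_interval m s e"
  proof (intro set_eqI iffI)
    fix t assume "t \<in> A"
    obtain j where j: "n \<le> t + j * m" "t + j * m < n + m" using window by blast
    then have "t + j * m \<in> S" using cyc_convex_shift[OF A, of t j] \<open>t \<in> A\<close> unfolding S_def by simp
    then have "s \<le> t + j * m" "t + j * m \<le> e" using fin unfolding s_def e_def by simp_all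
    then show "t \<in> cyc_interval m s e" using cyc_intervalI[of s t j m e] by simp
  next
    fix t assume "t \<in> cyc_interval m s e"
    then obtain j where "s \<le> t + j * m" "t + j * m \<le> e" unfolding cyc_interval_def by auto
    then have "t + j * m \<in> A" using mid by blast
    then show "t \<in> A" using cyc_convex_shift[OF A, of t j] by simp
  qed
  then show ?thesis using that se em by blast
qed

text \<open>Unlike in \<open>circular_arc_model\<close>, a set may be the whole line and vertices
  may share a set, so arcs can be enlarged freely; the integer representations get proper and
  distinct arcs again in \<open>arc_rep_realize\<close>.\<close>

definition arc_rep :: "'a set \<Rightarrow> ('a \<Rightarrow> 'a \<Rightarrow> bool) \<Rightarrow> 't::linordered_idom \<Rightarrow> ('a \<Rightarrow> 't set) \<Rightarrow> bool" where
  "arc_rep V E m A \<longleftrightarrow> 0 < m \<and> (\<forall>v\<in>V. cyc_convex m (A v) \<and> A v \<noteq> {}) \<and>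
     (\<forall>u\<in>V. \<forall>v\<in>V. u \<noteq> v \<longrightarrow> (E u v \<longleftrightarrow> A u \<inter> A v \<noteq> {}))"

definition helly_rep :: "'a set \<Rightarrow> ('a \<Rightarrow> 'a \<Rightarrow> bool) \<Rightarrow> ('a \<Rightarrow> 't set) \<Rightarrow> bool" where
  "helly_rep V E A \<longleftrightarrow>
     (\<forall>K \<subseteq> V. (\<forall>u\<in>K. \<forall>v\<in>K. u \<noteq> v \<longrightarrow> E u v) \<longrightarrow> (\<exists>t. \<forall>v\<in>K. t \<in> A v))"

lemma arc_repD:
  assumes "arc_rep V E m A"
  shows "0 < m" "\<And>v. v \<in> V \<Longrightarrow> cyc_convex m (A v)" "\<And>v. v \<in> V \<Longrightarrow> A v \<noteq> {}"
    "\<And>u v t. u \<in> V \<Longrightarrow> v \<in> V \<Longrightarrow> t \<in> A u \<Longrightarrow> t \<in> A v \<Longrightarrow> u \<noteq> v \<Longrightarrow> E u v"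
    "\<And>u v. u \<in> V \<Longrightarrow> v \<in> V \<Longrightarrow> u \<noteq> v \<Longrightarrow> E u v \<Longrightarrow> \<exists>t. t \<in> A u \<and> t \<in> A v"
  using assms unfolding arc_rep_def by blast+

lemma arc_rep_subset: "arc_rep V E m A \<Longrightarrow> W \<subseteq> V \<Longrightarrow> arc_rep W E m A"
  unfolding arc_rep_def by blast

lemma helly_rep_subset: "helly_rep V E A \<Longrightarrow> W \<subseteq> V \<Longrightarrow> helly_rep W E A"
  unfolding helly_rep_def by (meson subset_trans)

text \<open>Serves to number the left endpoints when arcs are made discrete and to order a clique by
  the points its members miss. The quotient of an index by \<open>card P\<close> counts periods, the
  remainder selects from the sorted list.\<close>

lemma ex_periodic_enumeration:
  fixes P :: "'t::linordered_idom set" and m :: 't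
  assumes fin: "finite P" and ne: "P \<noteq> {}" and P: "P \<subseteq> {0..<m}"
  obtains g :: "int \<Rightarrow> 't" where "strict_mono g"
    "\<And>i j. g (i + j * int (card P)) = g i + of_int j * m"
    "\<And>i. \<exists>j::int. g i + of_int j * m \<in> P" "P \<subseteq> range g"
proof -
  define k where "k = int (card P)"
  define L where "L = sorted_list_of_set P"
  define g where "g i = L ! nat (i mod k) + of_int (i div k) * m" for i
  have k: "0 < k" using fin ne unfolding k_def by (simp add: card_gt_0_iff)
  have L: "set L = P" "length L = card P" "sorted_wrt (<) L"
    using fin unfolding L_def by (auto simp: strict_sorted_list_of_set)
  have idx: "nat (i mod k) < length L" for i
    using k pos_mod_bound[OF k, of i] unfolding L(2) k_def by (simp add: nat_less_iff)
  have inP: "L ! nat (i mod k) \<in> P" for i using idx L(1) nth_mem by blast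
  then have bnd: "0 \<le> L ! nat (i mod k) \<and> L ! nat (i mod k) < m" for i using P by (meson atLeastLessThan_iff subsetD)
  have m: "0 < m" using bnd[of 0] by (meson le_less_trans)
  have mono: "strict_mono g"
  proof (rule strict_monoI)
    fix i j :: int assume "i < j"
    show "g i < g j"
    proof (cases "i div k = j div k")
      case True
      have "i mod k < j mod k" using \<open>i < j\<close> True
        by (metis add_less_cancel_left mult_div_mod_eq)
      then have "nat (i mod k) < nat (j mod k)" using pos_mod_sign[OF k, of i] by linarith
      then have "L ! nat (i mod k) < L ! nat (j mod k)" using L(3) idx[of j] by (simp add: sorted_wrt_iff_nth_less)
      then show ?thesis unfolding g_def True by simp
    next
      case False
      have "i div k \<le> j div k" using \<open>i < j\<close> k by (intro zdiv_mono1) auto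
      then have "i div k + 1 \<le> j div k" using False by simp
      then have "of_int (i div k + 1) * m \<le> of_int (j div k) * m"
        using m by (intro mult_right_mono) (simp_all del: of_int_add)
      then have "of_int (i div k) * m + m \<le> of_int (j div k) * m" by (simp add: algebra_simps)
      then show ?thesis using bnd[of i] bnd[of j] unfolding g_def by simp
    qed
  qed
  have per: "g (i + j * k) = g i + of_int j * m" for i j
    using k unfolding g_def by (simp add: algebra_simps)
  have cls: "\<exists>j::int. g i + of_int j * m \<in> P" for i
    using inP[of i] by (intro exI[of _ "- (i div k)"]) (simp add: g_def)
  have zero: "g i = L ! nat i" if "0 \<le> i" "i < k" for i using that unfolding g_def by simp
  have "P \<subseteq> range g"
  proof
    fix p assume "p \<in> P"
    then obtain i where "i < length L" "p = L ! i" using L(1) by (metis in_set_conv_nth)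
    then have "p = g (int i)" using zero[of "int i"] L(2) by (simp add: k_def)
    then show "p \<in> range g" by blast
  qed
  then show ?thesis using that mono per cls unfolding k_def by blast
qed

subsection \<open>Graphs and induced subgraphs\<close>

lemma graph_adj:
  assumes "Digraph.graph G"
  shows "u \<rightarrow>\<^bsub>G\<^esub> v \<Longrightarrow> v \<rightarrow>\<^bsub>G\<^esub> u" "\<not> v \<rightarrow>\<^bsub>G\<^esub> v"
    "u \<rightarrow>\<^bsub>G\<^esub> v \<Longrightarrow> u \<in> verts G" "u \<rightarrow>\<^bsub>G\<^esub> v \<Longrightarrow> v \<in> verts G"
proof -
  interpret Digraph.graph G by fact
  show "u \<rightarrow>\<^bsub>G\<^esub> v \<Longrightarrow> v \<rightarrow>\<^bsub>G\<^esub> u" using sym_arcs unfolding symmetric_def by (rule symD)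
  show "\<not> v \<rightarrow>\<^bsub>G\<^esub> v" using adj_not_same by blast
  show "u \<rightarrow>\<^bsub>G\<^esub> v \<Longrightarrow> u \<in> verts G" "u \<rightarrow>\<^bsub>G\<^esub> v \<Longrightarrow> v \<in> verts G" by (auto dest: adj_in_verts)
qed

lemma graph_finite_verts: "Digraph.graph G \<Longrightarrow> finite (verts G)"
  unfolding Digraph.graph_def digraph_def by (simp add: fin_digraph.finite_verts)

lemma graph_induced:
  assumes "Digraph.graph G" "induced_subgraph H G"
  shows "Digraph.graph H"
proof -
  interpret Digraph.graph G by fact
  have "digraph H" using assms(2) by (rule digraphI_induced)
  moreover have "symmetric H" using induced_graph_imp_symmetric[OF sym_arcs assms(2)] .
  ultimately show ?thesis by (rule digraph.graphI)
qed

lemma induced_adj: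
  assumes "induced_subgraph H G" "u \<in> verts H" "v \<in> verts H"
  shows "u \<rightarrow>\<^bsub>H\<^esub> v \<longleftrightarrow> u \<rightarrow>\<^bsub>G\<^esub> v"
proof -
  have "tail H = tail G" "head H = head G" 
    and "arcs H = {e \<in> arcs G. tail G e \<in> verts H \<and> head G e \<in> verts H}"
    using assms(1) unfolding induced_subgraph_def subgraph_def compatible_def by auto
  then show ?thesis using assms(2,3) unfolding arcs_ends_conv by auto
qed

lemma induced_eqI:
  assumes "induced_subgraph H G" "verts H = verts G"
  shows "H = G"
proof -
  have "tail H = tail G" "head H = head G" 
    and "arcs H = {e \<in> arcs G. tail G e \<in> verts H \<and> head G e \<in> verts H}" and "wf_digraph G"
    using assms(1) unfolding induced_subgraph_def subgraph_def compatible_def by auto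
  then have "arcs H = arcs G" using assms(2) by (auto simp: wf_digraph_def)
  then show ?thesis using assms(2) \<open>tail H = tail G\<close> \<open>head H = head G\<close> by (intro pre_digraph.equality) auto
qed

lemma induced_verts: "induced_subgraph H G \<Longrightarrow> verts H \<subseteq> verts G"
  unfolding induced_subgraph_def subgraph_def by blast

subsection \<open>From arcs of the unit circle to periodic sets\<close>

lemma cis_eq_cis_iff: "cis s = cis t \<longleftrightarrow> (\<exists>n::int. s = t + of_int n * (2 * pi))"
  using sin_cos_eq_iff[of s t] by (auto simp: complex_eq_iff mult.commute)

lemma cis_mem_image_iff: "cis t \<in> cis ` {a..b} \<longleftrightarrow> t \<in> cyc_interval (2 * pi) a b"
proof
  assume "cis t \<in> cis ` {a..b}"
  then obtain r where r: "cis r = cis t" "a \<le> r" "r \<le> b" by auto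
  then obtain n :: int where "r = t + of_int n * (2 * pi)" unfolding cis_eq_cis_iff by blast
  then show "t \<in> cyc_interval (2 * pi) a b" using r(2,3) by (intro cyc_intervalI[of _ _ n]) auto
next
  assume "t \<in> cyc_interval (2 * pi) a b"
  then obtain n :: int where n: "a \<le> t + of_int n * (2 * pi)" "t + of_int n * (2 * pi) \<le> b"
    unfolding cyc_interval_def by blast
  have "cis t = cis (t + of_int n * (2 * pi))" unfolding cis_eq_cis_iff by (intro exI[of _ "- n"]) simp
  then show "cis t \<in> cis ` {a..b}" using n by auto
qed

lemma circular_arc_model_lift:
  assumes "circular_arc_model G A" "\<And>u v. u \<in> verts G \<Longrightarrow> v \<in> verts G \<Longrightarrow> u \<rightarrow>\<^bsub>G\<^esub> v \<Longrightarrow> u \<noteq> v"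
  defines "B \<equiv> \<lambda>v. {t. cis t \<in> A v}"
  shows "\<forall>v\<in>verts G. \<exists>a b. a \<le> b \<and> B v = cyc_interval (2 * pi) a b"
    and "arc_rep (verts G) (\<lambda>u v. u \<rightarrow>\<^bsub>G\<^esub> v) (2 * pi) B"
    and "helly_family (A ` verts G) \<Longrightarrow> helly_rep (verts G) (\<lambda>u v. u \<rightarrow>\<^bsub>G\<^esub> v) B"
proof -
  have arc: "\<exists>a b. a < b \<and> A v = cis ` {a..b}" if "v \<in> verts G" for v
    using assms(1) that unfolding circular_arc_model_def circle_arc_def by metis
  show int: "\<forall>v\<in>verts G. \<exists>a b. a \<le> b \<and> B v = cyc_interval (2 * pi) a b"
  proof
    fix v assume "v \<in> verts G"
    then obtain a b where ab: "a < b" "A v = cis ` {a..b}" using arc by blast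
    then have "B v = cyc_interval (2 * pi) a b" unfolding B_def ab(2) cis_mem_image_iff by simp
    then show "\<exists>a b. a \<le> b \<and> B v = cyc_interval (2 * pi) a b" using ab(1) less_imp_le by blast
  qed
  have ne: "B v \<noteq> {}" if v: "v \<in> verts G" for v
  proof -
    obtain a b where "a < b" "A v = cis ` {a..b}" using arc[OF v] by blast
    then have "cis a \<in> A v" by simp
    then show ?thesis unfolding B_def by blast
  qed
  have cis: "\<exists>t. z = cis t" if "v \<in> verts G" "z \<in> A v" for v z
    using arc[OF that(1)] that(2) by auto
  have adj: "u \<rightarrow>\<^bsub>G\<^esub> v \<longleftrightarrow> A u \<inter> A v \<noteq> {}" if "u \<in> verts G" "v \<in> verts G" "u \<noteq> v" for u v
    using assms(1) that unfolding circular_arc_model_def by blast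
  have meet: "A u \<inter> A v \<noteq> {} \<longleftrightarrow> B u \<inter> B v \<noteq> {}" if "u \<in> verts G" for u v
    using cis[OF that] unfolding B_def by blast
  have "cyc_convex (2 * pi) (B v)" if "v \<in> verts G" for v
    using int that cyc_convex_cyc_interval[of "2 * pi"] by fastforce
  then show "arc_rep (verts G) (\<lambda>u v. u \<rightarrow>\<^bsub>G\<^esub> v) (2 * pi) B"
    unfolding arc_rep_def using ne adj meet by auto
  assume helly: "helly_family (A ` verts G)"
  show "helly_rep (verts G) (\<lambda>u v. u \<rightarrow>\<^bsub>G\<^esub> v) B"
    unfolding helly_rep_def
  proof (intro allI impI)
    fix K assume K: "K \<subseteq> verts G" "\<forall>u\<in>K. \<forall>v\<in>K. u \<noteq> v \<longrightarrow> u \<rightarrow>\<^bsub>G\<^esub> v"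
    show "\<exists>t. \<forall>v\<in>K. t \<in> B v"
    proof (cases "K = {}")
      case False
      have "A u \<inter> A v \<noteq> {}" if "u \<in> K" "v \<in> K" for u v
      proof (cases "u = v")
        case True
        then obtain a b where "a < b" "A v = cis ` {a..b}" using arc K(1) \<open>v \<in> K\<close> by blast
        then have "cis a \<in> A v" by simp
        then show ?thesis using True by blast
      next
        case False
        then show ?thesis using that K adj[of u v] by blast
      qed
      then have "\<forall>Y\<in>A ` K. \<forall>Z\<in>A ` K. Y \<inter> Z \<noteq> {}" by blast
      moreover have "A ` K \<subseteq> A ` verts G" "A ` K \<noteq> {}" using K(1) False by blast+
      ultimately have "\<Inter> (A ` K) \<noteq> {}"
        using helly unfolding helly_family_def by presburger
      then obtain z where z: "\<forall>v\<in>K. z \<in> A v" by blast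
      then obtain t where "z = cis t" using False cis K(1) by blast
      then show ?thesis using z unfolding B_def by blast
    qed simp
  qed
qed

text \<open>If two closed intervals meet, the later of their left endpoints belongs to both. Hence
  restricting all arcs to the finitely many left endpoints per period preserves adjacency.\<close>

lemma arc_rep_discretize:
  fixes m :: real
  assumes rep: "arc_rep V E m B" and fin: "finite V"
    and int: "\<forall>v\<in>V. \<exists>a b. a \<le> b \<and> B v = cyc_interval m a b"
  shows "\<exists>k (A :: 'a \<Rightarrow> int set). arc_rep V E k A"
proof (cases "V = {}")
  case True
  then show ?thesis unfolding arc_rep_def by (intro exI[of _ 1]) simp
next
  case False
  note B = arc_repD[OF rep]
  obtain a b where ab: "\<And>v. v \<in> V \<Longrightarrow> a v \<le> b v" "\<And>v. v \<in> V \<Longrightarrow> B v = cyc_interval m (a v) (b v)"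
    using int by metis
  \<comment> \<open>The left endpoint of \<open>v\<close> reduced to the period that starts at
    \<open>0\<close>.\<close>
  define st where "st v = a v - of_int \<lfloor>a v / m\<rfloor> * m" for v
  have st: "0 \<le> st v" "st v < m" for v
    using B(1) floor_divide_lower[OF B(1), of "a v"] floor_divide_upper[OF B(1), of "a v"]
    unfolding st_def by (auto simp: algebra_simps)
  then have "st ` V \<subseteq> {0..<m}" "finite (st ` V)" "st ` V \<noteq> {}" using fin False by auto
  then obtain g :: "int \<Rightarrow> real" where g: "strict_mono g"
    "\<And>i j. g (i + j * int (card (st ` V))) = g i + of_int j * m" "st ` V \<subseteq> range g"
    using ex_periodic_enumeration by metis
  define k where "k = int (card (st ` V))"
  have per: "g (i + k) = g i + m" for i using g(2)[of i 1] unfolding k_def by simp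
  define A where "A v = {j. g j \<in> B v}" for v
  have starts: "\<exists>i. g i = a v + of_int n * m" if v: "v \<in> V" for v n
  proof -
    obtain i where "st v = g i" using v g(3) by blast
    then have "g (i + (n + \<lfloor>a v / m\<rfloor>) * k) = a v + of_int n * m"
      unfolding k_def g(2) st_def[symmetric] by (simp add: st_def algebra_simps)
    then show ?thesis by blast
  qed
  have "cyc_convex k (A v)" if v: "v \<in> V" for v
  proof -
    have "False" if h: "x < p" "p < y" "y < q" "q < x + k" "g x \<in> B v" "g y \<in> B v" "g p \<notin> B v" "g q \<notin> B v"
      for x p y q
    proof -
      have "g x < g p" "g p < g y" "g y < g q" "g q < g x + m"
        using h(1-4) unfolding per[symmetric] strict_mono_less[OF g(1)] .
      then show False using cyc_convexD[OF B(2)[OF v]] h(5-8) by blast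
    qed
    moreover have "g (x + k) \<in> B v \<longleftrightarrow> g x \<in> B v" for x
      using cyc_convex_shift1[OF B(2)[OF v]] per by simp
    ultimately show ?thesis unfolding cyc_convex_def A_def by blast
  qed
  moreover have "A v \<noteq> {}" if v: "v \<in> V" for v
  proof -
    obtain i where "g i = a v + of_int 0 * m" using starts[OF v] by blast
    then have "g i \<in> B v" using ab[OF v] by (auto intro!: cyc_intervalI[of _ _ 0])
    then show ?thesis unfolding A_def by blast
  qed
  moreover have "B u \<inter> B v \<noteq> {} \<longleftrightarrow> A u \<inter> A v \<noteq> {}" if uv: "u \<in> V" "v \<in> V" for u v
  proof -
    have *: "A u \<inter> A v \<noteq> {}" 
      if h: "u \<in> V" "v \<in> V" "a u \<le> t + of_int j * m" "t + of_int j * m \<le> b u"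
        "a v \<le> t + of_int i * m" "t + of_int i * m \<le> b v" "a u - of_int j * m \<le> a v - of_int i * m"
      for u v t i j
    proof -
      obtain l where l: "g l = a v + of_int (- i) * m" using starts h(2) by blast
      have "g l \<in> B u" unfolding ab(2)[OF h(1)] using l h by (intro cyc_intervalI[of _ _ j]) auto
      moreover have "g l \<in> B v" unfolding ab(2)[OF h(2)] using l h by (intro cyc_intervalI[of _ _ i]) auto
      ultimately show ?thesis unfolding A_def by blast
    qed
    have "A u \<inter> A v \<noteq> {}" if ne: "B u \<inter> B v \<noteq> {}"
    proof -
      obtain t where "t \<in> B u" "t \<in> B v" using ne by blast
      then obtain i j where "a u \<le> t + of_int j * m" "t + of_int j * m \<le> b u"
        "a v \<le> t + of_int i * m" "t + of_int i * m \<le> b v"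
        unfolding ab(2)[OF uv(1)] ab(2)[OF uv(2)] cyc_interval_def by blast
      then have "A u \<inter> A v \<noteq> {} \<or> A v \<inter> A u \<noteq> {}"
        using *[of u v t j i] *[of v u t i j] uv linear[of "a u - of_int j * m" "a v - of_int i * m"] by argo
      then show ?thesis by blast
    qed
    then show ?thesis unfolding A_def by blast
  qed
  moreover have "0 < k" using fin False unfolding k_def by (simp add: card_gt_0_iff)
  ultimately have "arc_rep V E k A" using rep unfolding arc_rep_def by simp
  then show ?thesis by blast
qed

lemma circular_arc_graph_arc_rep:
  assumes "circular_arc_graph G"
  obtains k and A :: "'a \<Rightarrow> int set" where "arc_rep (verts G) (\<lambda>u v. u \<rightarrow>\<^bsub>G\<^esub> v) k A"
proof -
  obtain A where "circular_arc_model G A" using assms unfolding circular_arc_graph_def by blast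
  moreover have "u \<noteq> v" if "u \<rightarrow>\<^bsub>G\<^esub> v" for u v
    using that assms graph_adj(2) unfolding circular_arc_graph_def by metis
  moreover have "finite (verts G)" using assms graph_finite_verts unfolding circular_arc_graph_def by blast
  ultimately show ?thesis
    using that circular_arc_model_lift(1,2)[of G A] arc_rep_discretize by blast
qed

subsection \<open>From periodic sets of integers to arcs of the unit circle\<close>

text \<open>An integer interval from \<open>s\<close> to \<open>e\<close> is prolonged by a fraction
  \<open>d v\<close> strictly between 0 and 1. Taking floors still sends common points to common
  points, the arcs have positive length without closing up, and pairwise different fractions make
  the arcs different.\<close>

lemma arc_rep_realize:
  fixes A :: "'a \<Rightarrow> int set"
  assumes rep: "arc_rep (verts G) (\<lambda>u v. u \<rightarrow>\<^bsub>G\<^esub> v) m A" and fin: "finite (verts G)"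
  obtains X where "circular_arc_model G X"
    "helly_rep (verts G) (\<lambda>u v. u \<rightarrow>\<^bsub>G\<^esub> v) A \<Longrightarrow> helly_family (X ` verts G)"
proof -
  note A = arc_repD[OF rep]
  have m: "0 < real_of_int m" using A(1) by simp
  have "\<forall>v\<in>verts G. \<exists>s e. s \<le> e \<and> e < s + m \<and> A v = cyc_interval m s e"
  proof
    fix v assume v: "v \<in> verts G"
    show "\<exists>s e. s \<le> e \<and> e < s + m \<and> A v = cyc_interval m s e"
      by (rule cyc_convex_is_cyc_interval[OF A(2)[OF v] A(1) A(3)[OF v]]) blast
  qed
  then obtain s e where se: "\<And>v. v \<in> verts G \<Longrightarrow> s v \<le> e v" "\<And>v. v \<in> verts G \<Longrightarrow> e v < s v + m"
    "\<And>v. v \<in> verts G \<Longrightarrow> A v = cyc_interval m (s v) (e v)"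
    by metis
  obtain f :: "'a \<Rightarrow> nat" where f: "inj_on f (verts G)" using finite_imp_inj_to_nat_seg[OF fin] by blast
  define d :: "'a \<Rightarrow> real" where "d v = 1 / (real (f v) + 2)" for v
  have d: "0 < d v" "d v < 1" for v unfolding d_def by auto
  have dinj: "d u \<noteq> d v" if "u \<in> verts G" "v \<in> verts G" "u \<noteq> v" for u v
    using that f unfolding d_def by (auto simp: inj_on_def)
  define R where "R v = cyc_interval (real_of_int m) (s v) (e v + d v)" for v
  define c where "c = 2 * pi / m"
  have c: "0 < c" "c * m = 2 * pi" using m unfolding c_def by simp_all
  define X where "X v = cis ` {c * s v..c * (e v + d v)}" for v
  have XR: "cis (c * t) \<in> X v \<longleftrightarrow> t \<in> R v" for t v
  proof -
    have "c * t + of_int j * (2 * pi) = c * (t + of_int j * real_of_int m)" for j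
      unfolding c(2)[symmetric] by (simp add: algebra_simps)
    then show ?thesis using c(1) unfolding X_def R_def cis_mem_image_iff cyc_interval_def by simp
  qed
  have surj: "\<exists>t. z = cis (c * t)" if "z \<in> X v" for z v
  proof -
    obtain r where "z = cis r" using \<open>z \<in> X v\<close> unfolding X_def by blast
    then have "z = cis (c * (r / c))" using c by simp
    then show ?thesis by blast
  qed
  have Rfloor: "\<lfloor>t\<rfloor> \<in> A v" if v: "v \<in> verts G" "t \<in> R v" for v t
  proof -
    obtain j :: int where j: "s v \<le> t + real_of_int j * real_of_int m" "t + real_of_int j * real_of_int m \<le> e v + d v"
      using v(2) unfolding R_def by (rule cyc_intervalE)
    have "\<lfloor>t + real_of_int (j * m)\<rfloor> = \<lfloor>t\<rfloor> + j * m" by (rule floor_add_int[symmetric])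
    moreover have "s v \<le> \<lfloor>t + real_of_int (j * m)\<rfloor>" using j(1) unfolding le_floor_iff by simp
    moreover have "\<lfloor>t + real_of_int (j * m)\<rfloor> < e v + 1" using j(2) d[of v] unfolding floor_less_iff by simp
    ultimately show ?thesis unfolding se(3)[OF v(1)] by (intro cyc_intervalI[of _ _ j]) auto
  qed
  have Rint: "of_int n \<in> R v" if v: "v \<in> verts G" "n \<in> A v" for v n
  proof -
    obtain j :: int where "s v \<le> n + j * m" "n + j * m \<le> e v"
      using v(2) unfolding se(3)[OF v(1)] cyc_interval_def by auto
    then have "real_of_int (s v) \<le> of_int (n + j * m)" "real_of_int (n + j * m) \<le> e v" 
      by (simp_all only: of_int_le_iff)
    then show ?thesis unfolding R_def using d[of v] by (intro cyc_intervalI[of _ _ j]) auto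
  qed
  have sep: "R u \<noteq> R v" if uv: "u \<in> verts G" "v \<in> verts G" "d u < d v" for u v
  proof
    assume eq: "R u = R v"
    have "e v + d v \<in> R v" unfolding R_def using se(1)[OF uv(2)] d[of v] by (intro cyc_intervalI[of _ _ 0]) auto
    then have "e v + d v \<in> R u" unfolding eq .
    then obtain j :: int where j: "s u \<le> e v + d v + real_of_int j * real_of_int m" "e v + d v + real_of_int j * real_of_int m \<le> e u + d u"
      unfolding R_def by (rule cyc_intervalE)
    have "real_of_int (e v + j * m) < of_int (e u)" using j(2) uv(3) by simp
    then have 1: "e v + j * m + 1 \<le> e u" by (simp only: of_int_less_iff)
    have "real_of_int (s u) < of_int (e v + j * m + 1)" using j(1) d(2)[of v] by simp
    then have 2: "s u \<le> e v + j * m" by (simp only: of_int_less_iff)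
    \<comment> \<open>Halfway between the right end of \<open>R v\<close> and the next integer:
      \<open>R u\<close> reaches that integer, whereas \<open>R v\<close> leaves the point free,
      because its next translate begins no earlier than that integer.\<close>
    define t where "t = e v + (d v + 1) / 2"
    have "real_of_int (s u) \<le> of_int (e v + j * m)" "real_of_int (e v + j * m + 1) \<le> of_int (e u)"
      using 1 2 by (simp_all only: of_int_le_iff)
    then have "t \<in> R u" unfolding R_def t_def using d[of u] d[of v]
      by (intro cyc_intervalI[of _ _ j]) (auto simp: field_simps)
    then obtain i :: int where i: "s v \<le> t + real_of_int i * real_of_int m" "t + real_of_int i * real_of_int m \<le> e v + d v"
      unfolding eq unfolding R_def by (rule cyc_intervalE)
    have "i < 0"
    proof (rule ccontr)
      assume "\<not> i < 0"
      then have "0 \<le> of_int i * real_of_int m" using m by simp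
      then show False using i(2) d(2)[of v] unfolding t_def by (simp add: field_simps)
    qed
    then have "of_int i * real_of_int m \<le> real_of_int (- 1) * real_of_int m" using m by (intro mult_right_mono) auto
    then have "s v < real_of_int (e v + 1 - m)" using i(1) d(2)[of v] unfolding t_def by (simp add: field_simps)
    then have "s v < e v + 1 - m" by (simp only: of_int_less_iff)
    then show False using se(2)[OF uv(2)] by simp
  qed
  have XReq: "R u = R v" if "X u = X v" for u v using XR that by blast
  have model: "circular_arc_model G X"
    unfolding circular_arc_model_def
  proof (intro conjI ballI impI)
    show "inj_on X (verts G)"
    proof (rule inj_onI, rule ccontr)
      fix u v assume "u \<in> verts G" "v \<in> verts G" "X u = X v" "u \<noteq> v"
      then show False using XReq[of u v] dinj[of u v] sep[of u v] sep[of v u] linorder_neqE[of "d u" "d v"] by fastforce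
    qed
    fix u assume u: "u \<in> verts G"
    have "s u < e u + d u" using se(1)[OF u] d[of u] by simp
    then have "c * s u < c * (e u + d u)" using c(1) by simp
    moreover have "real_of_int (e u + 1) \<le> of_int (s u + m)" using se(2)[OF u] by (simp only: of_int_le_iff)
    then have "e u + d u < s u + real_of_int m" using d(2)[of u] by simp
    then have "c * (e u + d u) < c * (s u + real_of_int m)" using c(1) by simp
    then have "c * (e u + d u) < c * s u + 2 * pi" unfolding distrib_left c(2) .
    ultimately show "circle_arc (X u)" unfolding circle_arc_def X_def by blast
    fix v assume v: "v \<in> verts G" "u \<noteq> v"
    have "A u \<inter> A v \<noteq> {} \<longleftrightarrow> X u \<inter> X v \<noteq> {}"
    proof
      assume "A u \<inter> A v \<noteq> {}"
      then show "X u \<inter> X v \<noteq> {}" using Rint u v XR by blast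
    next
      assume "X u \<inter> X v \<noteq> {}"
      then obtain t where "cis (c * t) \<in> X u" "cis (c * t) \<in> X v" using surj by blast
      then show "A u \<inter> A v \<noteq> {}" using Rfloor u v unfolding XR by blast
    qed
    then show "u \<rightarrow>\<^bsub>G\<^esub> v \<longleftrightarrow> X u \<inter> X v \<noteq> {}" using rep u v unfolding arc_rep_def by blast
  qed
  have "helly_family (X ` verts G)" if h: "helly_rep (verts G) (\<lambda>u v. u \<rightarrow>\<^bsub>G\<^esub> v) A"
    unfolding helly_family_def
  proof (intro allI impI)
    fix S assume S: "S \<subseteq> X ` verts G" "S \<noteq> {}" "\<forall>Y\<in>S. \<forall>Z\<in>S. Y \<inter> Z \<noteq> {}"
    obtain K where K: "K \<subseteq> verts G" "S = X ` K" using S(1) by (meson subset_imageE)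
    have "u \<rightarrow>\<^bsub>G\<^esub> v" if uv: "u \<in> K" "v \<in> K" "u \<noteq> v" for u v
    proof -
      have "X u \<inter> X v \<noteq> {}" using S(3) K(2) uv by simp
      then show ?thesis using model uv K(1) unfolding circular_arc_model_def by (meson subsetD)
    qed
    then obtain n where "\<forall>v\<in>K. n \<in> A v" using h K(1) unfolding helly_rep_def by blast
    then have "cis (c * of_int n) \<in> X v" if "v \<in> K" for v using that Rint[of v n] XR K(1) by auto
    then have "cis (c * of_int n) \<in> \<Inter> S" unfolding K(2) by simp
    then show "\<Inter> S \<noteq> {}" by (metis empty_iff)
  qed
  then show ?thesis using that model by blast
qed

subsection \<open>Obstacles are not Helly circular-arc graphs\<close>

text \<open>Treats both kinds of enumeration alike. A common point of the new clique lies in the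
  arcs of all members of \<open>Q\<close> other than \<open>x\<close> and \<open>y\<close>, and in
  neither of these two, since each has a non-neighbour among the witnesses.\<close>

lemma witness_enumeration_adj:
  assumes "Digraph.graph G" "clique G Q" "witness_enumeration G Q x y ws" "x \<in> Q" "y \<in> Q" "x \<noteq> y"
  shows "clique G (set ws \<union> (Q - {x, y}))"
    and "\<exists>w\<in>set ws. w \<noteq> x \<and> \<not> w \<rightarrow>\<^bsub>G\<^esub> x" and "\<exists>w\<in>set ws. w \<noteq> y \<and> \<not> w \<rightarrow>\<^bsub>G\<^esub> y"
proof -
  note adj = graph_adj[OF assms(1)]
  have Q: "Q \<subseteq> verts G" "\<And>u v. u \<in> Q \<Longrightarrow> v \<in> Q \<Longrightarrow> u \<noteq> v \<Longrightarrow> u \<rightarrow>\<^bsub>G\<^esub> v"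
    using assms(2) unfolding clique_def by auto
  have ws: "set ws \<subseteq> verts G" using assms(3) unfolding witness_enumeration_def by blast
  have nn: "w \<rightarrow>\<^bsub>G\<^esub> v" if "v \<in> Q" "v \<notin> non_neighbours G w" "w \<noteq> v" for v w
    using that Q(1) unfolding non_neighbours_def by blast
  have non: "w \<noteq> v \<and> \<not> w \<rightarrow>\<^bsub>G\<^esub> v" if "v \<in> non_neighbours G w" for v w
    using that unfolding non_neighbours_def by blast
  have out: "w \<notin> Q" if "v \<in> Q" "v \<in> non_neighbours G w" for v w
    using Q(2)[of w v] that unfolding non_neighbours_def by blast
  consider (O1) w where "ws = [w]" "non_neighbours G w \<inter> Q = {x, y}"
    | (O2) u z where "ws = [u, z]" "non_neighbours G u \<inter> Q = {x}" "non_neighbours G z \<inter> Q = {y}" "u \<rightarrow>\<^bsub>G\<^esub> z"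
    using assms(3) unfolding witness_enumeration_def by blast
  then have "clique G (set ws \<union> (Q - {x, y})) \<and> (\<exists>w\<in>set ws. w \<noteq> x \<and> \<not> w \<rightarrow>\<^bsub>G\<^esub> x)
     \<and> (\<exists>w\<in>set ws. w \<noteq> y \<and> \<not> w \<rightarrow>\<^bsub>G\<^esub> y)"
  proof cases
    case O1
    have "w \<notin> Q" using out[of x w] O1(2) assms(4) by blast
    have 1: "w \<rightarrow>\<^bsub>G\<^esub> v" if "v \<in> Q - {x, y}" for v
    proof (rule nn)
      show "v \<in> Q" "w \<noteq> v" using that \<open>w \<notin> Q\<close> by auto
      show "v \<notin> non_neighbours G w" using that O1(2) by blast
    qed
    have "clique G (set ws \<union> (Q - {x, y}))"
      using ws Q 1 adj(1) unfolding clique_def O1(1) by auto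
    moreover have "x \<in> non_neighbours G w" "y \<in> non_neighbours G w" using O1(2) by auto
    then have "w \<noteq> x \<and> \<not> w \<rightarrow>\<^bsub>G\<^esub> x" "w \<noteq> y \<and> \<not> w \<rightarrow>\<^bsub>G\<^esub> y" using non by blast+
    ultimately show ?thesis using O1(1) by simp
  next
    case O2
    have x: "x \<in> non_neighbours G u" and y: "y \<in> non_neighbours G z" using O2 by auto
    have "u \<notin> Q" "z \<notin> Q" using out x y assms(4,5) by blast+
    have 1: "u \<rightarrow>\<^bsub>G\<^esub> v \<and> z \<rightarrow>\<^bsub>G\<^esub> v" if "v \<in> Q - {x, y}" for v
    proof -
      have "v \<in> Q" "u \<noteq> v" "z \<noteq> v" using that \<open>u \<notin> Q\<close> \<open>z \<notin> Q\<close> by auto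
      moreover have "v \<notin> non_neighbours G u" "v \<notin> non_neighbours G z" using that O2 by blast+
      ultimately show ?thesis using nn by blast
    qed
    have "clique G (set ws \<union> (Q - {x, y}))"
      using ws Q 1 adj(1) O2(4) unfolding clique_def O2(1) by auto
    moreover have "u \<noteq> x \<and> \<not> u \<rightarrow>\<^bsub>G\<^esub> x" "z \<noteq> y \<and> \<not> z \<rightarrow>\<^bsub>G\<^esub> y" using non[OF x] non[OF y] by blast+
    ultimately show ?thesis using O2(1) by simp
  qed
  then show "clique G (set ws \<union> (Q - {x, y}))"
    and "\<exists>w\<in>set ws. w \<noteq> x \<and> \<not> w \<rightarrow>\<^bsub>G\<^esub> x" and "\<exists>w\<in>set ws. w \<noteq> y \<and> \<not> w \<rightarrow>\<^bsub>G\<^esub> y" by blast+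
qed

lemma obstacle_no_helly_rep:
  fixes m :: real
  assumes G: "Digraph.graph G" and obs: "obstacle_enumeration_in G vs Ws"
    and rep: "arc_rep (verts G) (\<lambda>u v. u \<rightarrow>\<^bsub>G\<^esub> v) m A"
    and helly: "helly_rep (verts G) (\<lambda>u v. u \<rightarrow>\<^bsub>G\<^esub> v) A"
  shows False
proof -
  note A = arc_repD[OF rep]
  define k where "k = length vs"
  define Q where "Q = set vs"
  have k: "3 \<le> k" and dist: "distinct vs" and Q: "clique G Q"
    and W: "\<And>i. i < k \<Longrightarrow> witness_enumeration G Q (vs ! i) (vs ! ((i + 1) mod k)) (Ws ! i)"
    using obs unfolding obstacle_enumeration_in_def k_def Q_def by auto
  have QV: "Q \<subseteq> verts G" using Q unfolding clique_def by blast
  have vsQ: "vs ! i \<in> Q" if "i < k" for i using that unfolding Q_def k_def by simp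
  have vsV: "vs ! i \<in> verts G" if "i < k" for i using vsQ[OF that] QV by blast
  have vs_eq: "vs ! i = vs ! j \<longleftrightarrow> i = j" if "i < k" "j < k" for i j
    using that dist unfolding k_def by (simp add: nth_eq_iff_index_eq)
  have common: "\<exists>t. \<forall>v\<in>K. t \<in> A v" if "clique G K" for K
    using helly that unfolding helly_rep_def clique_def by blast
  obtain p where p: "\<And>v. v \<in> Q \<Longrightarrow> p \<in> A v" using common[OF Q] by blast
  have "\<exists>t. p < t \<and> t < p + m \<and> t \<notin> A (vs ! i) \<and> t \<notin> A (vs ! ((i + 1) mod k)) \<and>
      (\<forall>v\<in>Q - {vs ! i, vs ! ((i + 1) mod k)}. t \<in> A v)" if i: "i < k" for i
  proof -
    let ?x = "vs ! i" and ?y = "vs ! ((i + 1) mod k)"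
    have j: "(i + 1) mod k < k" "(i + 1) mod k \<noteq> i" using k i by (auto simp: mod_Suc)
    have xy: "?x \<in> Q" "?y \<in> Q" "?x \<noteq> ?y" using vsQ i j vs_eq by auto
    note we = witness_enumeration_adj[OF G Q W[OF i] xy]
    obtain t where t: "\<forall>v\<in>set (Ws ! i) \<union> (Q - {?x, ?y}). t \<in> A v" using common[OF we(1)] by blast
    have WV: "set (Ws ! i) \<subseteq> verts G" using W[OF i] unfolding witness_enumeration_def by blast
    have tx: "t \<notin> A ?x"
    proof
      assume "t \<in> A ?x"
      obtain w where w: "w \<in> set (Ws ! i)" "w \<noteq> ?x" "\<not> w \<rightarrow>\<^bsub>G\<^esub> ?x" using we(2) by blast
      then show False using A(4)[of w ?x t] t WV xy(1) QV \<open>t \<in> A ?x\<close> by blast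
    qed
    have ty: "t \<notin> A ?y"
    proof
      assume "t \<in> A ?y"
      obtain w where w: "w \<in> set (Ws ! i)" "w \<noteq> ?y" "\<not> w \<rightarrow>\<^bsub>G\<^esub> ?y" using we(3) by blast
      then show False using A(4)[of w ?y t] t WV xy(2) QV \<open>t \<in> A ?y\<close> by blast
    qed
    \<comment> \<open>Moves \<open>t\<close> into the period that starts at \<open>p\<close>; the
      translate differs from \<open>p\<close> because \<open>p\<close> lies in every arc of the
      clique and \<open>t\<close> does not.\<close>
    define j where "j = - \<lfloor>(t - p) / m\<rfloor>"
    define s where "s = t + of_int j * m"
    have sA: "s \<in> A v \<longleftrightarrow> t \<in> A v" if "v \<in> verts G" for v
      unfolding s_def by (rule cyc_convex_shift[OF A(2)[OF that]])
    have "p \<le> s" "s < p + m"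
      using floor_divide_lower[OF A(1), of "t - p"] floor_divide_upper[OF A(1), of "t - p"]
      unfolding s_def j_def by (auto simp: algebra_simps)
    moreover have "s \<noteq> p" using sA[of ?x] tx p xy(1) QV by blast
    ultimately have "p < s" "s < p + m" by auto
    moreover have "s \<notin> A ?x" "s \<notin> A ?y" using sA tx ty xy QV by blast+
    moreover have "s \<in> A v" if "v \<in> Q - {?x, ?y}" for v using that t sA QV by blast
    ultimately show ?thesis by blast
  qed
  then obtain T where T: "\<And>i. i < k \<Longrightarrow> p < T i" "\<And>i. i < k \<Longrightarrow> T i < p + m"
    "\<And>i. i < k \<Longrightarrow> T i \<notin> A (vs ! i)" "\<And>i. i < k \<Longrightarrow> T i \<notin> A (vs ! ((i + 1) mod k))"
    "\<And>i v. i < k \<Longrightarrow> v \<in> Q - {vs ! i, vs ! ((i + 1) mod k)} \<Longrightarrow> T i \<in> A v"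
    by metis
  have i0: "0 \<in> {..<k}" using k by simp
  have "finite (T ` {..<k})" "T ` {..<k} \<noteq> {}" using i0 by auto
  then have "Min (T ` {..<k}) \<in> T ` {..<k}" by (rule Min_in)
  then obtain i where i: "i < k" "T i = Min (T ` {..<k})" by auto
  have least: "T i \<le> T j" if "j < k" for j unfolding i(2) using that by simp
  define n where "n = (i + 1) mod k"
  define l where "l = (if i = 0 then k - 1 else i - 1)"
  have n: "n < k" "l < k" "n \<noteq> i" "l \<noteq> i" "n \<noteq> l" "(l + 1) mod k = i" "(n + 1) mod k \<noteq> i"
    using i(1) k unfolding n_def l_def by (auto simp: mod_Suc)
  have Tl: "T l \<in> A (vs ! n)" "T l \<notin> A (vs ! i)"
    using T(5)[OF n(2)] T(4)[OF n(2)] vsQ[OF n(1)] vs_eq n i(1) by auto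
  have Tn: "T n \<in> A (vs ! i)" "T n \<notin> A (vs ! n)"
    using T(5)[OF n(1)] T(3)[OF n(1)] vsQ[OF i(1)] vs_eq n i(1) by auto
  have Ti: "T i \<notin> A (vs ! i)" "T i \<notin> A (vs ! n)" using T(3,4)[OF i(1)] unfolding n_def by auto
  have lt: "T i < T l" "T i < T n" "T l \<noteq> T n"
    using least[OF n(1)] least[OF n(2)] Tl Tn Ti by (auto simp: less_le)
  \<comment> \<open>\<open>vs ! n\<close> contains \<open>p\<close> and \<open>T l\<close> but
    misses \<open>T i\<close> and \<open>T n\<close>; \<open>vs ! i\<close> contains
    \<open>p\<close> and \<open>T n\<close> but misses \<open>T i\<close> and \<open>T l\<close>.
    Whichever of \<open>T l\<close> and \<open>T n\<close> comes first decides which of the two arcs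
    is broken.\<close>
  show False
  proof (cases "T l < T n")
    case True
    then show False
      using cyc_convexD[OF A(2)[OF vsV[OF n(1)]], of p "T i" "T l" "T n"] T(1,2) lt p[OF vsQ[OF n(1)]] Tl Tn Ti i n
      by blast
  next
    case False
    then have "T n < T l" using lt(3) by simp
    then show False
      using cyc_convexD[OF A(2)[OF vsV[OF i(1)]], of p "T i" "T n" "T l"] T(1,2) lt p[OF vsQ[OF i(1)]] Tl Tn Ti i n
      by blast
  qed
qed

lemma obstacle_not_helly_circular_arc_graph:
  assumes "obstacle_enumeration_in G vs Ws"
  shows "\<not> helly_circular_arc_graph G"
proof
  assume "helly_circular_arc_graph G"
  then obtain A where A: "Digraph.graph G" "circular_arc_model G A" "helly_family (A ` verts G)"
    unfolding helly_circular_arc_graph_def by blast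
  have "u \<noteq> v" if "u \<rightarrow>\<^bsub>G\<^esub> v" for u v using that graph_adj(2)[OF A(1)] by metis
  then show False
    using obstacle_no_helly_rep[OF A(1) assms circular_arc_model_lift(2)[OF A(2)]
        circular_arc_model_lift(3)[OF A(2) _ A(3)]] by metis
qed

section \<open>Obstacles inside minimal forbidden graphs\<close>

lemma obstacle_enumeration_in_induced:
  assumes "induced_subgraph H G" "obstacle_enumeration_in G vs Ws" "set vs \<union> witnesses Ws \<subseteq> verts H"
  shows "obstacle_enumeration_in H vs Ws"
proof -
  note ind = induced_adj[OF assms(1)] and HG = induced_verts[OF assms(1)]
  have nn: "non_neighbours H w \<inter> set vs = non_neighbours G w \<inter> set vs" if "w \<in> verts H" for w
    using that assms(3) HG ind unfolding non_neighbours_def by blast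
  have "witness_enumeration H (set vs) x y ws" if "witness_enumeration G (set vs) x y ws" "ws \<in> set Ws" for x y ws
  proof -
    have "set ws \<subseteq> verts H" using that(2) assms(3) unfolding witnesses_def by blast
    then show ?thesis using that(1) nn ind unfolding witness_enumeration_def by auto
  qed
  moreover have "clique G (set vs)" using assms(2) unfolding obstacle_enumeration_in_def by blast
  then have "clique H (set vs)" using assms(3) ind unfolding clique_def by (simp add: subset_iff)
  ultimately show ?thesis using assms(2) unfolding obstacle_enumeration_in_def by simp
qed

text \<open>Clique and witnesses induce a subgraph that still carries the enumeration, hence is not
  Helly; minimality makes it the whole graph.\<close>

lemma minimal_obstacle_covers:
  assumes "Digraph.graph G" "minimal_forbidden_induced_subgraph helly_circular_arc_graph G"
    and obs: "obstacle_enumeration_in G vs Ws"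
  shows "verts G = set vs \<union> witnesses Ws"
proof -
  let ?S = "set vs \<union> witnesses Ws"
  have "set ws \<subseteq> verts G" if "ws \<in> set Ws" for ws
    using obs that unfolding obstacle_enumeration_in_def witness_enumeration_def by (metis in_set_conv_nth)
  then have "witnesses Ws \<subseteq> verts G" unfolding witnesses_def by blast
  then have S: "?S \<subseteq> verts G" using obs unfolding obstacle_enumeration_in_def clique_def by blast
  interpret Digraph.graph G by fact
  have ind: "induced_subgraph (G \<restriction> ?S) G" using S by (rule induced_induce)
  have "obstacle_enumeration_in (G \<restriction> ?S) vs Ws"
    by (rule obstacle_enumeration_in_induced[OF ind obs]) simp
  then have "\<not> helly_circular_arc_graph (G \<restriction> ?S)" by (rule obstacle_not_helly_circular_arc_graph)
  then have "G \<restriction> ?S = G" using ind assms(2) unfolding minimal_forbidden_induced_subgraph_def by blast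
  then show ?thesis by (metis induce_subgraph_verts)
qed

subsection \<open>Extremal representations\<close>

definition common_sets :: "'a set \<Rightarrow> ('a \<Rightarrow> int set) \<Rightarrow> 'a set set" where
  "common_sets V A = {S. S \<subseteq> V \<and> (\<exists>t. \<forall>v\<in>S. t \<in> A v)}"

text \<open>The count is compared over all circumferences, inclusion of arcs only at the fixed
  \<open>m\<close>. Since vertex sets are counted and not points, the count is bounded by the number
  of subsets of \<open>V\<close> and a mere refinement of the circle gains nothing.\<close>

definition extremal_rep :: "'a set \<Rightarrow> ('a \<Rightarrow> 'a \<Rightarrow> bool) \<Rightarrow> int \<Rightarrow> ('a \<Rightarrow> int set) \<Rightarrow> bool" where
  "extremal_rep V E m A \<longleftrightarrow> arc_rep V E m A \<and>
     (\<forall>m' A'. arc_rep V E m' A' \<longrightarrow> card (common_sets V A') \<le> card (common_sets V A)) \<and>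
     (\<forall>A'. arc_rep V E m A' \<and> (\<forall>v\<in>V. A v \<subseteq> A' v) \<longrightarrow> (\<forall>v\<in>V. A' v = A v))"

lemma finite_common_sets: "finite V \<Longrightarrow> finite (common_sets V A)"
  unfolding common_sets_def by (rule finite_subset[of _ "Pow V"]) auto

lemma ex_extremal_rep:
  fixes A0 :: "'a \<Rightarrow> int set"
  assumes "arc_rep V E m0 A0" and fin: "finite V"
  obtains m A where "extremal_rep V E m A"
proof -
  have "card (common_sets V A) \<le> card (Pow V)" for A
    using fin unfolding common_sets_def by (intro card_mono) auto
  then have "\<exists>p. (case p of (m, A) \<Rightarrow> arc_rep V E m A) \<and>
      (\<forall>q. (case q of (m, A) \<Rightarrow> arc_rep V E m A) \<longrightarrow>
        card (common_sets V (snd q)) \<le> card (common_sets V (snd p)))"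
    using assms(1)
    by (intro ex_has_greatest_nat[of _ "(m0, A0)" _ "Suc (card (Pow V))"]) (auto simp: less_Suc_eq_le)
  then obtain m A1 where A1: "arc_rep V E m A1"
    "\<And>m' A'. arc_rep V E m' A' \<Longrightarrow> card (common_sets V A') \<le> card (common_sets V A1)"
    by auto
  define N where "N = card (common_sets V A1)"
  \<comment> \<open>The second maximum is taken over the number of points in one period. A strict
    enlargement of an arc shows within one period, and it keeps the first count at its
    maximum.\<close>
  define sz where "sz A = (\<Sum>v\<in>V. card (A v \<inter> {0..<m}))" for A :: "'a \<Rightarrow> int set"
  have "sz A < Suc (card V * nat m)" for A
  proof -
    have "card (A v \<inter> {0..<m}) \<le> card {0..<m}" for v by (intro card_mono) auto
    then show ?thesis unfolding sz_def less_Suc_eq_le by (intro sum_bounded_above[where K = "nat m", simplified]) auto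
  qed
  then have "\<exists>A. (arc_rep V E m A \<and> card (common_sets V A) = N) \<and>
      (\<forall>A'. arc_rep V E m A' \<and> card (common_sets V A') = N \<longrightarrow> sz A' \<le> sz A)"
    using A1(1) by (intro ex_has_greatest_nat[of _ A1 _ "Suc (card V * nat m)"]) (auto simp: N_def)
  then obtain A where A: "arc_rep V E m A" "card (common_sets V A) = N"
    "\<And>A'. arc_rep V E m A' \<Longrightarrow> card (common_sets V A') = N \<Longrightarrow> sz A' \<le> sz A"
    by blast
  have "A' v = A v" if A': "arc_rep V E m A'" "\<forall>v\<in>V. A v \<subseteq> A' v" and v: "v \<in> V" for A' v
  proof (rule ccontr)
    assume "A' v \<noteq> A v"
    then obtain t where t: "t \<in> A' v" "t \<notin> A v" using A'(2) v by blast
    have "common_sets V A \<subseteq> common_sets V A'" using A'(2) unfolding common_sets_def by blast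
    then have "N \<le> card (common_sets V A')" unfolding A(2)[symmetric] by (rule card_mono[OF finite_common_sets[OF fin]])
    then have "card (common_sets V A') = N" using A1(2)[OF A'(1)] unfolding N_def by simp
    then have "sz A' \<le> sz A" by (rule A(3)[OF A'(1)])
    have m: "0 < m" using A(1) arc_repD(1) by blast
    define s where "s = t + of_int (- (t div m)) * m"
    have "s = t mod m" unfolding s_def by (simp add: minus_div_mult_eq_mod)
    then have "s \<in> {0..<m}" using m by simp
    moreover have "s \<in> A' v" using cyc_convex_shift[OF arc_repD(2)[OF A'(1) v]] t(1) unfolding s_def by blast
    moreover have "s \<notin> A v" using cyc_convex_shift[OF arc_repD(2)[OF A(1) v]] t(2) unfolding s_def by blast
    ultimately have "A v \<inter> {0..<m} \<subset> A' v \<inter> {0..<m}" using A'(2) v by blast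
    then have "card (A v \<inter> {0..<m}) < card (A' v \<inter> {0..<m})" by (intro psubset_card_mono) auto
    moreover have "card (A u \<inter> {0..<m}) \<le> card (A' u \<inter> {0..<m})" if "u \<in> V" for u
      using A'(2) that by (intro card_mono) auto
    ultimately have "sz A < sz A'" unfolding sz_def using v fin by (intro sum_strict_mono_ex1) auto
    then show False using \<open>sz A' \<le> sz A\<close> by simp
  qed
  then have "extremal_rep V E m A"
    unfolding extremal_rep_def A(2) N_def using A(1) A1(2) by blast
  then show ?thesis using that by blast
qed

text \<open>Otherwise the orbit of \<open>n\<close>, being next to \<open>A v\<close>, could be
  added to it: the set stays convex and no adjacency changes, against the maximality of the
  arcs.\<close>

lemma extremal_rep_blocked:
  assumes ext: "extremal_rep V E m A" and sym: "\<And>u v. E u v \<Longrightarrow> E v u"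
    and v: "v \<in> V" and n: "n \<notin> A v" "n + d \<in> A v" "d = 1 \<or> d = - 1"
  obtains u where "u \<in> V" "u \<noteq> v" "\<not> E v u" "n \<in> A u"
proof -
  have rep: "arc_rep V E m A" using ext unfolding extremal_rep_def by blast
  note A = arc_repD[OF rep]
  have "\<exists>u\<in>V. u \<noteq> v \<and> \<not> E v u \<and> n \<in> A u"
  proof (rule ccontr)
    assume no: "\<not> ?thesis"
    define I where "I = cyc_interval m n n"
    have I: "t \<in> A u \<longleftrightarrow> n \<in> A u" if t: "t \<in> I" "u \<in> V" for t u
    proof -
      obtain j :: int where "n \<le> t + of_int j * m" "t + of_int j * m \<le> n" using t(1) unfolding I_def by (rule cyc_intervalE)
      then have "t + of_int j * m = n" by simp
      then show ?thesis using cyc_convex_shift[OF A(2)[OF t(2)], of t j] by simp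
    qed
    define A' where "A' = A(v := A v \<union> I)"
    have conv: "cyc_convex m (A' u) \<and> A' u \<noteq> {}" if u: "u \<in> V" for u
      using A(2,3)[OF u] cyc_convex_insert[OF A(2)[OF v] n(3,2)] unfolding A'_def I_def by auto
    have vI: "(\<exists>t. t \<in> A v \<union> I \<and> t \<in> A u) \<longleftrightarrow> E v u" if u: "u \<in> V" "u \<noteq> v" for u
    proof
      assume "\<exists>t. t \<in> A v \<union> I \<and> t \<in> A u"
      then show "E v u" using no A(4)[OF v u(1)] u I by blast
    next
      assume "E v u"
      then show "\<exists>t. t \<in> A v \<union> I \<and> t \<in> A u" using A(5)[OF v u(1)] u(2) by blast
    qed
    have "E u w \<longleftrightarrow> A' u \<inter> A' w \<noteq> {}" if uw: "u \<in> V" "w \<in> V" "u \<noteq> w" for u w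
    proof -
      consider "u = v" | "w = v" | "u \<noteq> v" "w \<noteq> v" by blast
      then show ?thesis
      proof cases
        case 1
        then show ?thesis using vI[of w] uw unfolding A'_def by auto
      next
        case 2
        then have "E u w \<longleftrightarrow> E v u" using sym by blast
        then show ?thesis using vI[of u] uw 2 unfolding A'_def by auto
      next
        case 3
        then show ?thesis using A(4)[OF uw(1,2)] A(5)[OF uw] uw(3) unfolding A'_def by auto
      qed
    qed
    then have "arc_rep V E m A'" unfolding arc_rep_def using conv A(1) by blast
    moreover have "\<forall>u\<in>V. A u \<subseteq> A' u" unfolding A'_def by auto
    ultimately have "A' v = A v" using ext v unfolding extremal_rep_def by blast
    moreover have "n \<in> A' v" unfolding A'_def I_def by (auto intro!: cyc_intervalI[of _ _ 0])
    ultimately show False using n(1) by blast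
  qed
  then show ?thesis using that by blast
qed

text \<open>\<open>v\<close> begins right after \<open>e\<close>, a point of all other members of
  \<open>Q\<close>. Doubling the circle makes room for a common point of \<open>Q\<close> between
  \<open>e\<close> and \<open>e + 1\<close>, while every old common point \<open>t\<close> survives
  as \<open>2 * t\<close>; the count would exceed its maximum.\<close>

lemma extremal_rep_no_new_common:
  assumes ext: "extremal_rep V E m A" and fin: "finite V" and sym: "\<And>u v. E u v \<Longrightarrow> E v u"
    and v: "v \<in> Q" and Q: "Q \<subseteq> V" "\<And>u. u \<in> Q \<Longrightarrow> u \<noteq> v \<Longrightarrow> E v u" "\<And>u. u \<in> Q \<Longrightarrow> u \<noteq> v \<Longrightarrow> e \<in> A u"
    and no: "\<not> (\<exists>t. \<forall>u\<in>Q. t \<in> A u)" and e: "e + 1 \<in> A v"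
  shows False
proof -
  have rep: "arc_rep V E m A" using ext unfolding extremal_rep_def by blast
  note A = arc_repD[OF rep]
  have vV: "v \<in> V" using v Q(1) by blast
  define I where "I = cyc_interval (2 * m) (2 * e + 1) (2 * e + 1)"
  define D where "D u = {n. n div 2 \<in> A u}" for u
  \<comment> \<open>Every point is doubled; the second copy of \<open>e\<close> is given to \<open>v\<close> and taken from the
    non-neighbours of \<open>v\<close>, which makes it a common point of \<open>Q\<close>.\<close>
  define A' where "A' u = (if u = v then D v \<union> I else if E v u then D u else - (- D u \<union> I))" for u
  have even: "2 * t \<notin> I" for t
  proof
    assume "2 * t \<in> I"
    then obtain j :: int where "2 * e + 1 \<le> 2 * t + of_int j * (2 * m)" "2 * t + of_int j * (2 * m) \<le> 2 * e + 1"
      unfolding I_def by (rule cyc_intervalE)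
    then have "2 * (t + j * m) = 2 * e + 1" by (simp add: algebra_simps)
    then show False by presburger
  qed
  have evenD: "2 * t \<in> D u \<longleftrightarrow> t \<in> A u" for t u unfolding D_def by simp
  have Dconv: "cyc_convex (2 * m) (D u)" if u: "u \<in> V" for u
  proof -
    have sh: "(x + 2 * m) div 2 = x div 2 + m" for x :: int by simp
    have "False" if h: "x < p" "p < y" "y < q" "q < x + 2 * m" "x \<in> D u" "y \<in> D u" "p \<notin> D u" "q \<notin> D u" for x p y q
    proof -
      have "x div 2 \<le> p div 2" "p div 2 \<le> y div 2" "y div 2 \<le> q div 2" "q div 2 \<le> x div 2 + m"
        using h(1-4) zdiv_mono1[of q "x + 2 * m" 2] by (simp_all add: zdiv_mono1)
      moreover have "x div 2 \<noteq> p div 2" "p div 2 \<noteq> y div 2" "y div 2 \<noteq> q div 2" "q div 2 \<noteq> x div 2 + m"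
        using h(5-8) cyc_convex_shift1[OF A(2)[OF u], of "x div 2"] unfolding D_def mem_Collect_eq by metis+
      ultimately have "x div 2 < p div 2" "p div 2 < y div 2" "y div 2 < q div 2" "q div 2 < x div 2 + m"
        by (simp_all only: less_le simp_thms)
      then show False
        using cyc_convexD[OF A(2)[OF u]] h(5-8) unfolding D_def mem_Collect_eq by blast
    qed
    moreover have "x + 2 * m \<in> D u \<longleftrightarrow> x \<in> D u" for x
      using cyc_convex_shift1[OF A(2)[OF u]] unfolding D_def mem_Collect_eq sh .
    ultimately show ?thesis unfolding cyc_convex_def by blast
  qed
  have conv: "cyc_convex (2 * m) (A' u)" if u: "u \<in> V" for u
  proof -
    have 1: "cyc_convex (2 * m) (D v \<union> I)"
      unfolding I_def using e by (intro cyc_convex_insert[OF Dconv[OF vV], of 1]) (simp_all add: D_def add.commute)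
    \<comment> \<open>A non-neighbour of \<open>v\<close> misses \<open>e + 1\<close>, so its
      complement contains \<open>2 * e + 2\<close> and may be extended by the adjacent point
      \<open>2 * e + 1\<close>.\<close>
    have "cyc_convex (2 * m) (- (- D u \<union> I))" if "u \<noteq> v" "\<not> E v u"
    proof -
      have "e + 1 \<notin> A u" using A(4)[OF vV u e] that by blast
      then show ?thesis unfolding I_def using cyc_convex_Compl[OF Dconv[OF u]]
        by (intro cyc_convex_Compl[of _ "- D u \<union> _"] cyc_convex_insert[of _ "- D u" 1])
          (simp_all add: D_def add.commute)
    qed
    then show ?thesis using 1 Dconv[OF u] unfolding A'_def by auto
  qed
  have A'even: "2 * t \<in> A' u" if "t \<in> A u" for t u
    using that even[of t] evenD[of t u] unfolding A'_def by auto
  have adj: "E u w" if uw: "u \<in> V" "w \<in> V" "u \<noteq> w" "n \<in> A' u" "n \<in> A' w" for u w n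
  proof (cases "n \<in> I")
    case True
    then have *: "u = v \<or> E v u" "w = v \<or> E v w" using uw(4,5) unfolding A'_def by (auto split: if_splits)
    show ?thesis
    proof (cases "u = v \<or> w = v")
      case True
      then show ?thesis using * sym uw(3) by blast
    next
      case False
      then have "n div 2 \<in> A u" "n div 2 \<in> A w" using * uw(4,5) unfolding A'_def D_def by auto
      then show ?thesis using A(4) uw by blast
    qed
  next
    case False
    then have "n div 2 \<in> A u" "n div 2 \<in> A w" using uw(4,5) unfolding A'_def D_def by (auto split: if_splits)
    then show ?thesis using A(4) uw by blast
  qed
  have "arc_rep V E (2 * m) A'"
    unfolding arc_rep_def
  proof (intro conjI ballI impI)
    show "0 < 2 * m" using A(1) by simp
    fix u assume u: "u \<in> V"
    show "cyc_convex (2 * m) (A' u)" using conv[OF u] .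
    show "A' u \<noteq> {}" using A(3)[OF u] A'even by blast
    fix w assume w: "w \<in> V" "u \<noteq> w"
    show "E u w \<longleftrightarrow> A' u \<inter> A' w \<noteq> {}" using A(5)[OF u w] A'even adj[OF u w] by blast
  qed
  then have le: "card (common_sets V A') \<le> card (common_sets V A)" using ext unfolding extremal_rep_def by blast
  have "common_sets V A \<subseteq> common_sets V A'" using A'even unfolding common_sets_def by blast
  moreover have "Q \<notin> common_sets V A" using no unfolding common_sets_def by blast
  moreover have "2 * e + 1 \<in> A' u" if "u \<in> Q" for u
  proof (cases "u = v")
    case True
    then show ?thesis unfolding A'_def I_def by (auto intro!: cyc_intervalI[of _ _ 0])
  next
    case False
    then show ?thesis using Q(2,3)[OF that] unfolding A'_def D_def by simp
  qed
  then have "Q \<in> common_sets V A'" using Q(1) unfolding common_sets_def by blast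
  ultimately have "common_sets V A \<subset> common_sets V A'" by blast
  then have "card (common_sets V A) < card (common_sets V A')"
    by (rule psubset_card_mono[OF finite_common_sets[OF fin]])
  then show False using le by simp
qed

subsection \<open>Circular-arc graphs that are not Helly contain an obstacle\<close>

lemma ex_last_before:
  fixes x y :: int
  assumes "x < y" "\<not> P x" "P y"
  obtains e where "x \<le> e" "e < y" "\<And>n. x \<le> n \<Longrightarrow> n \<le> e \<Longrightarrow> \<not> P n" "P (e + 1)"
proof -
  let ?S = "{n \<in> {x<..y}. P n}"
  have fin: "finite ?S" by (rule finite_subset[of _ "{x<..y}"]) auto
  have "y \<in> ?S" using assms by simp
  then have mem: "Min ?S \<in> ?S" using Min_in[OF fin] by blast
  have "\<not> P n" if "x \<le> n" "n \<le> Min ?S - 1" for n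
  proof
    assume "P n"
    then have "n \<noteq> x" using assms(2) by blast
    then have "n \<in> ?S" using that mem \<open>P n\<close> by auto
    then show False using Min_le[OF fin, of n] that(2) by simp
  qed
  then show ?thesis using that[of "Min ?S - 1"] mem by auto
qed

lemma ex_first_after:
  fixes x y :: int
  assumes "x < y" "P x" "\<not> P y"
  obtains f where "x < f" "f \<le> y" "\<And>n. f \<le> n \<Longrightarrow> n \<le> y \<Longrightarrow> \<not> P n" "P (f - 1)"
proof -
  obtain e where e: "- y \<le> e" "e < - x" "\<And>n. - y \<le> n \<Longrightarrow> n \<le> e \<Longrightarrow> \<not> P (- n)" "P (- (e + 1))"
    using ex_last_before[of "- y" "- x" "\<lambda>n. P (- n)"] assms by auto
  have "\<not> P n" if "- e \<le> n" "n \<le> y" for n using e(3)[of "- n"] that by simp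
  moreover have "- (e + 1) = - e - 1" by simp
  then have "P (- e - 1)" using e(4) by metis
  ultimately show ?thesis using that[of "- e"] e(1,2) by auto
qed

text \<open>The second conclusion is what later restricts edges between witnesses: each point of the
  circle lies between the missed points of two consecutive clique vertices, and no other clique
  vertex can miss it.\<close>

lemma ex_obstacle:
  assumes G: "Digraph.graph G" and ext: "extremal_rep (verts G) (\<lambda>u v. u \<rightarrow>\<^bsub>G\<^esub> v) m A"
    and nh: "\<not> helly_rep (verts G) (\<lambda>u v. u \<rightarrow>\<^bsub>G\<^esub> v) A"
  obtains vs Ws where "obstacle_enumeration_in G vs Ws"
    "\<And>t. \<exists>i<length vs. \<forall>v\<in>set vs - {vs ! i, vs ! ((i + 1) mod length vs)}. t \<in> A v"
proof -
  let ?E = "\<lambda>u v. u \<rightarrow>\<^bsub>G\<^esub> v"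
  let ?V = "verts G"
  have rep: "arc_rep ?V ?E m A" using ext unfolding extremal_rep_def by blast
  note A = arc_repD[OF rep]
  note adj = graph_adj[OF G]
  have fin: "finite ?V" by (rule graph_finite_verts[OF G])
  have m: "0 < m" using A(1) .
  define bad where "bad K \<longleftrightarrow> K \<subseteq> ?V \<and> (\<forall>u\<in>K. \<forall>v\<in>K. u \<noteq> v \<longrightarrow> ?E u v) \<and> \<not> (\<exists>t. \<forall>v\<in>K. t \<in> A v)" for K
  have "\<exists>K. bad K" using nh unfolding helly_rep_def bad_def by blast
  then obtain K where "bad K" ..
  then obtain Q where Q: "bad Q" "\<And>K. bad K \<Longrightarrow> card Q \<le> card K"
    using ex_has_least_nat[of bad K card] by blast
  have QV: "Q \<subseteq> ?V" and clq: "\<And>u v. u \<in> Q \<Longrightarrow> v \<in> Q \<Longrightarrow> u \<noteq> v \<Longrightarrow> ?E u v"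
    and noc: "\<not> (\<exists>t. \<forall>v\<in>Q. t \<in> A v)" using Q(1) unfolding bad_def by auto
  have finQ: "finite Q" using QV fin finite_subset by blast
  define k where "k = card Q"
  have k3: "3 \<le> k"
  proof (rule ccontr)
    assume "\<not> 3 \<le> k"
    then consider "card Q = 0" | "card Q = 1" | "card Q = 2" unfolding k_def by linarith
    then show False
    proof cases
      case 1
      then show False using finQ noc by simp
    next
      case 2
      then obtain v where "Q = {v}" by (meson card_1_singletonE)
      then show False using noc A(3)[of v] QV by auto
    next
      case 3
      then obtain u v where uv: "Q = {u, v}" "u \<noteq> v" by (meson card_2_iff)
      then have "?E u v" using clq by blast
      then show False using A(5)[of u v] uv QV noc by auto
    qed
  qed
  have "\<exists>t. 0 \<le> t \<and> t < m \<and> t \<notin> A v \<and> (\<forall>u\<in>Q. u \<noteq> v \<longrightarrow> t \<in> A u)" if v: "v \<in> Q" for v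
  proof -
    have "card (Q - {v}) < card Q" using v finQ by (intro psubset_card_mono) auto
    then have "\<not> bad (Q - {v})" using Q(2)[of "Q - {v}"] by linarith
    then obtain t where t: "\<forall>u\<in>Q - {v}. t \<in> A u" using QV clq unfolding bad_def by blast
    define s where "s = t + of_int (- (t div m)) * m"
    have "s = t mod m" unfolding s_def by (simp add: minus_div_mult_eq_mod)
    then have "0 \<le> s" "s < m" using m by simp_all
    moreover have s: "s \<in> A u" if "u \<in> Q - {v}" for u
      using cyc_convex_shift[OF A(2)[of u]] t QV that unfolding s_def by blast
    moreover have "s \<notin> A v" using noc s by blast
    ultimately show ?thesis by blast
  qed
  then obtain x where x: "\<And>v. v \<in> Q \<Longrightarrow> 0 \<le> x v" "\<And>v. v \<in> Q \<Longrightarrow> x v < m" "\<And>v. v \<in> Q \<Longrightarrow> x v \<notin> A v"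
    "\<And>v u. v \<in> Q \<Longrightarrow> u \<in> Q \<Longrightarrow> u \<noteq> v \<Longrightarrow> x v \<in> A u"
    by metis
  have "inj_on x Q" using x(3,4) by (intro inj_onI) metis
  then have card: "card (x ` Q) = k" unfolding k_def by (rule card_image)
  have "x ` Q \<subseteq> {0..<m}" "x ` Q \<noteq> {}" "finite (x ` Q)" using x(1,2) finQ k3 unfolding k_def by auto
  then obtain g :: "int \<Rightarrow> int" where mono: "strict_mono g" and
    per: "\<And>i j. g (i + j * int k) = g i + of_int j * m" and
    cls: "\<And>i. \<exists>j::int. g i + of_int j * m \<in> x ` Q" and ran: "x ` Q \<subseteq> range g"
    using ex_periodic_enumeration[of "x ` Q" m] unfolding card by metis
  have "\<exists>v\<in>Q. g i \<notin> A v \<and> (\<forall>u\<in>Q. u \<noteq> v \<longrightarrow> g i \<in> A u) \<and> (\<exists>j::int. g i + of_int j * m = x v)" for i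
  proof -
    obtain j :: int and v where v: "v \<in> Q" "g i + of_int j * m = x v" using cls[of i] by blast
    then have "g i \<in> A u \<longleftrightarrow> x v \<in> A u" if "u \<in> Q" for u
      using cyc_convex_shift[OF A(2)[of u], of "g i" j] that QV by auto
    then show ?thesis using v x(3,4)[OF v(1)] by blast
  qed
  \<comment> \<open>\<open>w i\<close> is the only member of \<open>Q\<close> that misses
    \<open>g i\<close>; the sequence has period \<open>k\<close> and runs exactly once through
    \<open>Q\<close> in each period.\<close>
  then obtain w where w: "\<And>i. w i \<in> Q" "\<And>i. g i \<notin> A (w i)" "\<And>i u. u \<in> Q \<Longrightarrow> u \<noteq> w i \<Longrightarrow> g i \<in> A u"
    "\<And>i. \<exists>j::int. g i + of_int j * m = x (w i)"
    by metis
  have wV: "w i \<in> ?V" for i using w(1) QV by blast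
  have wper: "w (i + j * int k) = w i" for i j
  proof (rule ccontr)
    assume "w (i + j * int k) \<noteq> w i"
    then have "g (i + j * int k) \<in> A (w i)" using w(3)[of "w i" "i + j * int k"] w(1)[of i] by metis
    then show False unfolding per using cyc_convex_shift[OF A(2)[OF wV]] w(2) by blast
  qed
  have wne: "w i \<noteq> w j" if ij: "i < j" "j < i + int k" for i j
  proof
    assume "w i = w j"
    then obtain a b :: int where ab: "g i + of_int a * m = g j + of_int b * m" using w(4) by metis
    then have "g (i + a * int k) = g (j + b * int k)" unfolding per .
    then have eq: "i + a * int k = j + b * int k" using mono strict_mono_eq by blast
    then have "j - i = (a - b) * int k" by (simp add: algebra_simps)
    then have "0 < (a - b) * int k" "(a - b) * int k < int k" using ij by linarith+
    then have "0 < a - b" by (simp add: zero_less_mult_iff)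
    then have "1 * int k \<le> (a - b) * int k" by (intro mult_right_mono) auto
    then show False using \<open>(a - b) * int k < int k\<close> by simp
  qed
  have wsur: "\<exists>j. i \<le> j \<and> j < i + int k \<and> w j = u" if u: "u \<in> Q" for u i
  proof -
    obtain l where l: "x u = g l" using ran u by blast
    then have wl: "w l = u" using w(3)[of u l] x(3) u by metis
    define j where "j = l + (- ((l - i) div int k)) * int k"
    have "j = i + (l - i) mod int k" unfolding j_def by (simp add: algebra_simps minus_div_mult_eq_mod[symmetric])
    then have "i \<le> j" "j < i + int k" using k3 by simp_all
    moreover have "w j = u" unfolding j_def wper wl ..
    ultimately show ?thesis by blast
  qed
  have gk: "g (i + int k) = g i + m" for i using per[of i 1] by simp
  \<comment> \<open>\<open>u\<close> misses some \<open>g j\<close> further round the circle. If it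
    missed \<open>t\<close> too, these two points would separate its points \<open>g i\<close> and
    \<open>g (i + 1)\<close>.\<close>
  have between: "t \<in> A u" if t: "g i \<le> t" "t \<le> g (i + 1)" and u: "u \<in> Q" "u \<noteq> w i" "u \<noteq> w (i + 1)" for i t u
  proof (rule ccontr)
    assume tn: "t \<notin> A u"
    obtain j where j: "i \<le> j" "j < i + int k" "w j = u" using wsur[OF u(1)] by blast
    have "j \<noteq> i" "j \<noteq> i + 1" using j(3) u by auto
    then have "g (i + 1) < g j" using mono j(1) by (simp add: strict_mono_less)
    moreover have "g j < g i + m" using mono j(2) unfolding gk[symmetric] by (simp add: strict_mono_less)
    moreover have gi: "g i \<in> A u" "g (i + 1) \<in> A u" using w(3) u by auto
    moreover have "g i < t" "t < g (i + 1)" using t gi tn by (auto simp: le_less)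
    ultimately have "g j \<in> A u" using cyc_convexD[OF A(2)] tn u(1) QV by blast
    then show False using w(2)[of j] j(3) by simp
  qed
  have wit: "\<exists>ws. witness_enumeration G Q (w i) (w (i + 1)) ws" for i
  proof -
    define a where "a = w i"
    define b where "b = w (i + 1)"
    have ab: "a \<noteq> b" unfolding a_def b_def using wne[of i "i + 1"] k3 by simp
    have abQ: "a \<in> Q" "b \<in> Q" unfolding a_def b_def using w(1) by auto
    have abV: "a \<in> ?V" "b \<in> ?V" using abQ QV by auto
    have gg: "g i < g (i + 1)" "g (i + 1) < g i + m"
      unfolding gk[symmetric] using mono k3 by (simp_all add: strict_mono_less)
    have gia: "g i \<notin> A a" "g (i + 1) \<in> A a" and gib: "g i \<in> A b" "g (i + 1) \<notin> A b"
      using w(2) w(3) abQ ab unfolding a_def b_def by auto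
    have mid: "t \<in> A u" if "g i \<le> t" "t \<le> g (i + 1)" "u \<in> Q" "u \<noteq> a" "u \<noteq> b" for t u
      using between[of i t u] that unfolding a_def b_def by blast
    \<comment> \<open>\<open>e\<close> is the last point before \<open>a\<close> begins and
      \<open>f\<close> the first point after \<open>b\<close> ends: the gap of \<open>a\<close>
      covers \<open>g i\<close> to \<open>e\<close>, that of \<open>b\<close> covers
      \<open>f\<close> to \<open>g (i + 1)\<close>.\<close>
    obtain e where e: "g i \<le> e" "e < g (i + 1)" "\<And>n. g i \<le> n \<Longrightarrow> n \<le> e \<Longrightarrow> n \<notin> A a" "e + 1 \<in> A a"
      using ex_last_before[of "g i" "g (i + 1)" "\<lambda>n. n \<in> A a"] gg gia by blast
    obtain f where f: "g i < f" "f \<le> g (i + 1)" "\<And>n. f \<le> n \<Longrightarrow> n \<le> g (i + 1) \<Longrightarrow> n \<notin> A b" "f - 1 \<in> A b"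
      using ex_first_after[of "g i" "g (i + 1)" "\<lambda>n. n \<in> A b"] gg gib by blast
    \<comment> \<open>With disjoint gaps, \<open>e\<close> would lie in every member of
      \<open>Q\<close> except \<open>a\<close>, which begins at \<open>e + 1\<close>; then a further
      common point could be created.\<close>
    have fe: "f \<le> e"
    proof (rule ccontr)
      assume "\<not> f \<le> e"
      then have ef: "e < f" by simp
      have "e \<in> A b"
      proof (rule ccontr)
        assume eb: "e \<notin> A b"
        then have "g i < e" "e < f - 1" using ef e(1) f(4) gib by (cases "e = f - 1"; auto simp: le_less)+
        then have "g (i + 1) \<in> A b"
          using cyc_convexD[OF A(2)[OF abV(2)], of "g i" e "f - 1" "g (i + 1)"] f gib eb gg by simp
        then show False using gib by blast
      qed
      then have "e \<in> A u" if "u \<in> Q" "u \<noteq> a" for u using mid[of e u] e that by (cases "u = b") auto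
      then show False
        using extremal_rep_no_new_common[OF ext fin adj(1) abQ(1) QV _ _ noc e(4)] clq abQ(1) by blast
    qed
    \<comment> \<open>\<open>u\<close> keeps \<open>a\<close> from growing down to \<open>e\<close>,
      and \<open>z\<close> keeps \<open>b\<close> from growing up to \<open>f\<close>. Both have a
      point between \<open>g i\<close> and \<open>g (i + 1)\<close>, so only \<open>a\<close> and
      \<open>b\<close> can be their non-neighbours in \<open>Q\<close>.\<close>
    obtain u where u: "u \<in> ?V" "u \<noteq> a" "\<not> a \<rightarrow>\<^bsub>G\<^esub> u" "e \<in> A u"
      using extremal_rep_blocked[OF ext adj(1) abV(1), of e 1] e by auto
    obtain z where z: "z \<in> ?V" "z \<noteq> b" "\<not> b \<rightarrow>\<^bsub>G\<^esub> z" "f \<in> A z"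
      using extremal_rep_blocked[OF ext adj(1) abV(2), of f "- 1"] f by auto
    have nn: "non_neighbours G y \<inter> Q \<subseteq> {a, b}" if "y \<in> ?V" "g i \<le> t" "t \<le> g (i + 1)" "t \<in> A y" for y t
    proof
      fix v assume v: "v \<in> non_neighbours G y \<inter> Q"
      then have "v \<noteq> y" "\<not> ?E y v" "v \<in> ?V" unfolding non_neighbours_def by auto
      then show "v \<in> {a, b}" using mid[of t v] A(4)[of y v t] that v by blast
    qed
    have nu: "non_neighbours G u \<inter> Q \<subseteq> {a, b}" using nn[OF u(1) _ _ u(4)] e by simp
    have nz: "non_neighbours G z \<inter> Q \<subseteq> {a, b}" using nn[OF z(1) _ _ z(4)] f by simp
    have au: "a \<in> non_neighbours G u" and bz: "b \<in> non_neighbours G z"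
      using u z abV adj(1) unfolding non_neighbours_def by blast+
    consider "b \<in> non_neighbours G u" | "a \<in> non_neighbours G z"
      | "b \<notin> non_neighbours G u" "a \<notin> non_neighbours G z" by blast
    then show ?thesis
    proof cases
      case 1
      then have "non_neighbours G u \<inter> Q = {a, b}" using nu au abQ by blast
      then have "witness_enumeration G Q a b [u]" using u(1) unfolding witness_enumeration_def by simp
      then show ?thesis unfolding a_def b_def by blast
    next
      case 2
      then have "non_neighbours G z \<inter> Q = {a, b}" using nz bz abQ by blast
      then have "witness_enumeration G Q a b [z]" using z(1) unfolding witness_enumeration_def by simp
      then show ?thesis unfolding a_def b_def by blast
    next
      case 3
      then have nue: "non_neighbours G u \<inter> Q = {a}" and nze: "non_neighbours G z \<inter> Q = {b}"
        using nu nz au bz abQ by blast+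
      have "u \<noteq> b" using u(3) clq[OF abQ ab] by blast
      then have "?E u b" using 3(1) abV(2) unfolding non_neighbours_def by blast
      then obtain q0 where q0: "q0 \<in> A u" "q0 \<in> A b" using A(5)[OF u(1) abV(2) \<open>u \<noteq> b\<close>] by blast
      \<comment> \<open>\<open>u\<close> contains \<open>e\<close> and meets \<open>b\<close>, which
        has no point from \<open>f\<close> to \<open>g (i + 1)\<close>. It cannot get there upwards
        through \<open>e + 1\<close>, a point of its non-neighbour \<open>a\<close>, so it extends
        downwards through \<open>f\<close>.\<close>
      have fu: "f \<in> A u"
      proof (rule ccontr)
        assume fu: "f \<notin> A u"
        \<comment> \<open>The translate of \<open>q0\<close> in the period that ends just before
          \<open>e + 1\<close>.\<close>
        define q where "q = q0 + of_int (- ((q0 - (e + 1)) div m) - 1) * m"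
        have q: "q \<in> A u" "q \<in> A b"
          unfolding q_def using q0 cyc_convex_shift[OF A(2)[OF u(1)]] cyc_convex_shift[OF A(2)[OF abV(2)]] by blast+
        have "q + m = e + 1 + (q0 - (e + 1)) mod m"
          unfolding q_def by (simp add: algebra_simps minus_div_mult_eq_mod[symmetric])
        then have qb: "e + 1 - m \<le> q" "q < e + 1" using m pos_mod_sign[OF m, of "q0 - (e + 1)"] pos_mod_bound[OF m, of "q0 - (e + 1)"] by linarith+
        have eu: "e + 1 \<notin> A u" using A(4)[OF abV(1) u(1) e(4)] u by blast
        have "e + 1 - m \<notin> A u" using cyc_convex_shift1[OF A(2)[OF u(1)], of "e + 1 - m"] eu by simp
        then have "e + 1 < q + m" using qb(1) q(1) by (cases "q = e + 1 - m") auto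
        moreover have "q < f" using f(3)[of q] q(2) qb(2) e(2) by (cases "q < f") auto
        moreover have "f < e" using fe fu u(4) by (cases "f = e") auto
        ultimately have "e + 1 \<in> A u"
          using cyc_convexD[OF A(2)[OF u(1)], of q f e "e + 1"] q(1) u(4) fu by simp
        then show False using eu by blast
      qed
      have "u \<noteq> z" using nue nze ab by blast
      then have "?E u z" using A(4)[OF u(1) z(1) fu z(4)] by blast
      then have "witness_enumeration G Q a b [u, z]"
        using u(1) z(1) nue nze unfolding witness_enumeration_def by simp
      then show ?thesis unfolding a_def b_def by blast
    qed
  qed
  define vs where "vs = map (\<lambda>i. w (int i)) [0..<k]"
  define Ws where "Ws = map (\<lambda>i. SOME ws. witness_enumeration G Q (w (int i)) (w (int i + 1)) ws) [0..<k]"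
  have len: "length vs = k" "length Ws = k" unfolding vs_def Ws_def by simp_all
  have wmod: "w (i mod int k) = w i" for i
    using wper[of i "- (i div int k)"] by (simp add: minus_div_mult_eq_mod)
  have nth: "vs ! i = w (int i)" if "i < k" for i using that unfolding vs_def by simp
  have nth': "vs ! ((i + 1) mod k) = w (int i + 1)" for i
  proof -
    have "vs ! ((i + 1) mod k) = w (int ((i + 1) mod k))" using nth k3 by simp
    also have "\<dots> = w (int i + 1)" using wmod[of "int i + 1"] by (simp add: zmod_int add.commute)
    finally show ?thesis .
  qed
  have setvs: "set vs = Q"
  proof
    show "set vs \<subseteq> Q" unfolding vs_def using w(1) by auto
    show "Q \<subseteq> set vs"
    proof
      fix u assume "u \<in> Q"
      then obtain j where "0 \<le> j" "j < int k" "w j = u" using wsur[of u 0] by auto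
      then have "nat j < k" "vs ! nat j = u" using nth[of "nat j"] by auto
      then show "u \<in> set vs" using len(1) nth_mem by metis
    qed
  qed
  have "distinct vs" unfolding vs_def distinct_map using wne
    by (auto intro!: inj_onI) (metis add.left_neutral int_ops(1) linorder_neqE_nat of_nat_0_le_iff of_nat_less_iff add_strict_increasing2 of_nat_add)
  moreover have "clique G (set vs)" unfolding setvs clique_def using QV clq by blast
  moreover have "witness_enumeration G (set vs) (vs ! i) (vs ! ((i + 1) mod k)) (Ws ! i)" if "i < k" for i
    unfolding setvs nth' nth[OF that] using that someI_ex[OF wit[of "int i"]] by (simp add: Ws_def)
  ultimately have "obstacle_enumeration_in G vs Ws"
    unfolding obstacle_enumeration_in_def len using k3 by simp
  moreover have "\<exists>i<length vs. \<forall>v\<in>set vs - {vs ! i, vs ! ((i + 1) mod length vs)}. t \<in> A v" for t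
  proof -
    have kk: "g (j * int k) = g 0 + j * m" for j using per[of 0 j] by simp
    define j where "j = (t - g 0) div m"
    have "g (j * int k) \<le> t" unfolding kk j_def using m
      by (metis add.commute diff_ge_0_iff_ge le_diff_eq minus_div_mult_eq_mod pos_mod_sign)
    moreover have "t < g ((j + 1) * int k)" unfolding kk j_def using m pos_mod_bound[OF m, of "t - g 0"]
      by (simp add: algebra_simps minus_div_mult_eq_mod[symmetric])
    moreover have "j * int k < (j + 1) * int k" using k3 by simp
    ultimately obtain e where e: "\<not> t < g e" "t < g (e + 1)"
      using ex_last_before[of "j * int k" "(j + 1) * int k" "\<lambda>n. t < g n"] by (metis linorder_not_less order_refl)
    define i where "i = nat (e mod int k)"
    have i: "i < k" "int i = e mod int k" unfolding i_def using k3 by (simp_all add: nat_less_iff)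
    have "vs ! i = w e" unfolding nth[OF i(1)] i(2) wmod ..
    moreover have "vs ! ((i + 1) mod k) = w (e + 1)"
      unfolding nth' i(2) using wmod[of "e mod int k + 1"] wmod[of "e + 1"] by (metis mod_add_left_eq)
    ultimately show ?thesis unfolding len setvs using between[of e t] e i(1)
      by (intro exI[of _ i]) auto
  qed
  ultimately show ?thesis using that by blast
qed

section \<open>Rigidity of the witness enumerations in a minimal graph\<close>

lemma witness_cases:
  assumes "obstacle_enumeration_in G vs Ws" "j < length vs" "y \<in> set (Ws ! j)"
  obtains (both) "Ws ! j = [y]" "non_neighbours G y \<inter> set vs = {vs ! j, vs ! ((j + 1) mod length vs)}"
  | (left) z where "Ws ! j = [y, z]" "non_neighbours G y \<inter> set vs = {vs ! j}"
  | (right) u where "Ws ! j = [u, y]" "non_neighbours G y \<inter> set vs = {vs ! ((j + 1) mod length vs)}"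
proof -
  have "witness_enumeration G (set vs) (vs ! j) (vs ! ((j + 1) mod length vs)) (Ws ! j)"
    using assms(1,2) unfolding obstacle_enumeration_in_def by blast
  then show ?thesis using assms(3) that unfolding witness_enumeration_def by fastforce
qed

lemma obstacle_nth_eq:
  assumes "obstacle_enumeration_in G vs Ws" "i < length vs" "j < length vs"
  shows "vs ! i = vs ! j \<longleftrightarrow> i = j"
  using assms unfolding obstacle_enumeration_in_def by (auto simp: nth_eq_iff_index_eq)

lemma obstacle_length:
  assumes "obstacle_enumeration_in G vs Ws"
  shows "3 \<le> length vs" "length Ws = length vs" "\<And>i. (i + 1) mod length vs < length vs"
proof -
  show *: "3 \<le> length vs" "length Ws = length vs" using assms unfolding obstacle_enumeration_in_def by auto
  show "(i + 1) mod length vs < length vs" for i using *(1) by (intro mod_less_divisor) linarith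
qed

text \<open>A witness whose only missed clique vertex is \<open>vs ! i\<close> can occur in two
  places only: at the end of the enumeration before that vertex, or at the start of the one after
  it. The next lemma is the mirror image.\<close>

lemma single_witness_last:
  assumes obs: "obstacle_enumeration_in G vs Ws" and ij: "i < length vs" "j < length vs" "j \<noteq> i"
    and y: "y \<in> set (Ws ! j)" "non_neighbours G y \<inter> set vs = {vs ! i}"
  shows "(j + 1) mod length vs = i" "last (Ws ! j) = y"
proof -
  note eq = obstacle_nth_eq[OF obs] and len = obstacle_length[OF obs]
  have ne: "(j + 1) mod length vs \<noteq> j" using ij(2) len(1) by (auto simp: mod_Suc)
  have "(j + 1) mod length vs = i \<and> last (Ws ! j) = y"
    using obs ij(2) y(1)
  proof (cases rule: witness_cases)
    case both
    then have "vs ! j = vs ! i" "vs ! ((j + 1) mod length vs) = vs ! i" using y(2) by auto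
    then show ?thesis using eq ij ne len(3) by blast
  next
    case (left z)
    then have "vs ! j = vs ! i" using y(2) by simp
    then show ?thesis using eq ij by blast
  next
    case (right u)
    then have "vs ! ((j + 1) mod length vs) = vs ! i" using y(2) by simp
    then show ?thesis using eq[OF len(3) ij(1)] right(1) by simp
  qed
  then show "(j + 1) mod length vs = i" "last (Ws ! j) = y" by auto
qed

lemma single_witness_hd:
  assumes obs: "obstacle_enumeration_in G vs Ws" and ij: "i < length vs" "j < length vs" "(j + 1) mod length vs \<noteq> i"
    and y: "y \<in> set (Ws ! j)" "non_neighbours G y \<inter> set vs = {vs ! i}"
  shows "j = i" "hd (Ws ! j) = y"
proof -
  note eq = obstacle_nth_eq[OF obs] and len = obstacle_length[OF obs]
  have ne: "(j + 1) mod length vs \<noteq> j" using ij(2) len(1) by (auto simp: mod_Suc)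
  have "j = i \<and> hd (Ws ! j) = y"
    using obs ij(2) y(1)
  proof (cases rule: witness_cases)
    case both
    then have "vs ! j = vs ! i" "vs ! ((j + 1) mod length vs) = vs ! i" using y(2) by auto
    then show ?thesis using eq ij ne len(3) by blast
  next
    case (right u)
    then have "vs ! ((j + 1) mod length vs) = vs ! i" using y(2) by simp
    then show ?thesis using eq[OF len(3) ij(1)] ij(3) by blast
  next
    case (left z)
    then have "vs ! j = vs ! i" using y(2) by simp
    then show ?thesis using eq ij left(1) by simp
  qed
  then show "j = i" "hd (Ws ! j) = y" by auto
qed

lemma witness_not_in_clique:
  assumes obs: "obstacle_enumeration_in G vs Ws" and "y \<in> witnesses Ws"
  shows "y \<notin> set vs" "y \<in> verts G"
proof -
  note len = obstacle_length[OF obs]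
  obtain j where j: "j < length vs" "y \<in> set (Ws ! j)"
    using assms(2) len(2) unfolding witnesses_def by (metis UN_E in_set_conv_nth)
  have "witness_enumeration G (set vs) (vs ! j) (vs ! ((j + 1) mod length vs)) (Ws ! j)"
    using obs j(1) unfolding obstacle_enumeration_in_def by blast
  then show "y \<in> verts G" using j(2) unfolding witness_enumeration_def by blast
  have "non_neighbours G y \<inter> set vs \<noteq> {}" using obs j by (cases rule: witness_cases) auto
  then obtain v where v: "v \<in> set vs" "v \<in> non_neighbours G y" by blast
  moreover have "clique G (set vs)" using obs unfolding obstacle_enumeration_in_def by blast
  ultimately show "y \<notin> set vs" unfolding clique_def non_neighbours_def by auto
qed

text \<open>
  Replacing a witness enumeration by an adjacent pair of vertices of the right types yields another
  obstacle enumeration, so in a minimal graph the pair must have been there already.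
\<close>

lemma minimal_obstacle_rigid:
  assumes G: "Digraph.graph G" and min: "minimal_forbidden_induced_subgraph helly_circular_arc_graph G"
    and obs: "obstacle_enumeration_in G vs Ws" and i: "i < length vs"
    and y: "y1 \<in> witnesses Ws" "y2 \<in> witnesses Ws" "y1 \<rightarrow>\<^bsub>G\<^esub> y2"
      "non_neighbours G y1 \<inter> set vs = {vs ! i}" "non_neighbours G y2 \<inter> set vs = {vs ! ((i + 1) mod length vs)}"
  shows "Ws ! i = [y1, y2]"
proof -
  let ?k = "length vs"
  let ?j = "(i + 1) mod length vs"
  let ?Ws' = "Ws[i := [y1, y2]]"
  note eq = obstacle_nth_eq[OF obs] and len = obstacle_length[OF obs]
  have jne: "?j \<noteq> i" using i len(1) by (auto simp: mod_Suc)
  have yV: "y1 \<in> verts G" "y2 \<in> verts G" using witness_not_in_clique[OF obs] y(1,2) by auto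
  then have "witness_enumeration G (set vs) (vs ! i) (vs ! ?j) [y1, y2]"
    using y(3-5) unfolding witness_enumeration_def by simp
  then have obs': "obstacle_enumeration_in G vs ?Ws'"
    using obs i unfolding obstacle_enumeration_in_def by (auto simp: nth_list_update)
  then have cover: "verts G = set vs \<union> witnesses ?Ws'" by (rule minimal_obstacle_covers[OF G min])
  \<comment> \<open>No witness may be lost by the replacement, so one that stood at position
    \<open>i\<close> is either new there or also occurs at another position.\<close>
  have other: "(\<exists>j<?k. j \<noteq> i \<and> w \<in> set (Ws ! j)) \<or> w = y1 \<or> w = y2" if w: "w \<in> witnesses Ws" for w
  proof -
    have "w \<in> witnesses ?Ws'" using witness_not_in_clique[OF obs w] cover by blast
    then obtain j where "j < ?k" "w \<in> set (?Ws' ! j)"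
      using len(2) unfolding witnesses_def by (metis UN_E in_set_conv_nth length_list_update)
    then show ?thesis using len(2) by (cases "j = i") auto
  qed
  have inW: "w \<in> witnesses Ws" if "w \<in> set (Ws ! j)" "j < ?k" for w j
    using that len(2) unfolding witnesses_def by (metis UN_I nth_mem)
  have loc: "\<exists>j<?k. w \<in> set (Ws ! j)" if "w \<in> witnesses Ws" for w
    using that len(2) unfolding witnesses_def by (metis UN_E in_set_conv_nth)
  have neq: "vs ! i \<noteq> vs ! ?j" using eq[OF i len(3)] jne by metis
  have "witness_enumeration G (set vs) (vs ! i) (vs ! ?j) (Ws ! i)"
    using obs i unfolding obstacle_enumeration_in_def by blast
  then consider (O1) w where "Ws ! i = [w]" "non_neighbours G w \<inter> set vs = {vs ! i, vs ! ?j}"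
    | (O2) u z where "Ws ! i = [u, z]" "non_neighbours G u \<inter> set vs = {vs ! i}" "non_neighbours G z \<inter> set vs = {vs ! ?j}"
    unfolding witness_enumeration_def by blast
  then show ?thesis
  proof cases
    case O1
    \<comment> \<open>\<open>w\<close> would have to occur at another position too, but the two
      clique vertices that it misses determine the edge, as the clique has at least three
      vertices.\<close>
    have "w \<in> witnesses Ws" using inW[of w i] O1(1) i by simp
    moreover have "w \<noteq> y1" "w \<noteq> y2" using O1(2) y(4,5) neq by auto
    ultimately obtain j where j: "j < ?k" "j \<noteq> i" "w \<in> set (Ws ! j)" using other by blast
    have "{vs ! i, vs ! ?j} \<subseteq> {vs ! j, vs ! ((j + 1) mod ?k)}"
      using obs j(1,3) O1(2) by (cases rule: witness_cases) auto
    then have "vs ! i = vs ! ((j + 1) mod ?k)" "vs ! ?j = vs ! j \<or> vs ! ?j = vs ! ((j + 1) mod ?k)"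
      using eq[OF i j(1)] j(2) by auto
    then have "vs ! i = vs ! ((j + 1) mod ?k)" "vs ! ?j = vs ! j" using neq by auto
    then have "i = (j + 1) mod ?k" "?j = j" using eq[OF i len(3)] eq[OF len(3) j(1)] by auto
    then have False using i j(1,2) len(1) by (auto simp: mod_Suc split: if_splits)
    then show ?thesis ..
  next
    case O2
    have u: "u \<in> witnesses Ws" and z: "z \<in> witnesses Ws" using inW[of _ i] O2(1) i by auto
    \<comment> \<open>If they differed, both would have to be the last entry of the preceding
      enumeration. The argument for \<open>z\<close> and \<open>y2\<close> uses the first entry of
      the following one.\<close>
    have "u = y1"
    proof (rule ccontr)
      assume ne: "u \<noteq> y1"
      have "u \<noteq> y2" using O2(2) y(5) neq by auto
      then obtain j where j: "j < ?k" "j \<noteq> i" "u \<in> set (Ws ! j)" using other[OF u] ne by blast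
      obtain l where l: "l < ?k" "y1 \<in> set (Ws ! l)" using loc[OF y(1)] by blast
      have "l \<noteq> i"
      proof
        assume "l = i"
        then have "y1 = z" using l(2) O2(1) ne by simp
        then show False using O2(3) y(4) neq by auto
      qed
      have "(j + 1) mod ?k = i" "last (Ws ! j) = u" using single_witness_last[OF obs i j O2(2)] by auto
      moreover have "(l + 1) mod ?k = i" "last (Ws ! l) = y1"
        using single_witness_last[OF obs i l(1) \<open>l \<noteq> i\<close> l(2) y(4)] by auto
      moreover have "j = l" if "(j + 1) mod ?k = i" "(l + 1) mod ?k = i"
        using that j(1) l(1) by (auto simp: mod_Suc split: if_splits)
      ultimately show False using ne by simp
    qed
    moreover have "z = y2"
    proof (rule ccontr)
      assume ne: "z \<noteq> y2"
      have "z \<noteq> y1" using O2(3) y(4) neq by auto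
      then obtain j where j: "j < ?k" "j \<noteq> i" "z \<in> set (Ws ! j)" using other[OF z] ne by blast
      obtain l where l: "l < ?k" "y2 \<in> set (Ws ! l)" using loc[OF y(2)] by blast
      have "l \<noteq> i"
      proof
        assume "l = i"
        then have "y2 = u" using l(2) O2(1) ne by simp
        then show False using O2(2) y(5) neq by auto
      qed
      have inj: "(a + 1) mod ?k \<noteq> ?j" if "a < ?k" "a \<noteq> i" for a
        using that i by (auto simp: mod_Suc split: if_splits)
      have "j = ?j" "hd (Ws ! j) = z" using single_witness_hd[OF obs len(3) j(1) inj[OF j(1,2)] j(3) O2(3)] by auto
      moreover have "l = ?j" "hd (Ws ! l) = y2"
        using single_witness_hd[OF obs len(3) l(1) inj[OF l(1) \<open>l \<noteq> i\<close>] l(2) y(5)] by auto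
      ultimately show False using ne by simp
    qed
    ultimately show ?thesis using O2(1) by simp
  qed
qed

text \<open>The ends of an invalid edge share a point that at most two consecutive clique vertices
  miss. This fixes what the ends miss, and rigidity shows that they already form a witness
  enumeration.\<close>

lemma circular_arc_minimal_imp_essential:
  assumes ca: "circular_arc_graph G" and min: "minimal_forbidden_induced_subgraph helly_circular_arc_graph G"
  shows "essential_obstacle G"
proof -
  have G: "Digraph.graph G" using ca unfolding circular_arc_graph_def by blast
  have fin: "finite (verts G)" by (rule graph_finite_verts[OF G])
  let ?E = "\<lambda>u v. u \<rightarrow>\<^bsub>G\<^esub> v"
  obtain k0 and A0 :: "'a \<Rightarrow> int set" where "arc_rep (verts G) ?E k0 A0"
    using circular_arc_graph_arc_rep[OF ca] .
  then obtain m A where ext: "extremal_rep (verts G) ?E m A" using ex_extremal_rep fin by blast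
  then have rep: "arc_rep (verts G) ?E m A" unfolding extremal_rep_def by blast
  have "\<not> helly_rep (verts G) ?E A"
  proof
    assume helly: "helly_rep (verts G) ?E A"
    obtain X where "circular_arc_model G X" "helly_family (X ` verts G)"
      using arc_rep_realize[OF rep fin] helly by metis
    then have "helly_circular_arc_graph G" using G unfolding helly_circular_arc_graph_def by blast
    then show False using min unfolding minimal_forbidden_induced_subgraph_def by blast
  qed
  then obtain vs Ws where obs: "obstacle_enumeration_in G vs Ws" and
    pt: "\<And>t. \<exists>i<length vs. \<forall>v\<in>set vs - {vs ! i, vs ! ((i + 1) mod length vs)}. t \<in> A v"
    using ex_obstacle[OF G ext] by blast
  let ?k = "length vs"
  let ?nn = "\<lambda>y. non_neighbours G y \<inter> set vs"
  have QV: "set vs \<subseteq> verts G" using obs unfolding obstacle_enumeration_in_def clique_def by blast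
  have "valid_edge G vs Ws y1 y2" if y: "y1 \<in> witnesses Ws" "y2 \<in> witnesses Ws" "y1 \<rightarrow>\<^bsub>G\<^esub> y2" for y1 y2
  proof (rule ccontr)
    assume inv: "\<not> valid_edge G vs Ws y1 y2"
    have yV: "y1 \<in> verts G" "y2 \<in> verts G" using witness_not_in_clique[OF obs] y(1,2) by auto
    have "y1 \<noteq> y2" using y(3) graph_adj(2)[OF G] by metis
    then obtain t where t: "t \<in> A y1" "t \<in> A y2" using arc_repD(5)[OF rep yV _ y(3)] by blast
    obtain i where i: "i < ?k" "\<And>v. v \<in> set vs - {vs ! i, vs ! ((i + 1) mod ?k)} \<Longrightarrow> t \<in> A v" using pt by blast
    have sub: "?nn y \<subseteq> {vs ! i, vs ! ((i + 1) mod ?k)}" if "y \<in> verts G" "t \<in> A y" for y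
    proof
      fix v assume v: "v \<in> ?nn y"
      then have "v \<noteq> y" "\<not> ?E y v" "v \<in> verts G" unfolding non_neighbours_def by auto
      then show "v \<in> {vs ! i, vs ! ((i + 1) mod ?k)}"
        using i(2)[of v] arc_repD(4)[OF rep that(1), of v t] that(2) v by blast
    qed
    have "\<not> ?nn y1 \<subseteq> ?nn y2" "\<not> ?nn y2 \<subseteq> ?nn y1"
      and no: "\<not> (\<exists>ws\<in>set Ws. y1 \<in> set ws \<and> y2 \<in> set ws)"
      using inv unfolding valid_edge_def by auto
    \<comment> \<open>Two incomparable subsets of a pair are its two singletons.\<close>
    then have "?nn y1 = {vs ! i} \<and> ?nn y2 = {vs ! ((i + 1) mod ?k)} \<or>
        ?nn y2 = {vs ! i} \<and> ?nn y1 = {vs ! ((i + 1) mod ?k)}"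
      using sub[OF yV(1) t(1)] sub[OF yV(2) t(2)] by blast
    then have "Ws ! i = [y1, y2] \<or> Ws ! i = [y2, y1]"
      using minimal_obstacle_rigid[OF G min obs i(1)] y graph_adj(1)[OF G y(3)] by blast
    moreover have "Ws ! i \<in> set Ws" using i(1) obstacle_length(2)[OF obs] by simp
    ultimately show False using no by (metis list.set_intros)
  qed
  moreover have "verts G = set vs \<union> witnesses Ws" by (rule minimal_obstacle_covers[OF G min obs])
  ultimately have "essential_obstacle_enumeration_of G vs Ws"
    using obs unfolding essential_obstacle_enumeration_of_def obstacle_enumeration_of_def by blast
  then show ?thesis using G unfolding essential_obstacle_def by blast
qed

subsection \<open>Essential obstacles\<close>

lemma cyc_interval_translate:
  fixes m :: int
  shows "cyc_interval m (a + c * m) (b + c * m) = cyc_interval m a b"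
proof -
  have 1: "a + c * m \<le> t + of_int j * m \<longleftrightarrow> a \<le> t + of_int (j - c) * m"
    "t + of_int j * m \<le> b + c * m \<longleftrightarrow> t + of_int (j - c) * m \<le> b"
    "a \<le> t + of_int j * m \<longleftrightarrow> a + c * m \<le> t + of_int (j + c) * m"
    "t + of_int j * m \<le> b \<longleftrightarrow> t + of_int (j + c) * m \<le> b + c * m" for t j
    by (simp_all add: algebra_simps)
  show ?thesis unfolding cyc_interval_def using 1 by blast
qed

text \<open>After translation the two sets are given by intervals around \<open>n\<close> and
  \<open>n'\<close>. As these differ by at most one, no integer lies between the intervals and their
  union is an interval again.\<close>

lemma cyc_convex_Un:
  fixes m :: int
  assumes A: "cyc_convex m A" and B: "cyc_convex m B" and m: "0 < m"
    and n: "n \<in> A" "n' \<in> B" "n' \<le> n + 1" "n \<le> n' + 1"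
  shows "cyc_convex m (A \<union> B)"
proof -
  have shift: "\<exists>s e. C = cyc_interval m s e \<and> s \<le> p \<and> p \<le> e" if C: "cyc_convex m C" "p \<in> C" for C p
  proof -
    obtain s e where se: "C = cyc_interval m s e" using cyc_convex_is_cyc_interval[OF C(1) m] C(2) by blast
    obtain j :: int where j: "s \<le> p + of_int j * m" "p + of_int j * m \<le> e"
      using C(2) unfolding se by (rule cyc_intervalE)
    have "C = cyc_interval m (s + (- j) * m) (e + (- j) * m)" unfolding cyc_interval_translate se ..
    then show ?thesis using j by (intro exI[of _ "s + (- j) * m"] exI[of _ "e + (- j) * m"]) auto
  qed
  obtain a b where ab: "A = cyc_interval m a b" "a \<le> n" "n \<le> b" using shift[OF A n(1)] by blast
  obtain c d where cd: "B = cyc_interval m c d" "c \<le> n'" "n' \<le> d" using shift[OF B n(2)] by blast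
  have "A \<union> B = cyc_interval m (min a c) (max b d)"
  proof (intro set_eqI iffI)
    fix t assume "t \<in> A \<union> B"
    then obtain j :: int where "a \<le> t + of_int j * m \<and> t + of_int j * m \<le> b \<or> c \<le> t + of_int j * m \<and> t + of_int j * m \<le> d"
      unfolding ab(1) cd(1) cyc_interval_def by blast
    then show "t \<in> cyc_interval m (min a c) (max b d)" by (intro cyc_intervalI[of _ _ j]) auto
  next
    fix t assume "t \<in> cyc_interval m (min a c) (max b d)"
    then obtain j :: int where "min a c \<le> t + of_int j * m" "t + of_int j * m \<le> max b d"
      by (rule cyc_intervalE)
    then have "a \<le> t + of_int j * m \<and> t + of_int j * m \<le> b \<or> c \<le> t + of_int j * m \<and> t + of_int j * m \<le> d"
      using ab(2,3) cd(2,3) n(3,4) by linarith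
    then show "t \<in> A \<union> B" unfolding ab(1) cd(1) cyc_interval_def by blast
  qed
  then show ?thesis using cyc_convex_cyc_interval[OF m] by simp
qed

text \<open>
  The indices of an obstacle enumeration are extended periodically to all integers; \<open>H i\<close> and \<open>L i\<close>
  are the first and the last vertex of the witness enumeration of the edge from \<open>v i\<close> to \<open>v (i + 1)\<close>.
\<close>

locale cyclic_obstacle =
  fixes k :: int and v H L :: "int \<Rightarrow> 'a" and E :: "'a \<Rightarrow> 'a \<Rightarrow> bool"
  assumes k: "3 \<le> k"
    and v_eq: "v i = v j \<longleftrightarrow> (\<exists>c. j = i + c * k)"
    and H_per: "H (i + c * k) = H i"
    and L_per: "L (i + c * k) = L i"
    and sym: "E x y \<Longrightarrow> E y x"
    and irrefl: "\<not> E x x"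
    and v_v: "v i \<noteq> v j \<Longrightarrow> E (v i) (v j)"
    and H_v: "E (H i) (v j) \<longleftrightarrow> v j \<noteq> v i \<and> (H i = L i \<longrightarrow> v j \<noteq> v (i + 1))"
    and L_v: "E (L i) (v j) \<longleftrightarrow> v j \<noteq> v (i + 1) \<and> (H i = L i \<longrightarrow> v j \<noteq> v i)"
    and H_L: "H i \<noteq> L i \<Longrightarrow> E (H i) (L i)"
    and H_not_v: "H i \<noteq> v j"
    and L_not_v: "L i \<noteq> v j"
    and essential: "y \<in> range H \<union> range L \<Longrightarrow> z \<in> range H \<union> range L \<Longrightarrow> E y z \<Longrightarrow>
      (\<forall>j. E z (v j) \<longrightarrow> E y (v j)) \<or> (\<forall>j. E y (v j) \<longrightarrow> E z (v j)) \<or> (\<exists>i. {y, z} = {H i, L i})"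
begin

section \<open>Types of witnesses and the edges between them\<close>

definition wit :: "'a set" where "wit = range H \<union> range L"

lemma v_near: "v i = v j \<Longrightarrow> \<bar>i - j\<bar> < k \<Longrightarrow> i = j"
proof -
  assume "v i = v j" "\<bar>i - j\<bar> < k"
  then obtain c where c: "j = i + c * k" using v_eq by blast
  have "c = 0"
  proof (rule ccontr)
    assume "c \<noteq> 0"
    then have "1 * k \<le> \<bar>c\<bar> * k" using k by (intro mult_right_mono) auto
    also have "\<dots> = \<bar>i - j\<bar>" unfolding c using k by (simp add: abs_mult)
    finally show False using \<open>\<bar>i - j\<bar> < k\<close> by simp
  qed
  then show ?thesis using c by simp
qed

lemma v_ne: "v i \<noteq> v (i + 1)" "v (i + 1) \<noteq> v i" "v i \<noteq> v (i + 2)" "v (i + 2) \<noteq> v i"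
  using v_near[of i "i + 1"] v_near[of i "i + 2"] v_near[of "i + 1" i] v_near[of "i + 2" i] k by auto

lemma v_shift: "v (i + d) = v (j + d) \<longleftrightarrow> v i = v j"
  unfolding v_eq by simp

lemma H_cong: "v i = v j \<Longrightarrow> H i = H j" and L_cong: "v i = v j \<Longrightarrow> L i = L j"
  unfolding v_eq using H_per L_per by auto

text \<open>A common first witness of two edges would make each of the two clique vertices the
  successor of the other, which \<open>3 \<le> k\<close> forbids. This contradiction recurs
  below.\<close>

lemma H_eqD:
  assumes "H i = H j" shows "v i = v j"
proof (rule ccontr)
  assume ne: "v i \<noteq> v j"
  have "\<not> E (H j) (v i)" "\<not> E (H i) (v j)" using H_v[of i i] H_v[of j j] assms by auto
  then have "v i = v (j + 1)" "v j = v (i + 1)" using H_v ne by auto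
  then have "v (i + 2) = v i" using v_shift[of j 1 "i + 1"] by (simp add: add.assoc)
  then show False using v_ne by blast
qed

lemma L_eqD:
  assumes "L i = L j" shows "v i = v j"
proof (rule ccontr)
  assume ne: "v i \<noteq> v j"
  then have ne': "v (i + 1) \<noteq> v (j + 1)" unfolding v_shift .
  have "\<not> E (L j) (v (i + 1))" "\<not> E (L i) (v (j + 1))" using L_v[of i "i + 1"] L_v[of j "j + 1"] assms by auto
  then have "v (i + 1) = v j" "v (j + 1) = v i" using L_v ne' by auto
  then have "v (i + 2) = v i" using v_shift[of j 1 "i + 1"] by (simp add: add.assoc)
  then show False using v_ne by blast
qed

text \<open>A vertex can play both roles in two ways: as the single witness of one edge, or as the
  shared witness of two consecutive edges that each have two witnesses.\<close>

lemma H_eq_L: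
  assumes "H i = L j"
  shows "(H i = L i \<and> v i = v j) \<or> (H i \<noteq> L i \<and> H j \<noteq> L j \<and> v i = v (j + 1))"
proof (cases "H i = L i")
  case True
  then show ?thesis using assms L_eqD by metis
next
  case False
  have 1: "H j \<noteq> L j"
  proof
    assume "H j = L j"
    then have "v i = v j" using assms H_eqD by metis
    then have "L i = L j" by (rule L_cong)
    then show False using assms False by simp
  qed
  have "\<not> E (L j) (v i)" using H_v[of i i] assms by simp
  then show ?thesis using L_v 1 False by blast
qed

lemma wit_cases:
  assumes "y \<in> wit"
  obtains (two) i where "y = H i" "y = L i"
  | (one) a where "\<And>j. E y (v j) \<longleftrightarrow> v j \<noteq> v a" "y = H a \<or> y = L (a - 1)"
proof -
  consider i where "y = H i" | i where "y = L i" using assms unfolding wit_def by blast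
  then show ?thesis
  proof cases
    case 1
    then show ?thesis using two[of i] one[of i] H_v[of i] by (cases "H i = L i") auto
  next
    case 2
    then show ?thesis using two[of i] one[of "i + 1"] L_v[of i] by (cases "H i = L i") auto
  qed
qed

lemma two_v: "H i = L i \<Longrightarrow> E (H i) (v j) \<longleftrightarrow> v j \<noteq> v i \<and> v j \<noteq> v (i + 1)"
  using H_v by blast

lemma one_not_two:
  assumes "\<And>j. E y (v j) \<longleftrightarrow> v j \<noteq> v a" shows "\<not> (y = H i \<and> y = L i)"
proof
  assume "y = H i \<and> y = L i"
  then have "\<not> E y (v i)" "\<not> E y (v (i + 1))" using two_v by auto
  then have "v i = v (i + 1)" using assms by metis
  then show False using v_ne by blast
qed

text \<open>If \<open>y\<close> misses two clique vertices, then \<open>z\<close> misses the same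
  two and equals \<open>y\<close>. Hence \<open>y\<close> misses a single \<open>v a\<close>, which
  \<open>z\<close> misses as well, and only \<open>L (a - 1)\<close> and \<open>H a\<close> miss
  \<open>v a\<close>.\<close>

lemma adj_comparable:
  assumes yz: "y \<in> wit" "z \<in> wit" "E y z" and sub: "\<And>j. E z (v j) \<Longrightarrow> E y (v j)"
  shows "(\<exists>i. {y, z} = {L (i - 1), H i}) \<and> \<not> (\<exists>i. y = H i \<and> y = L i)"
proof -
  have ne: "y \<noteq> z" using yz(3) irrefl by metis
  show ?thesis
    using yz(1)
  proof (cases rule: wit_cases)
    case (two i)
    have no: "\<not> E z (v i)" "\<not> E z (v (i + 1))" using sub two two_v by (metis v_ne)+
    show ?thesis
      using yz(2)
    proof (cases rule: wit_cases)
      case (one b)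
      then have "v i = v (i + 1)" using no by metis
      then show ?thesis using v_ne by blast
    next
      case z: (two j)
      then have "v i = v j \<or> v i = v (j + 1)" "v (i + 1) = v j \<or> v (i + 1) = v (j + 1)" using no two_v by auto
      then consider "v i = v j" | "v i = v (j + 1)" "v (i + 1) = v j" using v_shift v_ne(1) by metis
      then show ?thesis
      proof cases
        case 1
        then show ?thesis using H_cong two z ne by metis
      next
        case 2
        then have "v (j + 2) = v j" using v_shift[of i 1 "j + 1"] by (simp add: add.assoc)
        then show ?thesis using v_ne by blast
      qed
    qed
  next
    case (one a)
    have no: "\<not> E z (v a)" using sub one(1) by metis
    have eq: "H a = H b" "L (a - 1) = L (b - 1)" if "v a = v b" for b
      using that H_cong[of a b] L_cong[of "a - 1" "b - 1"] v_shift[of a "- 1" b] by auto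
    have "\<exists>i. {y, z} = {L (i - 1), H i}"
      using yz(2)
    proof (cases rule: wit_cases)
      case z: (one b)
      then have "v a = v b" using no by blast
      then have "{y, z} = {L (b - 1), H b}" using eq one(2) z(2) ne by auto
      then show ?thesis ..
    next
      case z: (two j)
      then consider "v a = v j" | "v a = v (j + 1)" using no two_v by blast
      then show ?thesis
      proof cases
        case 1
        then have "{y, z} = {L (j - 1), H j}" using eq[OF 1] one(2) z ne by auto
        then show ?thesis ..
      next
        case 2
        then have "{y, z} = {L (j + 1 - 1), H (j + 1)}" using eq[OF 2] one(2) z ne by auto
        then show ?thesis ..
      qed
    qed
    then show ?thesis using one_not_two[OF one(1)] by blast
  qed
qed

text \<open>In the cyclic sequence \<open>L (i - 1)\<close>, \<open>H i\<close>, \<open>L i\<close>,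
  \<open>H (i + 1)\<close>, edges thus join consecutive terms only; this is what allows witnesses to
  be represented by short arcs.\<close>

lemma adj_cases:
  assumes "y \<in> wit" "z \<in> wit" "E y z"
  shows "(\<exists>i. {y, z} = {L (i - 1), H i}) \<or> (\<exists>i. {y, z} = {H i, L i})"
proof -
  consider "\<forall>j. E z (v j) \<longrightarrow> E y (v j)" | "\<forall>j. E y (v j) \<longrightarrow> E z (v j)" | "\<exists>i. {y, z} = {H i, L i}"
    using essential[of y z] assms unfolding wit_def by blast
  then show ?thesis
  proof cases
    case 1
    then show ?thesis using adj_comparable[OF assms] by blast
  next
    case 2
    then show ?thesis using adj_comparable[OF assms(2,1) sym[OF assms(3)]] by (metis insert_commute)
  next
    case 3
    then show ?thesis ..
  qed
qed

text \<open>Comparable neighbours cannot miss two clique vertices, and a single witness shares its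
  enumeration with no other vertex. This later keeps \<open>4 * l + 1\<close> free of witnesses when
  both edges at \<open>v l\<close> have a single witness.\<close>

lemma two_not_adj:
  assumes i: "H i = L i" and j: "H j = L j"
  shows "\<not> E (H i) (H j)"
proof
  assume E: "E (H i) (H j)"
  have wit: "H i \<in> wit" "H j \<in> wit" unfolding wit_def by auto
  have "\<exists>l. {H i, H j} = {H l, L l}"
    using essential[of "H i" "H j"] wit[unfolded wit_def] E adj_comparable[OF wit E] adj_comparable[OF wit(2,1) sym[OF E]] i j
    by blast
  then obtain l where l: "{H i, H j} = {H l, L l}" by blast
  have ne: "H i \<noteq> H j" using E irrefl by metis
  have "H l \<in> {H i, H j}" using l by blast
  then have "H l = L l" using H_eqD L_cong i j by (metis insertE singletonD)
  then show False using l ne by (metis doubleton_eq_iff)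
qed

lemma no_adj_to_two:
  assumes "E (H i) z" "H i = L i" "z \<in> wit" shows "z = L (i - 1) \<or> z = H (i + 1)"
proof -
  have w: "H i \<in> wit" unfolding wit_def by blast
  have ne: "H i \<noteq> z" using assms(1) irrefl by metis
  show ?thesis
    using adj_cases[OF w assms(3,1)]
  proof (elim disjE exE)
    fix l assume l: "{H i, z} = {L (l - 1), H l}"
    then consider "H i = L (l - 1)" "z = H l" | "H i = H l" "z = L (l - 1)" by (metis doubleton_eq_iff)
    then show ?thesis
    proof cases
      case 1
      then have "v i = v (l - 1)" using assms(2) L_eqD by metis
      then have "v (i + 1) = v l" using v_shift[of i 1 "l - 1"] by simp
      then show ?thesis using 1 H_cong by metis
    next
      case 2
      then have "v (i + - 1) = v (l + - 1)" unfolding v_shift using H_eqD by blast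
      then have "L (i + - 1) = L (l + - 1)" by (rule L_cong)
      then show ?thesis using 2 by simp
    qed
  next
    fix l assume l: "{H i, z} = {H l, L l}"
    then have "H i = H l \<or> H i = L l" by (metis doubleton_eq_iff)
    then have "v i = v l" using H_eqD L_eqD assms(2) by metis
    then have "H l = L l" using H_cong L_cong assms(2) by metis
    then show ?thesis using l ne by (metis doubleton_eq_iff)
  qed
qed

text \<open>
  The circle has \<open>4 * k\<close> points. In cyclic order, \<open>L (i - 1)\<close> owns the point \<open>4 * i\<close> and \<open>H i\<close> owns
  \<open>4 * i + 2\<close>; the point between them is shared if they are equal or adjacent, and \<open>H i\<close>, \<open>L i\<close>
  always share \<open>4 * i + 3\<close>. A vertex of the clique receives the complement of what its
  non-neighbours own, except that it never contains the point \<open>4 * i + 1\<close> if it is \<open>v i\<close>.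
  Witnesses in \<open>X\<close> are disregarded.
\<close>

definition link :: "int \<Rightarrow> bool" where
  "link i \<longleftrightarrow> L (i - 1) = H i \<or> E (L (i - 1)) (H i)"

text \<open>The left end \<open>4 * i - 1\<close> is the point \<open>4 * (i - 1) + 3\<close> shared
  with \<open>H (i - 1)\<close>.\<close>

definition block_L :: "int \<Rightarrow> int set" where
  "block_L i = cyc_interval (4 * k) (4 * i - 1) (if link i then 4 * i + 1 else 4 * i)"

definition block_H :: "int \<Rightarrow> int set" where
  "block_H i = cyc_interval (4 * k) (if link i then 4 * i + 1 else 4 * i + 2) (4 * i + 3)"

text \<open>The unions are over all roles of \<open>y\<close>, since one vertex may be both
  \<open>H i\<close> and \<open>L i\<close>, or both \<open>L (i - 1)\<close> and
  \<open>H i\<close>; that the blocks join up to one arc has to be proved.\<close>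

definition wit_arc :: "'a \<Rightarrow> int set" where
  "wit_arc y = (\<Union>i\<in>{i. L (i - 1) = y}. block_L i) \<union> (\<Union>i\<in>{i. H i = y}. block_H i)"

definition clique_gap :: "'a set \<Rightarrow> 'a \<Rightarrow> int set" where
  "clique_gap X u = {n. \<exists>i. n = 4 * i + 1 \<and> v i = u} \<union> (\<Union>y\<in>{y \<in> wit. y \<notin> X \<and> \<not> E y u}. wit_arc y)"

definition obstacle_arc :: "'a set \<Rightarrow> 'a \<Rightarrow> int set" where
  "obstacle_arc X u = (if u \<in> range v then - clique_gap X u else wit_arc u)"

lemma L_shift: "L (i + c * k - 1) = L (i - 1)"
proof -
  have "i + c * k - 1 = (i - 1) + c * k" by simp
  then show ?thesis using L_per by metis
qed

lemma link_per: "link (i + c * k) = link i"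
  unfolding link_def L_shift H_per ..

lemma block_cong:
  assumes "v i = v j" shows "block_L i = block_L j" "block_H i = block_H j"
proof -
  obtain c where c: "j = i + c * k" using assms v_eq by blast
  have *: "cyc_interval (4 * k) (a + 4 * (c * k)) (b + 4 * (c * k)) = cyc_interval (4 * k) a b" for a b
    using cyc_interval_translate[of "4 * k" a c b] by (simp add: algebra_simps)
  show "block_L i = block_L j" "block_H i = block_H j"
    unfolding block_L_def block_H_def c link_per
    using *[of "4 * i - 1" "4 * i + 1"] *[of "4 * i - 1" "4 * i"] *[of "4 * i + 1" "4 * i + 3"] *[of "4 * i + 2" "4 * i + 3"]
    by (simp_all add: algebra_simps)
qed

lemma block_conv: "cyc_convex (4 * k) (block_L i)" "cyc_convex (4 * k) (block_H i)"
  unfolding block_L_def block_H_def using k by (auto intro!: cyc_convex_cyc_interval)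

lemma cyc_interval_mem: "a \<le> n \<Longrightarrow> n \<le> b \<Longrightarrow> n \<in> cyc_interval m a b" for m :: int
  by (rule cyc_intervalI[of _ _ 0]) auto

lemma block_mem:
  "4 * i - 1 \<in> block_L i" "4 * i \<in> block_L i" "link i \<Longrightarrow> 4 * i + 1 \<in> block_L i"
  "4 * i + 2 \<in> block_H i" "4 * i + 3 \<in> block_H i" "link i \<Longrightarrow> 4 * i + 1 \<in> block_H i"
  unfolding block_L_def block_H_def by (auto intro!: cyc_interval_mem)

lemma wit_arc_iff:
  "n \<in> wit_arc y \<longleftrightarrow>
    (\<exists>i. L (i - 1) = y \<and> (n = 4 * i - 1 \<or> n = 4 * i \<or> link i \<and> n = 4 * i + 1)) \<or>
    (\<exists>i. H i = y \<and> (n = 4 * i + 2 \<or> n = 4 * i + 3 \<or> link i \<and> n = 4 * i + 1))"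
  (is "_ \<longleftrightarrow> ?R")
proof
  assume "n \<in> wit_arc y"
  then consider i where "L (i - 1) = y" "n \<in> block_L i" | i where "H i = y" "n \<in> block_H i"
    unfolding wit_arc_def by blast
  then show ?R
  proof cases
    case 1
    obtain c :: int where c: "4 * i - 1 \<le> n + of_int c * (4 * k)" "n + of_int c * (4 * k) \<le> (if link i then 4 * i + 1 else 4 * i)"
      using 1(2) unfolding block_L_def by (rule cyc_intervalE)
    define j where "j = i + (- c) * k"
    have "L (j - 1) = y" "link j = link i" unfolding j_def L_shift link_per using 1(1) by auto
    moreover have "n = 4 * j - 1 \<or> n = 4 * j \<or> link i \<and> n = 4 * j + 1"
      using c unfolding j_def by (auto simp: algebra_simps split: if_splits)
    ultimately show ?thesis by blast
  next
    case 2
    obtain c :: int where c: "(if link i then 4 * i + 1 else 4 * i + 2) \<le> n + of_int c * (4 * k)" "n + of_int c * (4 * k) \<le> 4 * i + 3"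
      using 2(2) unfolding block_H_def by (rule cyc_intervalE)
    define j where "j = i + (- c) * k"
    have "H j = y" "link j = link i" unfolding j_def H_per link_per using 2(1) by auto
    moreover have "n = 4 * j + 2 \<or> n = 4 * j + 3 \<or> link i \<and> n = 4 * j + 1"
      using c unfolding j_def by (auto simp: algebra_simps split: if_splits)
    ultimately show ?thesis by blast
  qed
next
  assume ?R
  moreover have "n \<in> block_L i" if "n = 4 * i - 1 \<or> n = 4 * i \<or> link i \<and> n = 4 * i + 1" for i
    using that block_mem[of i] by auto
  moreover have "n \<in> block_H i" if "n = 4 * i + 2 \<or> n = 4 * i + 3 \<or> link i \<and> n = 4 * i + 1" for i
    using that block_mem[of i] by auto
  ultimately show "n \<in> wit_arc y" unfolding wit_arc_def by blast
qed

lemma wit_arc_residues: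
  "4 * i \<in> wit_arc y \<longleftrightarrow> L (i - 1) = y"
  "4 * i + 1 \<in> wit_arc y \<longleftrightarrow> link i \<and> (L (i - 1) = y \<or> H i = y)"
  "4 * i + 2 \<in> wit_arc y \<longleftrightarrow> H i = y"
  "4 * i + 3 \<in> wit_arc y \<longleftrightarrow> H i = y \<or> L i = y"
proof -
  have 0: "4 * i = 4 * j - 1 \<longleftrightarrow> False" "4 * i = 4 * j \<longleftrightarrow> i = j" "4 * i = 4 * j + 1 \<longleftrightarrow> False"
    "4 * i = 4 * j + 2 \<longleftrightarrow> False" "4 * i = 4 * j + 3 \<longleftrightarrow> False" for j by presburger+
  have 1: "4 * i + 1 = 4 * j - 1 \<longleftrightarrow> False" "4 * i + 1 = 4 * j \<longleftrightarrow> False" "4 * i + 1 = 4 * j + 1 \<longleftrightarrow> i = j"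
    "4 * i + 1 = 4 * j + 2 \<longleftrightarrow> False" "4 * i + 1 = 4 * j + 3 \<longleftrightarrow> False" for j by presburger+
  have 2: "4 * i + 2 = 4 * j - 1 \<longleftrightarrow> False" "4 * i + 2 = 4 * j \<longleftrightarrow> False" "4 * i + 2 = 4 * j + 1 \<longleftrightarrow> False"
    "4 * i + 2 = 4 * j + 2 \<longleftrightarrow> i = j" "4 * i + 2 = 4 * j + 3 \<longleftrightarrow> False" for j by presburger+
  have 3: "4 * i + 3 = 4 * j - 1 \<longleftrightarrow> j = i + 1" "4 * i + 3 = 4 * j \<longleftrightarrow> False" "4 * i + 3 = 4 * j + 1 \<longleftrightarrow> False"
    "4 * i + 3 = 4 * j + 2 \<longleftrightarrow> False" "4 * i + 3 = 4 * j + 3 \<longleftrightarrow> i = j" for j by presburger+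
  show "4 * i \<in> wit_arc y \<longleftrightarrow> L (i - 1) = y" unfolding wit_arc_iff 0 by blast
  show "4 * i + 1 \<in> wit_arc y \<longleftrightarrow> link i \<and> (L (i - 1) = y \<or> H i = y)" unfolding wit_arc_iff 1 by blast
  show "4 * i + 2 \<in> wit_arc y \<longleftrightarrow> H i = y" unfolding wit_arc_iff 2 by blast
  show "4 * i + 3 \<in> wit_arc y \<longleftrightarrow> H i = y \<or> L i = y" unfolding wit_arc_iff 3 by auto
qed

lemma residue_cases:
  fixes n :: int
  obtains i where "n = 4 * i" | i where "n = 4 * i + 1" | i where "n = 4 * i + 2" | i where "n = 4 * i + 3"
proof -
  have "n = 4 * (n div 4) + n mod 4" "n mod 4 = 0 \<or> n mod 4 = 1 \<or> n mod 4 = 2 \<or> n mod 4 = 3" by presburger+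
  then show ?thesis using that by (metis add.right_neutral)
qed

text \<open>A single witness of an edge owns \<open>block_H i\<close> and
  \<open>block_L (i + 1)\<close>, which overlap in \<open>4 * i + 3\<close>. A witness missing only
  \<open>v a\<close> owns one or both blocks at \<open>a\<close>; if both, then
  \<open>link a\<close> holds and they share \<open>4 * a + 1\<close>.\<close>

lemma wit_arc_conv:
  assumes "y \<in> wit" shows "cyc_convex (4 * k) (wit_arc y)"
  using assms
proof (cases rule: wit_cases)
  case (two i)
  have "block_L j = block_L (i + 1)" if "L (j - 1) = y" for j
  proof (rule block_cong)
    have "v (j - 1) = v i" using that two L_eqD by metis
    then show "v j = v (i + 1)" using v_shift[of "j - 1" 1 i] by simp
  qed
  then have 1: "(\<Union>j\<in>{j. L (j - 1) = y}. block_L j) = block_L (i + 1)"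
  proof (rule SUP_eq_const[rotated])
    have "i + 1 \<in> {j. L (j - 1) = y}" using two by simp
    then show "{j. L (j - 1) = y} \<noteq> {}" by (metis empty_iff)
  qed blast
  have "block_H j = block_H i" if "H j = y" for j
    using that two H_eqD block_cong by metis
  then have 2: "(\<Union>j\<in>{j. H j = y}. block_H j) = block_H i"
  proof (intro SUP_eq_const[rotated])
    have "i \<in> {j. H j = y}" using two by simp
    then show "{j. H j = y} \<noteq> {}" by (metis empty_iff)
  qed blast
  show ?thesis unfolding wit_arc_def 1 2
    by (rule cyc_convex_Un[OF block_conv _ block_mem(2,5)]) (use k in auto)
next
  case (one a)
  have L: "v j = v a" if "L (j - 1) = y" for j using that L_v[of "j - 1" j] one(1)[of j] by simp
  have H: "v j = v a" if "H j = y" for j using that H_v[of j j] one(1)[of j] by simp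
  have const: "(\<Union>j\<in>{j. Q j}. B j) = (if Q a then B a else {})"
    if "\<And>j. Q j \<Longrightarrow> Q a \<and> B j = B a" for Q and B :: "int \<Rightarrow> int set"
  proof (cases "Q a")
    case True
    then have "{j. Q j} \<noteq> {}" by (metis empty_Collect_eq)
    then have "(\<Union>j\<in>{j. Q j}. B j) = B a" by (rule SUP_eq_const) (use that in blast)
    then show ?thesis using True by simp
  next
    case False
    then show ?thesis using that by auto
  qed
  have L_blocks: "(\<Union>j\<in>{j. L (j - 1) = y}. block_L j) = (if L (a - 1) = y then block_L a else {})"
  proof (rule const)
    fix j assume j: "L (j - 1) = y"
    have "v (j + - 1) = v (a + - 1)" using L[OF j] unfolding v_shift .
    then have "L (j + - 1) = L (a + - 1)" by (rule L_cong)
    then show "L (a - 1) = y \<and> block_L j = block_L a" using j block_cong(1)[OF L[OF j]] by simp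
  qed
  have H_blocks: "(\<Union>j\<in>{j. H j = y}. block_H j) = (if H a = y then block_H a else {})"
  proof (rule const)
    fix j assume j: "H j = y"
    then show "H a = y \<and> block_H j = block_H a" using block_cong(2)[OF H[OF j]] H_cong[OF H[OF j]] by simp
  qed
  consider "L (a - 1) = y" "H a = y" | "L (a - 1) = y" "H a \<noteq> y" | "L (a - 1) \<noteq> y" "H a = y" using one(2) by blast
  then show ?thesis
  proof cases
    case c: 1
    then have "link a" unfolding link_def by simp
    then have "cyc_convex (4 * k) (block_L a \<union> block_H a)"
      by (intro cyc_convex_Un[OF block_conv, of "4 * a + 1" _ "4 * a + 1"]) (use block_mem k in auto)
    then show ?thesis unfolding wit_arc_def L_blocks H_blocks using c by simp
  next
    case 2
    then show ?thesis unfolding wit_arc_def L_blocks H_blocks using block_conv by simp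
  next
    case 3
    then show ?thesis unfolding wit_arc_def L_blocks H_blocks using block_conv by simp
  qed
qed

lemma not_adj_v:
  assumes "y \<in> wit" shows "\<not> E y (v i) \<longleftrightarrow> y = L (i - 1) \<or> y = H i"
proof
  assume no: "\<not> E y (v i)"
  have L: "L (j - 1) = L (i - 1)" if "v i = v j" for j
    using L_cong[of "j + - 1" "i + - 1"] that unfolding v_shift by simp
  show "y = L (i - 1) \<or> y = H i"
    using assms
  proof (cases rule: wit_cases)
    case (two j)
    then consider "v i = v j" | "v i = v (j + 1)" using no two_v by blast
    then show ?thesis
    proof cases
      case 1
      then show ?thesis using two H_cong by metis
    next
      case 2
      then show ?thesis using two L[of "j + 1"] by simp
    qed
  next
    case (one a)
    then have "v i = v a" using no by blast
    then show ?thesis using one(2) L[of a] H_cong[of i a] by auto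
  qed
next
  assume "y = L (i - 1) \<or> y = H i"
  then show "\<not> E y (v i)" using H_v[of i i] L_v[of "i - 1" i] by auto
qed

text \<open>The only witnesses contributing to the gap are \<open>L (i - 1)\<close> and
  \<open>H i\<close>. Their arcs contain \<open>4 * i\<close> and \<open>4 * i + 2\<close>, so the
  extra point \<open>4 * i + 1\<close> glues together whatever is left of them after
  \<open>X\<close> is disregarded.\<close>

lemma clique_gap_conv: "cyc_convex (4 * k) (clique_gap X (v i))"
proof -
  define J where "J = cyc_interval (4 * k) (4 * i + 1) (4 * i + 1)"
  define SL where "SL = (if L (i - 1) \<in> X then {} else wit_arc (L (i - 1)))"
  define SH where "SH = (if H i \<in> X then {} else wit_arc (H i))"
  have J: "{n. \<exists>j. n = 4 * j + 1 \<and> v j = v i} = J"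
  proof (intro set_eqI iffI)
    fix n assume "n \<in> {n. \<exists>j. n = 4 * j + 1 \<and> v j = v i}"
    then obtain j c where j: "n = 4 * j + 1" "i = j + c * k" unfolding v_eq by blast
    show "n \<in> J" unfolding J_def by (rule cyc_intervalI[of _ _ c]) (simp_all add: j algebra_simps)
  next
    fix n assume "n \<in> J"
    then obtain c :: int where "4 * i + 1 \<le> n + of_int c * (4 * k)" "n + of_int c * (4 * k) \<le> 4 * i + 1"
      unfolding J_def by (rule cyc_intervalE)
    then have "n = 4 * (i - c * k) + 1" "i = (i - c * k) + c * k" by (simp_all add: algebra_simps)
    then show "n \<in> {n. \<exists>j. n = 4 * j + 1 \<and> v j = v i}" using v_eq by blast
  qed
  have wits: "L (i - 1) \<in> wit" "H i \<in> wit" unfolding wit_def by auto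
  have eq: "clique_gap X (v i) = (J \<union> SL) \<union> SH"
  proof -
    have "{y \<in> wit. y \<notin> X \<and> \<not> E y (v i)} = {L (i - 1), H i} - X"
      using not_adj_v wits by blast
    then show ?thesis unfolding clique_gap_def J SL_def SH_def by auto
  qed
  have Jc: "cyc_convex (4 * k) J" unfolding J_def using k by (intro cyc_convex_cyc_interval) simp
  have k4: "0 < 4 * k" using k by simp
  have mem: "4 * i + 1 \<in> J" unfolding J_def by (rule cyc_interval_mem) auto
  have "cyc_convex (4 * k) (J \<union> SL)"
  proof (cases "L (i - 1) \<in> X")
    case False
    have "4 * i \<in> wit_arc (L (i - 1))" unfolding wit_arc_residues ..
    then have "cyc_convex (4 * k) (J \<union> wit_arc (L (i - 1)))"
      by (intro cyc_convex_Un[OF Jc wit_arc_conv[OF wits(1)] k4 mem]) auto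
    then show ?thesis using False unfolding SL_def by simp
  qed (simp add: SL_def Jc)
  moreover have "cyc_convex (4 * k) ((J \<union> SL) \<union> wit_arc (H i))" if "cyc_convex (4 * k) (J \<union> SL)"
  proof -
    have "4 * i + 2 \<in> wit_arc (H i)" unfolding wit_arc_residues ..
    then show ?thesis using mem by (intro cyc_convex_Un[OF that wit_arc_conv[OF wits(2)] k4, of "4 * i + 1"]) auto
  qed
  ultimately show ?thesis unfolding eq SH_def by simp
qed

lemma wit_not_v: "y \<in> wit \<Longrightarrow> y \<notin> range v"
  using H_not_v L_not_v unfolding wit_def by (metis UnE imageE)

lemma adjacent_or_equal_linked:
  assumes "y \<in> wit" "z \<in> wit" "n \<in> wit_arc y" "n \<in> wit_arc z" "y \<noteq> z" shows "E y z"
proof (cases n rule: residue_cases)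
  case (1 i)
  then show ?thesis using assms wit_arc_residues(1) by metis
next
  case (2 i)
  then have "link i" "{y, z} = {L (i - 1), H i}" using assms wit_arc_residues(2)[of i] by auto
  then show ?thesis using assms(5) sym unfolding link_def by (metis doubleton_eq_iff)
next
  case (3 i)
  then show ?thesis using assms wit_arc_residues(3) by metis
next
  case (4 i)
  then have "{y, z} = {H i, L i}" using assms wit_arc_residues(4)[of i] by auto
  then show ?thesis using assms(5) sym H_L by (metis doubleton_eq_iff)
qed

text \<open>The point is chosen by the witnesses in \<open>K\<close>: for two, the point that they
  share as consecutive terms; for one, a point owned by it alone, which its clique neighbours
  contain; for none, the point of a disregarded witness, or a point near some \<open>v l\<close>
  outside \<open>K\<close>.\<close>

lemma clique_common_point:
  assumes X: "X \<subseteq> wit" and K: "K \<subseteq> (range v \<union> wit) - X" and cl: "\<And>a b. a \<in> K \<Longrightarrow> b \<in> K \<Longrightarrow> a \<noteq> b \<Longrightarrow> E a b"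
    and tri: "\<not> (\<exists>a b c. {a, b, c} \<subseteq> K \<inter> wit \<and> a \<noteq> b \<and> a \<noteq> c \<and> b \<noteq> c)"
    and proper: "\<not> range v \<subseteq> K \<or> X \<noteq> {}"
  shows "\<exists>n. \<forall>a\<in>K. n \<in> obstacle_arc X a"
proof -
  have v_mem: "n \<in> obstacle_arc X u"
    if u: "u \<in> range v" and 1: "\<And>i. n = 4 * i + 1 \<Longrightarrow> v i \<noteq> u"
      and 2: "\<And>y. y \<in> wit \<Longrightarrow> y \<notin> X \<Longrightarrow> n \<in> wit_arc y \<Longrightarrow> E y u" for n u
    using that unfolding obstacle_arc_def clique_gap_def by auto
  have w_mem: "n \<in> obstacle_arc X y \<longleftrightarrow> n \<in> wit_arc y" if "y \<in> wit" for n y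
    using wit_not_v[OF that] unfolding obstacle_arc_def by simp
  have kind: "a \<in> range v \<or> a \<in> wit" if "a \<in> K" for a using that K by blast
  have r: "4 * i \<noteq> 4 * j + 1" "4 * i + 2 \<noteq> 4 * j + 1" "4 * i + 3 \<noteq> 4 * j + 1" "4 * i + 1 = 4 * j + 1 \<longleftrightarrow> i = j"
    for i j :: int by presburger+
  consider (none) "K \<inter> wit = {}" | (one) y where "K \<inter> wit = {y}" | (pair) y z where "K \<inter> wit = {y, z}" "y \<noteq> z"
  proof (cases "K \<inter> wit = {}")
    case False
    then obtain y where y: "y \<in> K \<inter> wit" by blast
    show ?thesis
    proof (cases "K \<inter> wit = {y}")
      case False
      then obtain z where z: "z \<in> K \<inter> wit" "y \<noteq> z" using y by blast
      have "a = y \<or> a = z" if "a \<in> K \<inter> wit" for a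
        using tri y z that by (metis empty_subsetI insert_subset)
      then have "K \<inter> wit = {y, z}" using y z by blast
      then show ?thesis using pair z(2) by blast
    qed (rule one)
  qed (rule none)
  then show ?thesis
  proof cases
    case none
    then have Kv: "K \<subseteq> range v" using K by blast
    show ?thesis
    proof (cases "X = {}")
      case False
      \<comment> \<open>The private point of a disregarded witness is owned by no remaining witness,
        so every clique vertex contains it.\<close>
      then obtain x where x: "x \<in> X" "x \<in> wit" using X by blast
      then consider i where "x = H i" | i where "x = L i" unfolding wit_def by blast
      then show ?thesis
      proof cases
        case 1
        have "4 * i + 2 \<in> obstacle_arc X u" if "u \<in> K" for u
          using that Kv x 1 r wit_arc_residues(3)[of i] by (intro v_mem) auto
        then show ?thesis by blast
      next
        case 2
        have "4 * (i + 1) \<in> obstacle_arc X u" if "u \<in> K" for u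
        proof (rule v_mem)
          show "u \<in> range v" using that Kv by blast
          show "v j \<noteq> u" if "4 * (i + 1) = 4 * j + 1" for j using r(1) that by blast
          show "E y u" if "y \<in> wit" "y \<notin> X" "4 * (i + 1) \<in> wit_arc y" for y
            using that x 2 unfolding wit_arc_residues by simp
        qed
        then show ?thesis by blast
      qed
    next
      case True
      \<comment> \<open>Sought is a point that no clique vertex except possibly \<open>v l\<close>
        misses. If an edge at \<open>v l\<close> has two witnesses, the one next to
        \<open>v l\<close> misses only \<open>v l\<close> and its private point will do.\<close>
      then obtain l where l: "v l \<notin> K" using proper by blast
      have ne: "v l \<noteq> u" if "u \<in> K" for u using that l by blast
      show ?thesis
      proof (cases "H (l - 1) = L (l - 1)")
        case False
        have "4 * l \<in> obstacle_arc X u" if u: "u \<in> K" for u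
        proof (rule v_mem)
          show "u \<in> range v" using u Kv by blast
          then obtain j where "u = v j" by blast
          then show "E y u" if "4 * l \<in> wit_arc y" for y
            using that False L_v[of "l - 1" j] ne[OF u] unfolding wit_arc_residues by auto
        qed (use r in auto)
        then show ?thesis by blast
      next
        case sl: True
        show ?thesis
        proof (cases "H l = L l")
          case False
          have "4 * l + 2 \<in> obstacle_arc X u" if u: "u \<in> K" for u
          proof (rule v_mem)
            show "u \<in> range v" using u Kv by blast
            then obtain j where "u = v j" by blast
            then show "E y u" if "4 * l + 2 \<in> wit_arc y" for y
              using that False H_v[of l j] ne[OF u] unfolding wit_arc_residues by auto
          qed (use r in auto)
          then show ?thesis by blast
        next
          case True
          \<comment> \<open>Both edges at \<open>v l\<close> have a single witness. These are
            different and not adjacent, so no witness owns \<open>4 * l + 1\<close>, and among the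
            clique vertices only \<open>v l\<close> misses it.\<close>
          have "H (l - 1) \<noteq> H l" using H_eqD[of "l - 1" l] v_ne(1)[of "l - 1"] by auto
          then have "\<not> link l" unfolding link_def using two_not_adj[OF sl True] sl by simp
          then have "4 * l + 1 \<in> obstacle_arc X u" if u: "u \<in> K" for u
            using u Kv ne[OF u] r wit_arc_residues(2)[of l] by (intro v_mem) auto
          then show ?thesis by blast
        qed
      qed
    qed
  next
    case (one y)
    then have y: "y \<in> wit" "y \<in> K" by auto
    have Kvy: "a \<in> range v" if "a \<in> K" "a \<noteq> y" for a using that one kind by blast
    consider i where "y = H i" | i where "y = L (i - 1)" 
    proof -
      have "y = L j \<Longrightarrow> y = L (j + 1 - 1)" for j by simp
      then show ?thesis using y(1) that unfolding wit_def by blast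
    qed
    then show ?thesis
    proof cases
      case 1
      have "4 * i + 2 \<in> obstacle_arc X a" if a: "a \<in> K" for a
      proof (cases "a = y")
        case True
        then show ?thesis using w_mem[OF y(1)] 1 wit_arc_residues(3) by simp
      next
        case False
        then show ?thesis using Kvy[OF a False] r cl[OF y(2) a] wit_arc_residues(3)[of i] 1 by (intro v_mem) auto
      qed
      then show ?thesis by blast
    next
      case 2
      have "4 * i \<in> obstacle_arc X a" if a: "a \<in> K" for a
      proof (cases "a = y")
        case True
        then show ?thesis using w_mem[OF y(1)] 2 wit_arc_residues(1) by simp
      next
        case False
        then show ?thesis using Kvy[OF a False] r cl[OF y(2) a] wit_arc_residues(1)[of i] 2 by (intro v_mem) auto
      qed
      then show ?thesis by blast
    qed
  next
    case (pair y z)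
    then have yz: "y \<in> wit" "y \<in> K" "z \<in> wit" "z \<in> K" by auto
    have Kv: "a \<in> range v" if "a \<in> K" "a \<noteq> y" "a \<noteq> z" for a using that pair(1) kind by blast
    have E: "E y z" using cl[OF yz(2,4) pair(2)] .
    from adj_cases[OF yz(1,3) E] show ?thesis
    proof (elim disjE exE)
      fix i assume i: "{y, z} = {L (i - 1), H i}"
      then have li: "link i" using E sym unfolding link_def by (metis doubleton_eq_iff)
      have "4 * i + 1 \<in> obstacle_arc X a" if a: "a \<in> K" for a
      proof (cases "a = y \<or> a = z")
        case True
        then have "a \<in> wit" "a \<in> {L (i - 1), H i}" using yz i by auto
        then show ?thesis using w_mem wit_arc_residues(2) li by auto
      next
        case False
        then have Ea: "E w a" if "w \<in> {L (i - 1), H i}" for w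
          using that cl[OF yz(2) a] cl[OF yz(4) a] unfolding i[symmetric] by auto
        show ?thesis
        proof (rule v_mem)
          show "a \<in> range v" using Kv a False by blast
          show "v j \<noteq> a" if "4 * i + 1 = 4 * j + 1" for j
            using that Ea[of "H i"] H_v[of i i] by auto
          show "E w a" if "4 * i + 1 \<in> wit_arc w" for w
            using that Ea unfolding wit_arc_residues by blast
        qed
      qed
      then show ?thesis by blast
    next
      fix i assume i: "{y, z} = {H i, L i}"
      have "4 * i + 3 \<in> obstacle_arc X a" if a: "a \<in> K" for a
      proof (cases "a = y \<or> a = z")
        case True
        then have "a \<in> wit" "a \<in> {H i, L i}" using yz i by auto
        then show ?thesis using w_mem wit_arc_residues(4) by auto
      next
        case False
        then have Ea: "E w a" if "w \<in> {H i, L i}" for w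
          using that cl[OF yz(2) a] cl[OF yz(4) a] unfolding i[symmetric] by auto
        show ?thesis
        proof (rule v_mem)
          show "a \<in> range v" using Kv a False by blast
          show "v j \<noteq> a" if "4 * i + 3 = 4 * j + 1" for j using that r(3) by blast
          show "E w a" if "4 * i + 3 \<in> wit_arc w" for w
            using that Ea unfolding wit_arc_residues by blast
        qed
      qed
      then show ?thesis by blast
    qed
  qed
qed

text \<open>Nonemptiness and one direction of adjacency are instances of the common point lemma: a
  set of at most two vertices neither contains three witnesses nor exhausts the clique.\<close>

lemma obstacle_arc_rep:
  assumes X: "X \<subseteq> wit"
  shows "arc_rep ((range v \<union> wit) - X) E (4 * k) (obstacle_arc X)"
proof -
  let ?V = "(range v \<union> wit) - X"
  have common: "\<exists>n. n \<in> obstacle_arc X a \<and> n \<in> obstacle_arc X b"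
    if ab: "a \<in> ?V" "b \<in> ?V" "a \<noteq> b \<Longrightarrow> E a b" for a b
  proof -
    have "v 0 \<noteq> v 1" "v 1 \<noteq> v 2" "v 0 \<noteq> v 2" using v_ne[of 0] v_ne[of 1] by auto
    then have "\<not> range v \<subseteq> {a, b}" by (metis insertE rangeI singletonD subsetD)
    then have "\<exists>n. \<forall>c\<in>{a, b}. n \<in> obstacle_arc X c"
      using ab sym by (intro clique_common_point[OF X]) auto
    then show ?thesis by blast
  qed
  show ?thesis
    unfolding arc_rep_def
  proof (intro conjI ballI impI)
    show "0 < 4 * k" using k by simp
    fix a assume a: "a \<in> ?V"
    show "cyc_convex (4 * k) (obstacle_arc X a)"
    proof (cases "a \<in> range v")
      case True
      then show ?thesis unfolding obstacle_arc_def using cyc_convex_Compl[OF clique_gap_conv] by auto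
    next
      case False
      then show ?thesis unfolding obstacle_arc_def using wit_arc_conv a by auto
    qed
    show "obstacle_arc X a \<noteq> {}" using common[OF a a] by auto
    fix b assume b: "b \<in> ?V" "a \<noteq> b"
    show "E a b \<longleftrightarrow> obstacle_arc X a \<inter> obstacle_arc X b \<noteq> {}"
    proof
      assume "E a b"
      then show "obstacle_arc X a \<inter> obstacle_arc X b \<noteq> {}" using common[OF a b(1)] by blast
    next
      assume "obstacle_arc X a \<inter> obstacle_arc X b \<noteq> {}"
      then obtain n where n: "n \<in> obstacle_arc X a" "n \<in> obstacle_arc X b" by blast
      have mixed: "E y u" if "y \<in> wit" "y \<notin> X" "u \<in> range v" "n \<in> obstacle_arc X y" "n \<in> obstacle_arc X u" for y u
        using that wit_not_v[OF that(1)] unfolding obstacle_arc_def clique_gap_def by auto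
      consider "a \<in> range v" "b \<in> range v" | "a \<in> range v" "b \<in> wit" | "a \<in> wit" "b \<in> range v" | "a \<in> wit" "b \<in> wit"
        using a b(1) by blast
      then show "E a b"
      proof cases
        case 1
        then show ?thesis using v_v b(2) by blast
      next
        case 2
        then show ?thesis using mixed[of b a] n b(1) sym by blast
      next
        case 3
        then show ?thesis using mixed[of a b] n a by blast
      next
        case 4
        then show ?thesis using adjacent_or_equal_linked[OF 4 _ _ b(2)] n wit_not_v unfolding obstacle_arc_def by auto
      qed
    qed
  qed
qed

section \<open>Triangles of witnesses\<close>

lemma triangle_no_two:
  assumes b: "b = L (i - 1)" and c: "c = H (i + 1)" and two: "H i = L i"
    and E: "E (H i) b" "E (H i) c" "E b c"
  shows False
proof -
  have wit: "b \<in> wit" "c \<in> wit" unfolding wit_def b c by auto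
  have nb: "H (i - 1) \<noteq> L (i - 1)" using two_not_adj[OF two, of "i - 1"] E(1) b by auto
  have nc: "H (i + 1) \<noteq> L (i + 1)" using two_not_adj[OF two, of "i + 1"] E(2) c by auto
  have Eb: "E b (v j) \<longleftrightarrow> v j \<noteq> v i" for j using L_v[of "i - 1" j] nb b by simp
  have Ec: "E c (v j) \<longleftrightarrow> v j \<noteq> v (i + 1)" for j using H_v[of "i + 1" j] nc c by simp
  \<comment> \<open>\<open>b\<close> misses only \<open>v i\<close> and \<open>c\<close> only
    \<open>v (i + 1)\<close>, so the edge can be valid only through a common enumeration. One order
    of that pair identifies \<open>b\<close> with \<open>H i\<close>, the other would make
    \<open>v (i + 2)\<close> equal to \<open>v i\<close>.\<close>
  have "\<not> (\<forall>j. E c (v j) \<longrightarrow> E b (v j))" "\<not> (\<forall>j. E b (v j) \<longrightarrow> E c (v j))"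
    unfolding Eb Ec using v_ne by blast+
  then obtain j where "{b, c} = {H j, L j}" using essential[of b c] wit E(3) unfolding wit_def by blast
  then consider "b = H j" "c = L j" | "b = L j" "c = H j" by (metis doubleton_eq_iff)
  then show False
  proof cases
    case 1
    then have "v j = v i" using Eb[of j] H_v[of j j] by blast
    then have "H j = H i" by (rule H_cong)
    then show False using 1 E(1) irrefl by metis
  next
    case 2
    then have "v (j + 1) = v i" "v j = v (i + 1)" using Eb[of "j + 1"] Ec[of j] H_v[of j j] L_v[of j "j + 1"] by auto
    then have "v (i + 2) = v i" using v_shift[of j 1 "i + 1"] by (simp add: add.assoc)
    then show False using v_ne by blast
  qed
qed

text \<open>If \<open>a\<close> and \<open>b\<close> missed the same vertex
  \<open>v \<alpha>\<close>, the pairs containing \<open>c\<close> would place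
  \<open>v \<gamma>\<close> both directly before and directly after it, which
  \<open>3 \<le> k\<close> excludes.\<close>

lemma triangle_types_distinct:
  assumes a: "a = L (\<alpha> - 1)" and b: "b = H \<alpha>"
    and ta: "\<And>j. E a (v j) \<longleftrightarrow> v j \<noteq> v \<alpha>" and tb: "\<And>j. E b (v j) \<longleftrightarrow> v j \<noteq> v \<alpha>"
    and tc: "\<And>j. E c (v j) \<longleftrightarrow> v j \<noteq> v \<gamma>"
    and ne: "a \<noteq> b" and ac: "{a, c} = {H i, L i}" and bc: "{b, c} = {H j, L j}"
  shows False
proof -
  have "a \<noteq> H i"
  proof
    assume "a = H i"
    then have "v i = v \<alpha>" using ta[of i] H_v[of i i] by blast
    then show False using H_cong \<open>a = H i\<close> b ne by metis
  qed
  then have i: "a = L i" "c = H i" using ac by (metis doubleton_eq_iff)+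
  have "b \<noteq> L j"
  proof
    assume "b = L j"
    then have "v (j + 1) = v \<alpha>" using tb[of "j + 1"] L_v[of j "j + 1"] by blast
    then have "v j = v (\<alpha> - 1)" using v_shift[of j 1 "\<alpha> - 1"] by simp
    then show False using L_cong \<open>b = L j\<close> a ne by metis
  qed
  then have j: "b = H j" "c = L j" using bc by (metis doubleton_eq_iff)+
  have "v (i + 1) = v \<alpha>" "v i = v \<gamma>" "v j = v \<alpha>" "v (j + 1) = v \<gamma>"
    using ta[of "i + 1"] tc[of i] tb[of j] tc[of "j + 1"] i j H_v[of i i] L_v[of i "i + 1"] H_v[of j j] L_v[of j "j + 1"] by auto
  then have "v (i + 2) = v i" using v_shift[of "i + 1" 1 j] by (simp add: add.assoc)
  then show False using v_ne by blast
qed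

text \<open>The last witness of each of the three edges is the first one of the next, so the index
  advances by one each time and returns after three steps. Every \<open>n\<close> agrees with one of
  the three indices modulo \<open>3\<close>.\<close>

lemma triangle_oriented:
  assumes "a = H i" "b = L i" "b = H j" "c = L j" "c = H l" "a = L l"
    and ne: "H i \<noteq> L i" "H j \<noteq> L j" "H l \<noteq> L l"
  shows "k = 3 \<and> (\<forall>n. L n = H (n + 1) \<and> H n \<noteq> L n)"
proof -
  have ji: "v j = v (i + 1)" using H_eq_L[of j i] assms by auto
  have lj: "v l = v (j + 1)" using H_eq_L[of l j] assms by auto
  have il: "v i = v (l + 1)" using H_eq_L[of i l] assms by auto
  have li: "v l = v (i + 2)" using ji lj v_shift[of j 1 "i + 1"] by (simp add: add.assoc)
  have ii: "v i = v (i + 3)" using il li v_shift[of l 1 "i + 2"] by (simp add: add.assoc)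
  have k3: "k = 3"
  proof (rule ccontr)
    assume "k \<noteq> 3"
    then show False using v_near[OF ii] k by simp
  qed
  have "L n = H (n + 1) \<and> H n \<noteq> L n" for n
  proof -
    have key: "L n = H (n + 1) \<and> H n \<noteq> L n" if "v n = v p" "L p = H q" "v q = v (p + 1)" "H p \<noteq> L p" for p q
    proof -
      have "v (n + 1) = v q" using that v_shift by simp
      then show ?thesis using that H_cong L_cong by metis
    qed
    define r where "r = (n - i) mod 3"
    have n: "i + r = n + (- ((n - i) div 3)) * k" unfolding r_def k3 by (simp add: minus_mult_div_eq_mod[symmetric])
    then have vn: "v n = v (i + r)" unfolding v_eq by blast
    have "r = 0 \<or> r = 1 \<or> r = 2" unfolding r_def by presburger
    then have "v n = v i \<or> v n = v j \<or> v n = v l" using vn ji li by auto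
    then show ?thesis using key[of i j] key[of j l] key[of l i] assms ji lj il by metis
  qed
  then show ?thesis using k3 by blast
qed

text \<open>No corner misses two clique vertices and no two corners miss the same one. The edges of
  the triangle are then incomparable, hence all of the form \<open>H i\<close>, \<open>L i\<close>.
  What results is the octahedron: three clique vertices, three witnesses, each witness missing one
  clique vertex.\<close>

lemma triangle_octahedron:
  assumes w: "a \<in> wit" "b \<in> wit" "c \<in> wit" and E: "E a b" "E a c" "E b c"
    and ne: "a \<noteq> b" "a \<noteq> c" "b \<noteq> c"
  shows "k = 3 \<and> (\<forall>n. L n = H (n + 1) \<and> H n \<noteq> L n)"
proof -
  have no_two: False if h: "x = H i" "x = L i" "E x y" "E x z" "E y z" "y \<in> wit" "z \<in> wit" "y \<noteq> z" for x y z i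
  proof -
    have "y = L (i - 1) \<or> y = H (i + 1)" "z = L (i - 1) \<or> z = H (i + 1)"
      using no_adj_to_two[of i y] no_adj_to_two[of i z] h by metis+
    then consider "y = L (i - 1)" "z = H (i + 1)" | "z = L (i - 1)" "y = H (i + 1)" using h(8) by blast
    then show False
    proof cases
      case 1
      then show False using triangle_no_two[OF 1] h by metis
    next
      case 2
      then show False using triangle_no_two[OF 2] h sym by metis
    qed
  qed
  have nt: "\<not> (a = H i \<and> a = L i)" "\<not> (b = H i \<and> b = L i)" "\<not> (c = H i \<and> c = L i)" for i
    using no_two[of a i b c] no_two[of b i a c] no_two[of c i a b] w E ne sym by metis+
  obtain \<alpha> where a: "\<And>j. E a (v j) \<longleftrightarrow> v j \<noteq> v \<alpha>" "a = H \<alpha> \<or> a = L (\<alpha> - 1)"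
    using w(1) nt(1) by (cases rule: wit_cases) blast+
  obtain \<beta> where b: "\<And>j. E b (v j) \<longleftrightarrow> v j \<noteq> v \<beta>" "b = H \<beta> \<or> b = L (\<beta> - 1)"
    using w(2) nt(2) by (cases rule: wit_cases) blast+
  obtain \<gamma> where c: "\<And>j. E c (v j) \<longleftrightarrow> v j \<noteq> v \<gamma>" "c = H \<gamma> \<or> c = L (\<gamma> - 1)"
    using w(3) nt(3) by (cases rule: wit_cases) blast+
  have HL: "\<exists>i. {x, y} = {H i, L i}"
    if "x \<in> wit" "y \<in> wit" "E x y" "\<And>j. E x (v j) \<longleftrightarrow> v j \<noteq> v p" "\<And>j. E y (v j) \<longleftrightarrow> v j \<noteq> v q" "v p \<noteq> v q" for x y p q
    using essential[of x y] that unfolding wit_def by metis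
  have same: "H p = H q \<and> L (p - 1) = L (q - 1)" if "v p = v q" for p q
    using that H_cong[of p q] L_cong[of "p + - 1" "q + - 1"] v_shift[of p "- 1" q] by simp
  have dist: "v p \<noteq> v q"
    if xyz: "x \<in> wit" "y \<in> wit" "z \<in> wit" "E x z" "E y z" "x \<noteq> y" "x \<noteq> z" "y \<noteq> z"
      and x: "\<And>j. E x (v j) \<longleftrightarrow> v j \<noteq> v p" "x = H p \<or> x = L (p - 1)"
      and y: "\<And>j. E y (v j) \<longleftrightarrow> v j \<noteq> v q" "y = H q \<or> y = L (q - 1)"
      and z: "\<And>j. E z (v j) \<longleftrightarrow> v j \<noteq> v r" "z = H r \<or> z = L (r - 1)"
    for x y z p q r
  proof
    assume pq: "v p = v q"
    have y': "\<And>j. E y (v j) \<longleftrightarrow> v j \<noteq> v p" "y = H p \<or> y = L (p - 1)" using y same[OF pq] pq by auto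
    have "v p \<noteq> v r" using same[of p r] x(2) y'(2) z(2) xyz(6-8) by metis
    then obtain i j where ij: "{x, z} = {H i, L i}" "{y, z} = {H j, L j}"
      using HL[OF xyz(1,3,4) x(1) z(1)] HL[OF xyz(2,3,5) y'(1) z(1)] by blast
    consider "x = L (p - 1)" "y = H p" | "y = L (p - 1)" "x = H p" using x(2) y'(2) xyz(6) by blast
    then show False
    proof cases
      case 1
      then show False using triangle_types_distinct[OF 1 x(1) y'(1) z(1) xyz(6) ij] by blast
    next
      case 2
      then show False using triangle_types_distinct[OF 2 y'(1) x(1) z(1) xyz(6)[symmetric] ij(2,1)] by blast
    qed
  qed
  have "v \<alpha> \<noteq> v \<beta>" using dist[OF w E(2,3) ne a b c] .
  then obtain i where i: "{a, b} = {H i, L i}" using HL[OF w(1,2) E(1) a(1) b(1)] by blast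
  have "v \<beta> \<noteq> v \<gamma>" using dist[OF w(2,3,1) sym[OF E(1)] sym[OF E(2)] ne(3) ne(1)[symmetric] ne(2)[symmetric] b c a] .
  then obtain j where j: "{b, c} = {H j, L j}" using HL[OF w(2,3) E(3) b(1) c(1)] by blast
  have "v \<alpha> \<noteq> v \<gamma>" using dist[OF w(1,3,2) E(1) sym[OF E(3)] ne(2,1) ne(3)[symmetric] a c b] .
  then obtain l where l: "{a, c} = {H l, L l}" using HL[OF w(1,3) E(2) a(1) c(1)] by blast
  have nei: "H i \<noteq> L i" "H j \<noteq> L j" "H l \<noteq> L l" using i j l ne by (metis doubleton_eq_iff)+
  have R: "v p = v q" if "H p = H q \<or> L p = L q" for p q using that H_eqD L_eqD by blast
  \<comment> \<open>A corner that is the first witness of two pairs, or the last of two, would force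
    the other two corners to coincide; so the three pairs are oriented cyclically.\<close>
  consider (1) "a = H i" "b = L i" "b = H j" "c = L j" "c = H l" "a = L l"
    | (2) "b = H i" "a = L i" "a = H l" "c = L l" "c = H j" "b = L j"
  proof -
    have ab: "a = H i \<and> b = L i \<or> b = H i \<and> a = L i" using i by (metis doubleton_eq_iff)
    have bc: "b = H j \<and> c = L j \<or> c = H j \<and> b = L j" using j by (metis doubleton_eq_iff)
    have ac: "a = H l \<and> c = L l \<or> c = H l \<and> a = L l" using l by (metis doubleton_eq_iff)
    have 1: "\<not> (a = H i \<and> b = L i \<and> a = H l \<and> c = L l)" using R[of i l] L_cong[of i l] ne(3) by auto
    have 2: "\<not> (b = H i \<and> a = L i \<and> b = H j \<and> c = L j)" using R[of i j] L_cong[of i j] ne(2) by auto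
    have 3: "\<not> (a = H i \<and> b = L i \<and> c = H j \<and> b = L j)" using R[of i j] H_cong[of i j] ne(2) by auto
    have 4: "\<not> (b = H i \<and> a = L i \<and> c = H l \<and> a = L l)" using R[of i l] H_cong[of i l] ne(3) by auto
    show ?thesis using ab bc ac 1 2 3 4 that by blast
  qed
  then show ?thesis
  proof cases
    case 1
    then show ?thesis using triangle_oriented[OF 1 nei] by blast
  next
    case 2
    then show ?thesis using triangle_oriented[OF 2 nei(1) nei(3) nei(2)] by blast
  qed
qed

section \<open>Deletion of a vertex\<close>

definition triangle_free :: "'a set \<Rightarrow> bool" where
  "triangle_free W \<longleftrightarrow> \<not> (\<exists>a\<in>W. \<exists>b\<in>W. \<exists>c\<in>W. a \<noteq> b \<and> a \<noteq> c \<and> b \<noteq> c \<and> E a b \<and> E a c \<and> E b c)"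

lemma triangle_free_subset: "triangle_free W \<Longrightarrow> W' \<subseteq> W \<Longrightarrow> triangle_free W'"
  unfolding triangle_free_def by (meson subsetD)

lemma helly_rep_obstacle_arc:
  assumes X: "X \<subseteq> wit" and V: "V \<subseteq> (range v \<union> wit) - X" and tri: "triangle_free (wit \<inter> V)"
    and proper: "\<not> range v \<subseteq> V \<or> X \<noteq> {}"
  shows "helly_rep V E (obstacle_arc X)"
  unfolding helly_rep_def
proof (intro allI impI)
  fix K assume K: "K \<subseteq> V" "\<forall>a\<in>K. \<forall>b\<in>K. a \<noteq> b \<longrightarrow> E a b"
  show "\<exists>t. \<forall>a\<in>K. t \<in> obstacle_arc X a"
  proof (rule clique_common_point[OF X])
    show "K \<subseteq> range v \<union> wit - X" using K(1) V by blast
    show "E a b" if "a \<in> K" "b \<in> K" "a \<noteq> b" for a b using K(2) that by blast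
    show "\<not> (\<exists>a b c. {a, b, c} \<subseteq> K \<inter> wit \<and> a \<noteq> b \<and> a \<noteq> c \<and> b \<noteq> c)"
    proof
      assume "\<exists>a b c. {a, b, c} \<subseteq> K \<inter> wit \<and> a \<noteq> b \<and> a \<noteq> c \<and> b \<noteq> c"
      then obtain a b c where abc: "a \<in> K \<inter> wit" "b \<in> K \<inter> wit" "c \<in> K \<inter> wit" "a \<noteq> b" "a \<noteq> c" "b \<noteq> c" by auto
      then have "E a b" "E a c" "E b c" using K(2) by blast+
      then show False using tri abc K(1) unfolding triangle_free_def by blast
    qed
    show "\<not> range v \<subseteq> K \<or> X \<noteq> {}" using proper K(1) by blast
  qed
qed

text \<open>A triangle among the remaining witnesses would force the octahedron, which has just
  three witnesses, while \<open>x\<close> would be a fourth.\<close>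

lemma remove_witness_helly:
  assumes x: "x \<in> wit"
  shows "arc_rep ((range v \<union> wit) - {x}) E (4 * k) (obstacle_arc {x}) \<and>
    helly_rep ((range v \<union> wit) - {x}) E (obstacle_arc {x})"
proof -
  have "triangle_free (wit - {x})"
    unfolding triangle_free_def
  proof (intro notI, elim bexE conjE)
    fix a b c assume abc: "a \<in> wit - {x}" "b \<in> wit - {x}" "c \<in> wit - {x}" "a \<noteq> b" "a \<noteq> c" "b \<noteq> c" "E a b" "E a c" "E b c"
    then have oct: "k = 3" "\<And>n. L n = H (n + 1)" using triangle_octahedron[of a b c] by blast+
    have "wit \<subseteq> {H 0, H 1, H 2}"
    proof -
      have "H n \<in> {H 0, H 1, H 2}" for n
      proof -
        have "n mod 3 = n + (- (n div 3)) * k" unfolding oct(1) by (simp add: minus_mult_div_eq_mod[symmetric])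
        then have "H n = H (n mod 3)" using H_per by metis
        moreover have "n mod 3 = 0 \<or> n mod 3 = 1 \<or> n mod 3 = 2" by presburger
        ultimately show ?thesis by auto
      qed
      then show ?thesis unfolding wit_def using oct(2) by auto
    qed
    then have sub: "{a, b, c, x} \<subseteq> {H 0, H 1, H 2}" using abc x by blast
    have "card {a, b, c, x} = 4" using abc by auto
    moreover have "card {a, b, c, x} \<le> card {H 0, H 1, H 2}" using sub by (intro card_mono) auto
    moreover have "card {H 0, H 1, H 2} \<le> 3" by (metis card.empty card_insert_le_m1 finite.emptyI finite_insert diff_Suc_1 numeral_3_eq_3 zero_less_Suc le_refl)
    ultimately show False by simp
  qed
  then have "triangle_free (wit \<inter> ((range v \<union> wit) - {x}))" by (rule triangle_free_subset) blast
  then have "helly_rep ((range v \<union> wit) - {x}) E (obstacle_arc {x})"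
    using x by (intro helly_rep_obstacle_arc) auto
  then show ?thesis using obstacle_arc_rep[of "{x}"] x by simp
qed

text \<open>Non-adjacency matches \<open>v n\<close> with \<open>H n\<close>, so either triangle may
  serve as the clique. The edge from \<open>H i\<close> to \<open>H (i + 1)\<close> then has the
  witnesses \<open>v i\<close> and \<open>v (i + 1)\<close>.\<close>

lemma octahedron_swap:
  assumes oct: "k = 3" "\<And>n. L n = H (n + 1) \<and> H n \<noteq> L n"
  shows "cyclic_obstacle k H v (\<lambda>i. v (i + 1)) E"
proof
  show "3 \<le> k" by (rule k)
  show "H i = H j \<longleftrightarrow> (\<exists>c. j = i + c * k)" for i j using H_eqD H_cong v_eq by metis
  show "v (i + c * k) = v i" for i c using v_eq by metis
  show "v (i + c * k + 1) = v (i + 1)" for i c unfolding v_shift using v_eq by metis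
  show "E x y \<Longrightarrow> E y x" for x y by (rule sym)
  show "\<not> E x x" for x by (rule irrefl)
  have res: "\<exists>c. j - i = c * k \<or> j - i = 1 + c * k \<or> i - j = 1 + c * k" for i j
  proof -
    have "j - i = ((j - i) div 3) * k \<or> j - i = 1 + ((j - i) div 3) * k \<or>
        i - j = 1 + (- ((j - i) div 3) - 1) * k"
      unfolding oct(1) by presburger
    then show ?thesis by blast
  qed
  have near: "v j = v i \<or> v j = v (i + 1) \<or> v i = v (j + 1)" for i j
  proof -
    obtain c where "j = i + c * k \<or> j = (i + 1) + c * k \<or> i = (j + 1) + c * k" using res[of j i] by (metis add.assoc add.commute diff_eq_eq)
    then have "v i = v j \<or> v (i + 1) = v j \<or> v (j + 1) = v i" unfolding v_eq by metis
    then show ?thesis by metis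
  qed
  show "E (H i) (H j)" if "H i \<noteq> H j" for i j
  proof -
    have "v i \<noteq> v j" using that H_cong by blast
    then consider "v j = v (i + 1)" | "v i = v (j + 1)" using near[of j i] by auto
    then show ?thesis
    proof cases
      case 1
      then show ?thesis using H_L[of i] oct(2) H_cong by metis
    next
      case 2
      then show ?thesis using H_L[of j] oct(2) H_cong sym by metis
    qed
  qed
  have HH: "H j = H i \<longleftrightarrow> v j = v i" for i j using H_cong H_eqD by blast
  have vH: "E (v i) (H j) \<longleftrightarrow> v i \<noteq> v j" for i j using H_v[of j i] oct(2) sym by blast
  show "E (v i) (H j) \<longleftrightarrow> H j \<noteq> H i \<and> (v i = v (i + 1) \<longrightarrow> H j \<noteq> H (i + 1))" for i j
    unfolding vH HH using v_ne by auto
  show "E (v (i + 1)) (H j) \<longleftrightarrow> H j \<noteq> H (i + 1) \<and> (v i = v (i + 1) \<longrightarrow> H j \<noteq> H i)" for i j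
    unfolding vH HH using v_ne by auto
  show "E (v i) (v (i + 1))" if "v i \<noteq> v (i + 1)" for i using v_v that by blast
  show "v i \<noteq> H j" "v (i + 1) \<noteq> H j" for i j using H_not_v by metis+
  fix y z assume "y \<in> range v \<union> range (\<lambda>i. v (i + 1))" "z \<in> range v \<union> range (\<lambda>i. v (i + 1))" "E y z"
  then obtain i j where ij: "y = v i" "z = v j" "v i \<noteq> v j" using irrefl by fastforce
  then have "{y, z} = {v i, v (i + 1)} \<or> {y, z} = {v j, v (j + 1)}" using near[of j i] by auto
  then show "(\<forall>j. E z (H j) \<longrightarrow> E y (H j)) \<or> (\<forall>j. E y (H j) \<longrightarrow> E z (H j)) \<or> (\<exists>i. {y, z} = {v i, v (i + 1)})"
    by blast
qed

lemma remove_vertex_helly: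
  assumes x: "x \<in> range v \<union> wit"
  obtains A :: "'a \<Rightarrow> int set" where "arc_rep ((range v \<union> wit) - {x}) E (4 * k) A"
    "helly_rep ((range v \<union> wit) - {x}) E A"
proof (cases "x \<in> wit")
  case True
  then show ?thesis using that remove_witness_helly by blast
next
  case False
  then have xv: "x \<in> range v" using x by blast
  show ?thesis
  proof (cases "triangle_free wit")
    case True
    have "arc_rep ((range v \<union> wit) - {}) E (4 * k) (obstacle_arc {})" by (rule obstacle_arc_rep) simp
    then have "arc_rep ((range v \<union> wit) - {x}) E (4 * k) (obstacle_arc {})" by (rule arc_rep_subset) auto
    moreover have "helly_rep ((range v \<union> wit) - {x}) E (obstacle_arc {})"
      using xv triangle_free_subset[OF True, of "wit \<inter> _"] by (intro helly_rep_obstacle_arc) auto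
    ultimately show ?thesis using that by blast
  next
    case False
    then obtain a b c where "a \<in> wit" "b \<in> wit" "c \<in> wit" "a \<noteq> b" "a \<noteq> c" "b \<noteq> c" "E a b" "E a c" "E b c"
      unfolding triangle_free_def by blast
    then have oct: "k = 3" "\<And>n. L n = H (n + 1) \<and> H n \<noteq> L n" using triangle_octahedron[of a b c] by blast+
    interpret S: cyclic_obstacle k H v "\<lambda>i. v (i + 1)" E using oct by (rule octahedron_swap)
    have "S.wit = range v" unfolding S.wit_def by auto
    moreover have "wit = range H" unfolding wit_def using oct(2) by auto
    ultimately have eq: "range H \<union> S.wit = range v \<union> wit" "x \<in> S.wit" using xv by auto
    show ?thesis using that S.remove_witness_helly[OF eq(2)] unfolding eq(1) by blast
  qed
qed

end

text \<open>Reading the lists modulo their length turns the cyclic successor into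
  \<open>i + 1\<close>. \<open>hd\<close> and \<open>last\<close> encode both kinds of enumeration:
  they coincide exactly for a single witness, since the two members of a pair miss different
  vertices.\<close>

lemma essential_cyclic_obstacle:
  fixes G vs Ws
  defines "idx \<equiv> \<lambda>i. nat (i mod int (length vs))"
  defines "v \<equiv> \<lambda>i. vs ! idx i" and "H \<equiv> \<lambda>i. hd (Ws ! idx i)" and "L \<equiv> \<lambda>i. last (Ws ! idx i)"
  assumes G: "Digraph.graph G" and ess: "essential_obstacle_enumeration_of G vs Ws"
  shows "cyclic_obstacle (int (length vs)) v H L (\<lambda>x y. x \<rightarrow>\<^bsub>G\<^esub> y)"
    and "range v \<union> (range H \<union> range L) = verts G"
proof -
  let ?E = "\<lambda>x y. x \<rightarrow>\<^bsub>G\<^esub> y"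
  let ?k = "length vs"
  let ?K = "int ?k"
  let ?Q = "set vs"
  have obs: "obstacle_enumeration_in G vs Ws" and cover: "verts G \<subseteq> ?Q \<union> witnesses Ws"
    and valid: "\<And>y1 y2. y1 \<in> witnesses Ws \<Longrightarrow> y2 \<in> witnesses Ws \<Longrightarrow> ?E y1 y2 \<Longrightarrow> valid_edge G vs Ws y1 y2"
    using ess unfolding essential_obstacle_enumeration_of_def obstacle_enumeration_of_def by auto
  note len = obstacle_length[OF obs]
  have QV: "?Q \<subseteq> verts G" and clq: "clique G ?Q" using obs unfolding obstacle_enumeration_in_def clique_def by auto
  have idx: "idx i < ?k" "int (idx i) = i mod ?K" for i
  proof -
    have "0 < ?K" using len(1) by linarith
    then have "0 \<le> i mod ?K" "i mod ?K < ?K" by simp_all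
    then show "idx i < ?k" "int (idx i) = i mod ?K" unfolding idx_def by (simp_all add: nat_less_iff)
  qed
  have idx_per: "idx (i + c * ?K) = idx i" for i c unfolding idx_def by simp
  have idx_Suc: "idx (i + 1) = (idx i + 1) mod ?k" for i
  proof -
    have "int (idx (i + 1)) = int ((idx i + 1) mod ?k)"
      unfolding idx(2) zmod_int of_nat_add of_nat_1 by (simp add: mod_add_left_eq)
    then show ?thesis by simp
  qed
  have idx_int: "idx (int n) = n" if "n < ?k" for n unfolding idx_def using that by simp
  have v_eq: "v i = v j \<longleftrightarrow> (\<exists>c. j = i + c * ?K)" for i j
  proof
    assume "v i = v j"
    then have "idx i = idx j" unfolding v_def using obstacle_nth_eq[OF obs idx(1) idx(1)] by blast
    then have "i mod ?K = j mod ?K" using idx(2) by metis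
    then have "j = i + (j div ?K - i div ?K) * ?K" by (metis add_diff_cancel_left' add_diff_eq diff_add_cancel left_diff_distrib mod_div_mult_eq add.commute)
    then show "\<exists>c. j = i + c * ?K" ..
  next
    assume "\<exists>c. j = i + c * ?K"
    then show "v i = v j" unfolding v_def using idx_per by metis
  qed
  have vQ: "v i \<in> ?Q" for i unfolding v_def using idx(1) by simp
  have v_ne: "v i \<noteq> v (i + 1)" for i
  proof -
    have "(idx i + 1) mod ?k \<noteq> idx i" using idx(1)[of i] len(1) by (auto simp: mod_Suc)
    then show ?thesis unfolding v_def idx_Suc using obstacle_nth_eq[OF obs idx(1) len(3)] by metis
  qed
  have W: "witness_enumeration G ?Q (v i) (v (i + 1)) (Ws ! idx i)" for i
    unfolding v_def idx_Suc using obs idx(1) unfolding obstacle_enumeration_in_def by blast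
  have Wcases: "(H i = L i \<and> non_neighbours G (H i) \<inter> ?Q = {v i, v (i + 1)}) \<or>
      (H i \<noteq> L i \<and> ?E (H i) (L i) \<and> non_neighbours G (H i) \<inter> ?Q = {v i} \<and> non_neighbours G (L i) \<inter> ?Q = {v (i + 1)})"
    and Wset: "set (Ws ! idx i) = {H i, L i}" for i
  proof -
    consider (O1) w where "Ws ! idx i = [w]" "non_neighbours G w \<inter> ?Q = {v i, v (i + 1)}"
      | (O2) u z where "Ws ! idx i = [u, z]" "non_neighbours G u \<inter> ?Q = {v i}" "non_neighbours G z \<inter> ?Q = {v (i + 1)}" "?E u z"
      using W unfolding witness_enumeration_def by blast
    then have "((H i = L i \<and> non_neighbours G (H i) \<inter> ?Q = {v i, v (i + 1)}) \<or>
      (H i \<noteq> L i \<and> ?E (H i) (L i) \<and> non_neighbours G (H i) \<inter> ?Q = {v i} \<and> non_neighbours G (L i) \<inter> ?Q = {v (i + 1)})) \<and>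
      set (Ws ! idx i) = {H i, L i}"
    proof cases
      case O1
      then show ?thesis unfolding H_def L_def by simp
    next
      case O2
      then have "u \<noteq> z" using v_ne[of i] by auto
      then show ?thesis using O2 unfolding H_def L_def by simp
    qed
    then show "(H i = L i \<and> non_neighbours G (H i) \<inter> ?Q = {v i, v (i + 1)}) \<or>
      (H i \<noteq> L i \<and> ?E (H i) (L i) \<and> non_neighbours G (H i) \<inter> ?Q = {v i} \<and> non_neighbours G (L i) \<inter> ?Q = {v (i + 1)})"
      and "set (Ws ! idx i) = {H i, L i}" by blast+
  qed
  have nnH: "non_neighbours G (H i) \<inter> ?Q = (if H i = L i then {v i, v (i + 1)} else {v i})"
    and nnL: "non_neighbours G (L i) \<inter> ?Q = (if H i = L i then {v i, v (i + 1)} else {v (i + 1)})" for i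
    using Wcases[of i] by (simp_all split: if_split) metis+
  have wits: "witnesses Ws = range H \<union> range L"
  proof
    show "witnesses Ws \<subseteq> range H \<union> range L"
    proof
      fix y assume "y \<in> witnesses Ws"
      then obtain j where "j < ?k" "y \<in> set (Ws ! j)"
        using len(2) unfolding witnesses_def by (metis UN_E in_set_conv_nth)
      then have "y \<in> {H (int j), L (int j)}" using Wset[of "int j"] idx_int by simp
      then show "y \<in> range H \<union> range L" by blast
    qed
    have "{H i, L i} \<subseteq> witnesses Ws" for i
      using Wset[of i] idx(1)[of i] len(2) unfolding witnesses_def by (metis UN_upper nth_mem)
    then show "range H \<union> range L \<subseteq> witnesses Ws" by blast
  qed
  have ranv: "range v = ?Q"
  proof
    show "range v \<subseteq> ?Q" using vQ by blast
    show "?Q \<subseteq> range v"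
    proof
      fix x assume "x \<in> ?Q"
      then obtain j where "j < ?k" "x = vs ! j" by (metis in_set_conv_nth)
      then have "x = v (int j)" unfolding v_def using idx_int by simp
      then show "x \<in> range v" by blast
    qed
  qed
  have witV: "y \<notin> ?Q" "y \<in> verts G" if "y \<in> range H \<union> range L" for y
    using witness_not_in_clique[OF obs] that unfolding wits by blast+
  show "range v \<union> (range H \<union> range L) = verts G"
    using cover witV(2) QV unfolding ranv wits by blast
  have nn: "?E y (v j) \<longleftrightarrow> v j \<notin> non_neighbours G y \<inter> ?Q" if "y \<in> range H \<union> range L" for y j
    using witV[OF that] vQ[of j] QV unfolding non_neighbours_def by auto
  show "cyclic_obstacle ?K v H L ?E"
  proof
    show "3 \<le> ?K" using len(1) by simp
    show "v i = v j \<longleftrightarrow> (\<exists>c. j = i + c * ?K)" for i j by (rule v_eq)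
    show "H (i + c * ?K) = H i" "L (i + c * ?K) = L i" for i c unfolding H_def L_def idx_per by simp_all
    show "?E x y \<Longrightarrow> ?E y x" "\<not> ?E x x" for x y using graph_adj[OF G] by metis+
    show "v i \<noteq> v j \<Longrightarrow> ?E (v i) (v j)" for i j using clq vQ unfolding clique_def by blast
    show "?E (H i) (v j) \<longleftrightarrow> v j \<noteq> v i \<and> (H i = L i \<longrightarrow> v j \<noteq> v (i + 1))" for i j
      unfolding nn[OF UnI1[OF rangeI]] nnH by simp
    show "?E (L i) (v j) \<longleftrightarrow> v j \<noteq> v (i + 1) \<and> (H i = L i \<longrightarrow> v j \<noteq> v i)" for i j
      unfolding nn[OF UnI2[OF rangeI]] nnL by simp blast
    show "H i \<noteq> L i \<Longrightarrow> ?E (H i) (L i)" for i using Wcases[of i] by blast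
    show "H i \<noteq> v j" "L i \<noteq> v j" for i j using witV(1)[of "H i"] witV(1)[of "L i"] vQ[of j] by auto
    fix y z assume y: "y \<in> range H \<union> range L" and z: "z \<in> range H \<union> range L" and E: "?E y z"
    have ne: "y \<noteq> z" using E graph_adj(2)[OF G] by metis
    have "valid_edge G vs Ws y z" using valid y z E unfolding wits by blast
    then consider "non_neighbours G y \<inter> ?Q \<subseteq> non_neighbours G z \<inter> ?Q"
      | "non_neighbours G z \<inter> ?Q \<subseteq> non_neighbours G y \<inter> ?Q"
      | ws where "ws \<in> set Ws" "y \<in> set ws" "z \<in> set ws" unfolding valid_edge_def by blast
    then show "(\<forall>j. ?E z (v j) \<longrightarrow> ?E y (v j)) \<or> (\<forall>j. ?E y (v j) \<longrightarrow> ?E z (v j)) \<or> (\<exists>i. {y, z} = {H i, L i})"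
    proof cases
      case 1
      then show ?thesis using nn[OF y] nn[OF z] by blast
    next
      case 2
      then show ?thesis using nn[OF y] nn[OF z] by blast
    next
      case 3
      then obtain j where "j < ?k" "ws = Ws ! j" using len(2) by (metis in_set_conv_nth)
      then have "set ws = {H (int j), L (int j)}" using Wset[of "int j"] idx_int by simp
      then have "{y, z} = {H (int j), L (int j)}" using 3 ne by auto
      then show ?thesis by blast
    qed
  qed
qed

text \<open>A proper induced subgraph lacks a vertex, and representations as well as their Helly
  property restrict to fewer vertices; so deleting single vertices settles minimality.\<close>

lemma essential_imp_circular_arc_minimal:
  assumes "essential_obstacle G"
  shows "circular_arc_graph G \<and> minimal_forbidden_induced_subgraph helly_circular_arc_graph G"
proof -
  let ?E = "\<lambda>x y. x \<rightarrow>\<^bsub>G\<^esub> y"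
  obtain vs Ws where G: "Digraph.graph G" and ess: "essential_obstacle_enumeration_of G vs Ws"
    using assms unfolding essential_obstacle_def by blast
  have fin: "finite (verts G)" by (rule graph_finite_verts[OF G])
  obtain k v H L where obs: "cyclic_obstacle k v H L ?E" and V: "range v \<union> (range H \<union> range L) = verts G"
    using essential_cyclic_obstacle[OF G ess] by blast
  interpret O: cyclic_obstacle k v H L ?E by (rule obs)
  have V': "range v \<union> O.wit = verts G" using V unfolding O.wit_def .
  have "arc_rep (verts G) ?E (4 * k) (O.obstacle_arc {})" using O.obstacle_arc_rep[of "{}"] unfolding V' by simp
  then obtain X where "circular_arc_model G X" using arc_rep_realize fin by blast
  then have "circular_arc_graph G" using G unfolding circular_arc_graph_def by blast
  moreover have "\<not> helly_circular_arc_graph G"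
    using ess obstacle_not_helly_circular_arc_graph
    unfolding essential_obstacle_enumeration_of_def obstacle_enumeration_of_def by blast
  moreover have "helly_circular_arc_graph S" if S: "induced_subgraph S G" "S \<noteq> G" for S
  proof -
    have SG: "verts S \<subseteq> verts G" using induced_verts[OF S(1)] .
    then obtain x where x: "x \<in> verts G" "x \<notin> verts S" using induced_eqI[OF S(1)] S(2) by blast
    obtain A :: "'a \<Rightarrow> int set" where A: "arc_rep (verts G - {x}) ?E (4 * k) A" "helly_rep (verts G - {x}) ?E A"
      using O.remove_vertex_helly[of x] x(1) unfolding V' by blast
    have sub: "verts S \<subseteq> verts G - {x}" using SG x(2) by blast
    have adj: "u \<rightarrow>\<^bsub>S\<^esub> w \<longleftrightarrow> ?E u w" if "u \<in> verts S" "w \<in> verts S" for u w by (rule induced_adj[OF S(1) that])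
    have "arc_rep (verts S) (\<lambda>x y. x \<rightarrow>\<^bsub>S\<^esub> y) (4 * k) A"
      using arc_rep_subset[OF A(1) sub] adj unfolding arc_rep_def by simp
    moreover have "finite (verts S)" using SG fin finite_subset by blast
    ultimately obtain X where X: "circular_arc_model S X"
      "helly_rep (verts S) (\<lambda>x y. x \<rightarrow>\<^bsub>S\<^esub> y) A \<Longrightarrow> helly_family (X ` verts S)"
      using arc_rep_realize by metis
    have "helly_rep (verts S) (\<lambda>x y. x \<rightarrow>\<^bsub>S\<^esub> y) A"
      unfolding helly_rep_def
    proof (intro allI impI)
      fix K assume K: "K \<subseteq> verts S" "\<forall>u\<in>K. \<forall>w\<in>K. u \<noteq> w \<longrightarrow> u \<rightarrow>\<^bsub>S\<^esub> w"
      then have "\<forall>u\<in>K. \<forall>w\<in>K. u \<noteq> w \<longrightarrow> ?E u w" using adj by (meson subsetD)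
      then show "\<exists>t. \<forall>u\<in>K. t \<in> A u" using helly_rep_subset[OF A(2) sub] K(1) unfolding helly_rep_def by simp
    qed
    then show ?thesis using X graph_induced[OF G S(1)] unfolding helly_circular_arc_graph_def by blast
  qed
  ultimately show ?thesis unfolding minimal_forbidden_induced_subgraph_def by blast
qed

theorem theorem2:
  fixes G :: "('a, 'b) pre_digraph"
  assumes "Digraph.graph G"
  shows "circular_arc_graph G \<and> minimal_forbidden_induced_subgraph helly_circular_arc_graph G \<longleftrightarrow>
         essential_obstacle G"
  using circular_arc_minimal_imp_essential essential_imp_circular_arc_minimal by blast

end
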